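(* For every integer $n\geq 1$, the skew fraction field $\mathbf{F}(\mathfrak{s}_n)$ of $U(\mathfrak{s}_n)$ is isomorphic to $\mathbf{F}_{\frac{n(n+1)}{2}}$.
   Context: All vector spaces and algebras are over $\mathbb{C}$; $U(\mathfrak{g})$ is the universal enveloping algebra of a Lie algebra $\mathfrak{g}$. For $n\ge 1$, $\mathfrak{s}_n=\mathfrak{gl}_n\ltimes\mathbb{C}^n$ is the semidirect product of $\mathfrak{gl}_n$ (with basis the matrix units $e_{ij}$, $1\le i,j\le n$) and its natural representation $\mathbb{C}^n$ (with standard basis $e_1,\dots,e_n$), so that $[e_{ij},e_{kl}]=\delta_{jk}e_{il}-\delta_{li}e_{kj}$, $[e_{ij},e_k]=\delta_{jk}e_i$, $[e_i,e_j]=0$. $\mathbf{F}(\mathfrak{g})$ denotes the skew field of fractions of $U(\mathfrak{g})$. For a nonnegative integer $r$, the Weyl algebra $\mathcal{D}_r$ is the subalgebra of $\mathrm{End}_{\mathbb{C}}(\mathbb{C}[x_1^{\pm1},\dots,x_r^{\pm1}])$ generated by $x_i,x_i^{-1},\frac{\partial}{\partial x_i}$, $1\le i\le r$; it is a Noetherian domain, and $\mathbf{F}_r$ denotes its skew field of fractions. Isomorphism means isomorphism of $\mathbb{C}$-algebras. *)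

theory Defs
  imports
    Complex_Main
    "HOL-Library.Poly_Mapping"
    "HOL-Library.FuncSet"
    "HOL-Algebra.QuotRing"
    "HOL-Algebra.Module"
    "Jordan_Normal_Form.Matrix"
begin

section \<open>Associative algebras over the complex numbers\<close>

text \<open>
  An associative unital algebra is a \<^type>\<open>module\<close> record, i.e. a ring record together with a
  scalar multiplication. (The library locale \<^locale>\<open>algebra\<close> is restricted to commutative
  algebras and is therefore not used.)
\<close>

definition alg_iso :: "(complex, 'a) module \<Rightarrow> (complex, 'b) module \<Rightarrow> ('a \<Rightarrow> 'b) set" where
  "alg_iso A B = {h \<in> ring_iso A B.
     \<forall>c. \<forall>x \<in> carrier A. h (c \<odot>\<^bsub>A\<^esub> x) = c \<odot>\<^bsub>B\<^esub> h x}"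

definition alg_isomorphic :: "(complex, 'a) module \<Rightarrow> (complex, 'b) module \<Rightarrow> bool" where
  "alg_isomorphic A B \<longleftrightarrow> alg_iso A B \<noteq> {}"

definition quotient_alg :: "(complex, 'a) module \<Rightarrow> 'a set \<Rightarrow> (complex, 'a set) module" where
  "quotient_alg A I =
    \<lparr>carrier = carrier (A Quot I),
     monoid.mult = monoid.mult (A Quot I),
     one = monoid.one (A Quot I),
     zero = ring.zero (A Quot I),
     add = ring.add (A Quot I),
     module.smult = (\<lambda>c X. \<Union>x\<in>X. I +>\<^bsub>A\<^esub> (c \<odot>\<^bsub>A\<^esub> x))\<rparr>"

inductive_set subalg_gen :: "(complex, 'a) module \<Rightarrow> 'a set \<Rightarrow> 'a set"
  for A :: "(complex, 'a) module" (structure) and S :: "'a set" where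
  gen: "x \<in> S \<Longrightarrow> x \<in> subalg_gen A S"
| one: "\<one> \<in> subalg_gen A S"
| add: "x \<in> subalg_gen A S \<Longrightarrow> y \<in> subalg_gen A S \<Longrightarrow> x \<oplus> y \<in> subalg_gen A S"
| mult: "x \<in> subalg_gen A S \<Longrightarrow> y \<in> subalg_gen A S \<Longrightarrow> x \<otimes> y \<in> subalg_gen A S"
| scale: "x \<in> subalg_gen A S \<Longrightarrow> c \<odot> x \<in> subalg_gen A S"


section \<open>The skew field of fractions of an Ore domain\<close>

text \<open>
  For an Ore domain \<open>R\<close>, the pair \<open>(a, s)\<close> with \<open>s \<noteq> \<zero>\<close> stands for the right fraction
  \<open>a s\<^sup>-\<^sup>1\<close>. Two pairs \<open>(a, s)\<close> and \<open>(b, t)\<close> are identified iff, after passing to some common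
  nonzero denominator \<open>s u = t v\<close>, they have the same numerator \<open>a u = b v\<close>;
  \<open>frac_class R a s\<close> is the equivalence class of \<open>(a, s)\<close>.

  The operations on classes are
  \<open>a s\<^sup>-\<^sup>1 + b t\<^sup>-\<^sup>1 = (a u + b v) (s u)\<^sup>-\<^sup>1\<close> whenever \<open>s u = t v \<noteq> \<zero>\<close>, and
  \<open>a s\<^sup>-\<^sup>1 \<cdot> b t\<^sup>-\<^sup>1 = (a u) (t v)\<^sup>-\<^sup>1\<close> whenever \<open>b v = s u\<close> and \<open>v \<noteq> \<zero>\<close>
  (so that \<open>s\<^sup>-\<^sup>1 b = u v\<^sup>-\<^sup>1\<close>).
  In an Ore domain the results do not depend on any of the choices, and hence, as for
  \<^const>\<open>rcoset_mult\<close>, each union below is a union of copies of one class.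
\<close>

definition frac_class :: "('a, 'm) ring_scheme \<Rightarrow> 'a \<Rightarrow> 'a \<Rightarrow> ('a \<times> 'a) set" where
  "frac_class R a s =
    {(b, t). b \<in> carrier R \<and> t \<in> carrier R - {\<zero>\<^bsub>R\<^esub>} \<and>
      (\<exists>u \<in> carrier R. \<exists>v \<in> carrier R.
         s \<otimes>\<^bsub>R\<^esub> u = t \<otimes>\<^bsub>R\<^esub> v \<and> s \<otimes>\<^bsub>R\<^esub> u \<noteq> \<zero>\<^bsub>R\<^esub> \<and> a \<otimes>\<^bsub>R\<^esub> u = b \<otimes>\<^bsub>R\<^esub> v)}"

definition frac_add :: "('a, 'm) ring_scheme \<Rightarrow> ('a \<times> 'a) set \<Rightarrow> ('a \<times> 'a) set \<Rightarrow> ('a \<times> 'a) set" where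
  "frac_add R X Y =
    \<Union>{frac_class R (a \<otimes>\<^bsub>R\<^esub> u \<oplus>\<^bsub>R\<^esub> b \<otimes>\<^bsub>R\<^esub> v) (s \<otimes>\<^bsub>R\<^esub> u) | a s b t u v.
        (a, s) \<in> X \<and> (b, t) \<in> Y \<and> u \<in> carrier R \<and> v \<in> carrier R \<and>
        s \<otimes>\<^bsub>R\<^esub> u = t \<otimes>\<^bsub>R\<^esub> v \<and> s \<otimes>\<^bsub>R\<^esub> u \<noteq> \<zero>\<^bsub>R\<^esub>}"

definition frac_mult :: "('a, 'm) ring_scheme \<Rightarrow> ('a \<times> 'a) set \<Rightarrow> ('a \<times> 'a) set \<Rightarrow> ('a \<times> 'a) set" where
  "frac_mult R X Y =
    \<Union>{frac_class R (a \<otimes>\<^bsub>R\<^esub> u) (t \<otimes>\<^bsub>R\<^esub> v) | a s b t u v.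
        (a, s) \<in> X \<and> (b, t) \<in> Y \<and> u \<in> carrier R \<and> v \<in> carrier R - {\<zero>\<^bsub>R\<^esub>} \<and>
        b \<otimes>\<^bsub>R\<^esub> v = s \<otimes>\<^bsub>R\<^esub> u}"

definition skew_fraction_field :: "(complex, 'a) module \<Rightarrow> (complex, ('a \<times> 'a) set) module" where
  "skew_fraction_field R =
    \<lparr>carrier = {frac_class R a s | a s. a \<in> carrier R \<and> s \<in> carrier R - {\<zero>\<^bsub>R\<^esub>}},
     monoid.mult = frac_mult R,
     one = frac_class R \<one>\<^bsub>R\<^esub> \<one>\<^bsub>R\<^esub>,
     zero = frac_class R \<zero>\<^bsub>R\<^esub> \<one>\<^bsub>R\<^esub>,
     add = frac_add R,
     module.smult = (\<lambda>c X. \<Union>(a, s) \<in> X. frac_class R (c \<odot>\<^bsub>R\<^esub> a) s)\<rparr>"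


section \<open>Free algebras\<close>

text \<open>
  Words form the free monoid, written additively because \<^type>\<open>poly_mapping\<close> carries the
  convolution product for an additive (not necessarily commutative) monoid of exponents.
  Hence \<open>'a word \<Rightarrow>\<^sub>0 complex\<close> is the free associative algebra on the type \<open>'a\<close>.
\<close>

datatype 'a word = Word (letters: "'a list")

instantiation word :: (type) monoid_add
begin

definition zero_word :: "'a word" where
  "zero_word = Word []"

definition plus_word :: "'a word \<Rightarrow> 'a word \<Rightarrow> 'a word" where
  "plus_word v w = Word (letters v @ letters w)"

instance
  by standard (simp_all add: zero_word_def plus_word_def)

end

definition free_alg :: "'a set \<Rightarrow> (complex, 'a word \<Rightarrow>\<^sub>0 complex) module" where
  "free_alg X =
    \<lparr>carrier = {p. \<forall>w \<in> Poly_Mapping.keys p. set (letters w) \<subseteq> X},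
     monoid.mult = (*),
     one = 1,
     zero = 0,
     add = (+),
     module.smult = (\<lambda>c p. Poly_Mapping.single 0 c * p)\<rparr>"

definition letter :: "'a \<Rightarrow> 'a word \<Rightarrow>\<^sub>0 complex" where
  "letter x = Poly_Mapping.single (Word [x]) 1"


section \<open>Lie algebras and their universal enveloping algebras\<close>

record 'g lie_alg = "'g partial_object" +
  lie_zero :: 'g
  lie_add :: "'g \<Rightarrow> 'g \<Rightarrow> 'g"
  lie_scale :: "complex \<Rightarrow> 'g \<Rightarrow> 'g"
  lie_bracket :: "'g \<Rightarrow> 'g \<Rightarrow> 'g"

locale lie_algebra =
  fixes G :: "'g lie_alg" (structure)
  assumes zero_closed: "lie_zero G \<in> carrier G"
    and add_closed: "x \<in> carrier G \<Longrightarrow> y \<in> carrier G \<Longrightarrow> lie_add G x y \<in> carrier G"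
    and scale_closed: "x \<in> carrier G \<Longrightarrow> lie_scale G c x \<in> carrier G"
    and bracket_closed: "x \<in> carrier G \<Longrightarrow> y \<in> carrier G \<Longrightarrow> lie_bracket G x y \<in> carrier G"
    and add_assoc: "x \<in> carrier G \<Longrightarrow> y \<in> carrier G \<Longrightarrow> z \<in> carrier G \<Longrightarrow>
      lie_add G (lie_add G x y) z = lie_add G x (lie_add G y z)"
    and add_commute: "x \<in> carrier G \<Longrightarrow> y \<in> carrier G \<Longrightarrow> lie_add G x y = lie_add G y x"
    and add_zero: "x \<in> carrier G \<Longrightarrow> lie_add G (lie_zero G) x = x"
    and add_neg: "x \<in> carrier G \<Longrightarrow> lie_add G (lie_scale G (- 1) x) x = lie_zero G"
    and scale_add_right: "x \<in> carrier G \<Longrightarrow> y \<in> carrier G \<Longrightarrow>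
      lie_scale G c (lie_add G x y) = lie_add G (lie_scale G c x) (lie_scale G c y)"
    and scale_add_left: "x \<in> carrier G \<Longrightarrow>
      lie_scale G (c + d) x = lie_add G (lie_scale G c x) (lie_scale G d x)"
    and scale_scale: "x \<in> carrier G \<Longrightarrow> lie_scale G c (lie_scale G d x) = lie_scale G (c * d) x"
    and scale_one: "x \<in> carrier G \<Longrightarrow> lie_scale G 1 x = x"
    and bracket_add_left: "x \<in> carrier G \<Longrightarrow> y \<in> carrier G \<Longrightarrow> z \<in> carrier G \<Longrightarrow>
      lie_bracket G (lie_add G x y) z = lie_add G (lie_bracket G x z) (lie_bracket G y z)"
    and bracket_scale_left: "x \<in> carrier G \<Longrightarrow> y \<in> carrier G \<Longrightarrow>
      lie_bracket G (lie_scale G c x) y = lie_scale G c (lie_bracket G x y)"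
    and bracket_add_right: "x \<in> carrier G \<Longrightarrow> y \<in> carrier G \<Longrightarrow> z \<in> carrier G \<Longrightarrow>
      lie_bracket G x (lie_add G y z) = lie_add G (lie_bracket G x y) (lie_bracket G x z)"
    and bracket_scale_right: "x \<in> carrier G \<Longrightarrow> y \<in> carrier G \<Longrightarrow>
      lie_bracket G x (lie_scale G c y) = lie_scale G c (lie_bracket G x y)"
    and bracket_self: "x \<in> carrier G \<Longrightarrow> lie_bracket G x x = lie_zero G"
    and jacobi: "x \<in> carrier G \<Longrightarrow> y \<in> carrier G \<Longrightarrow> z \<in> carrier G \<Longrightarrow>
      lie_add G (lie_bracket G x (lie_bracket G y z))
        (lie_add G (lie_bracket G y (lie_bracket G z x)) (lie_bracket G z (lie_bracket G x y))) =
      lie_zero G"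

text \<open>
  The first two families of relations make the free algebra on the underlying set of \<open>G\<close> into
  the tensor algebra of the vector space \<open>G\<close>; the third one imposes
  \<open>x y - y x = [x, y]\<close>.
\<close>

definition enveloping_relations :: "'g lie_alg \<Rightarrow> ('g word \<Rightarrow>\<^sub>0 complex) set" where
  "enveloping_relations G =
     {letter (lie_add G x y) - (letter x + letter y) | x y. x \<in> carrier G \<and> y \<in> carrier G} \<union>
     {letter (lie_scale G c x) - Poly_Mapping.single 0 c * letter x | c x. x \<in> carrier G} \<union>
     {letter x * letter y - letter y * letter x - letter (lie_bracket G x y) | x y.
        x \<in> carrier G \<and> y \<in> carrier G}"

definition enveloping_alg :: "'g lie_alg \<Rightarrow> (complex, ('g word \<Rightarrow>\<^sub>0 complex) set) module" where
  "enveloping_alg G =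
     quotient_alg (free_alg (carrier G)) (Idl\<^bsub>free_alg (carrier G)\<^esub> (enveloping_relations G))"


section \<open>The semidirect product of the general linear Lie algebra and its natural module\<close>

definition s_lie :: "nat \<Rightarrow> (complex mat \<times> complex vec) lie_alg" where
  "s_lie n =
    \<lparr>carrier = carrier_mat n n \<times> carrier_vec n,
     lie_zero = (0\<^sub>m n n, 0\<^sub>v n),
     lie_add = (\<lambda>(A, v) (B, w). (A + B, v + w)),
     lie_scale = (\<lambda>c (A, v). (c \<cdot>\<^sub>m A, c \<cdot>\<^sub>v v)),
     lie_bracket = (\<lambda>(A, v) (B, w). (A * B - B * A, A *\<^sub>v w - B *\<^sub>v v))\<rparr>"


lemma lie_algebra_s_lie: "lie_algebra (s_lie n)"
proof -
  note mat_distrib =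
    add_mult_distrib_mat[of _ n n _ _ n] mult_add_distrib_mat[of _ n n _ n]
    minus_mult_distrib_mat[of _ n n _ _ n] mult_minus_distrib_mat[of _ n n _ n]
    mult_smult_distrib[of _ n n _ n] mult_smult_assoc_mat[of _ n n _ n]
    assoc_mult_mat[of _ n n _ n _ n]
  note vec_distrib =
    add_mult_distrib_mat_vec[of _ n n] mult_add_distrib_mat_vec[of _ n n]
    minus_mult_distrib_mat_vec[of _ n n] mult_minus_distrib_mat_vec[of _ n n]
    mult_mat_vec[of _ n n] assoc_mult_mat_vec[of _ n n _ n]
  have [simp]: "A * B \<in> carrier_mat n n" "A - B \<in> carrier_mat n n"
    if "A \<in> carrier_mat n n" "B \<in> carrier_mat n n" for A B :: "complex mat"
    using that by (auto intro!: minus_carrier_mat)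
  have [simp]: "A *\<^sub>v v \<in> carrier_vec n"
    if "A \<in> carrier_mat n n" "v \<in> carrier_vec n" for A :: "complex mat" and v
    using that by simp
  have [simp]: "v - w \<in> carrier_vec n"
    if "v \<in> carrier_vec n" "w \<in> carrier_vec n" for v w :: "complex vec"
    using that by simp
  have [simp]: "1 \<cdot>\<^sub>m A = A" for A :: "complex mat"
    by (intro eq_matI) auto
  have smult_vec: "(c \<cdot>\<^sub>m A) *\<^sub>v v = c \<cdot>\<^sub>v (A *\<^sub>v v)"
    if "A \<in> carrier_mat n n" "v \<in> carrier_vec n" for A :: "complex mat" and v c
    using that by (intro eq_vecI) auto
  note expand = mat_distrib vec_distrib smult_vec
  have dims [simp]: "dim_row A = n" "dim_col A = n" if "A \<in> carrier_mat n n" for A :: "complex mat"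
    using that by auto
  have dim_v [simp]: "dim_vec v = n" if "v \<in> carrier_vec n" for v :: "complex vec"
    using that by auto
  show ?thesis
    by (unfold_locales;
      simp add: s_lie_def split_beta mem_Times_iff expand del: index_mult_mat(1) index_mult_mat_vec;
      (intro conjI eq_matI eq_vecI)?;
      (simp add: algebra_simps del: index_mult_mat(1) index_mult_mat_vec)?)
qed

definition s_lie_mat :: "nat \<Rightarrow> nat \<Rightarrow> nat \<Rightarrow> complex mat \<times> complex vec" where
  "s_lie_mat n i j = (mat n n (\<lambda>(a, b). if a = i \<and> b = j then 1 else 0), 0\<^sub>v n)"

definition s_lie_vec :: "nat \<Rightarrow> nat \<Rightarrow> complex mat \<times> complex vec" where
  "s_lie_vec n i = (0\<^sub>m n n, unit_vec n i)"

lemma s_lie_bracket_mat_mat: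
  assumes "i < n" "j < n" "k < n" "l < n"
  shows "lie_bracket (s_lie n) (s_lie_mat n i j) (s_lie_mat n k l) =
    lie_add (s_lie n)
      (lie_scale (s_lie n) (if j = k then 1 else 0) (s_lie_mat n i l))
      (lie_scale (s_lie n) (if l = i then - 1 else 0) (s_lie_mat n k j))"
proof -
  let ?E = "\<lambda>i j. mat n n (\<lambda>(a, b). if a = i \<and> b = j then 1 else 0) :: complex mat"
  have prod: "?E i j * ?E k l = (if j = k then 1 else 0) \<cdot>\<^sub>m ?E i l"
    if "i < n" "j < n" "k < n" "l < n" for i j k l
  proof (rule eq_matI)
    fix a b assume "a < dim_row ((if j = k then 1 else 0) \<cdot>\<^sub>m ?E i l)"
      "b < dim_col ((if j = k then 1 else 0) \<cdot>\<^sub>m ?E i l)"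
    then have ab: "a < n" "b < n" by simp_all
    then have "(?E i j * ?E k l) $$ (a, b) = (\<Sum>x = 0..<n. ?E i j $$ (a, x) * ?E k l $$ (x, b))"
      by (simp add: scalar_prod_def)
    also have "\<dots> = (\<Sum>x = 0..<n. (if x = j then if a = i \<and> x = k \<and> b = l then 1 else 0 else 0))"
      using ab by (intro sum.cong) simp_all
    also have "\<dots> = (if a = i \<and> j = k \<and> b = l then 1 else 0)"
      using that by (simp add: sum.delta)
    finally show "(?E i j * ?E k l) $$ (a, b) = ((if j = k then 1 else 0) \<cdot>\<^sub>m ?E i l) $$ (a, b)"
      using ab by simp
  qed simp_all
  show ?thesis
    using assms unfolding s_lie_def s_lie_mat_def by (auto simp: prod)
qed

lemma s_lie_bracket_mat_vec:
  assumes "i < n" "j < n" "k < n"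
  shows "lie_bracket (s_lie n) (s_lie_mat n i j) (s_lie_vec n k) =
    lie_scale (s_lie n) (if j = k then 1 else 0) (s_lie_vec n i)"
  using assms unfolding s_lie_def s_lie_mat_def s_lie_vec_def
  by auto

lemma s_lie_bracket_vec_vec:
  "lie_bracket (s_lie n) (s_lie_vec n i) (s_lie_vec n j) = lie_zero (s_lie n)"
  unfolding s_lie_def s_lie_vec_def by auto

section \<open>Weyl algebras of Laurent differential operators\<close>

text \<open>
  A Laurent monomial is its finitely supported exponent function; the variables
  \<open>x\<^sub>1, \<dots>, x\<^sub>r\<close> carry the indices \<open>0, \<dots>, r - 1\<close>.
\<close>

type_synonym laurent = "(nat \<Rightarrow>\<^sub>0 int) \<Rightarrow>\<^sub>0 complex"

definition laurent_polys :: "nat \<Rightarrow> laurent set" where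
  "laurent_polys r = {p. \<forall>m \<in> Poly_Mapping.keys p. Poly_Mapping.keys m \<subseteq> {..<r}}"

text \<open>
  Endomorphisms are extensional functions, i.e. \<^const>\<open>undefined\<close> outside of the space, so that
  equality of functions is equality of endomorphisms.
\<close>

definition laurent_end :: "nat \<Rightarrow> (complex, laurent \<Rightarrow> laurent) module" where
  "laurent_end r =
    \<lparr>carrier = {f \<in> laurent_polys r \<rightarrow>\<^sub>E laurent_polys r.
        (\<forall>p \<in> laurent_polys r. \<forall>q \<in> laurent_polys r. f (p + q) = f p + f q) \<and>
        (\<forall>c. \<forall>p \<in> laurent_polys r.
           f (Poly_Mapping.single 0 c * p) = Poly_Mapping.single 0 c * f p)},
     monoid.mult = (\<lambda>f g. \<lambda>p \<in> laurent_polys r. f (g p)),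
     one = (\<lambda>p \<in> laurent_polys r. p),
     zero = (\<lambda>p \<in> laurent_polys r. 0),
     add = (\<lambda>f g. \<lambda>p \<in> laurent_polys r. f p + g p),
     module.smult = (\<lambda>c f. \<lambda>p \<in> laurent_polys r. Poly_Mapping.single 0 c * f p)\<rparr>"

text \<open>Multiplication by the power \<open>x\<^sub>i\<^sup>k\<close>, for an integer \<open>k\<close>.\<close>

definition var_power_op :: "nat \<Rightarrow> nat \<Rightarrow> int \<Rightarrow> laurent \<Rightarrow> laurent" where
  "var_power_op r i k = (\<lambda>p \<in> laurent_polys r. Poly_Mapping.single (Poly_Mapping.single i k) 1 * p)"

definition partial_op :: "nat \<Rightarrow> nat \<Rightarrow> laurent \<Rightarrow> laurent" where
  "partial_op r i = (\<lambda>p \<in> laurent_polys r.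
     \<Sum>m \<in> Poly_Mapping.keys p.
       Poly_Mapping.single (m - Poly_Mapping.single i 1)
         (of_int (Poly_Mapping.lookup m i) * Poly_Mapping.lookup p m))"

definition weyl_alg :: "nat \<Rightarrow> (complex, laurent \<Rightarrow> laurent) module" where
  "weyl_alg r = laurent_end r
     \<lparr>carrier := subalg_gen (laurent_end r)
        (\<Union>i<r. {var_power_op r i 1, var_power_op r i (- 1), partial_op r i})\<rparr>"

end

theory Submission
  imports Defs "HOL-Computational_Algebra.Polynomial"
begin

text \<open>
  The abelian ideal \<open>\<complex>\<^sup>n\<close> acts by the coordinates \<open>x\<^sub>1, \<dots>, x\<^sub>n\<close>, and the stabiliser in \<open>gl\<^sub>n\<close> of a point
  with \<open>x\<^sub>n \<noteq> 0\<close> is again a copy of \<open>s\<^sub>n\<^sub>-\<^sub>1\<close>. Inducing from it gives, with generators \<open>E\<^sub>i\<^sub>j, E\<^sub>i\<close> of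
  \<open>s\<^sub>n\<^sub>-\<^sub>1\<close> commuting with \<open>x\<close> and \<open>\<partial>\<close>, a homomorphism
  \<open>e\<^sub>i \<mapsto> x\<^sub>i\<close>, \<open>e\<^sub>n\<^sub>j \<mapsto> x\<^sub>n \<partial>\<^sub>j\<close>, \<open>e\<^sub>i\<^sub>j \<mapsto> x\<^sub>i \<partial>\<^sub>j + E\<^sub>i\<^sub>j\<close>,
  \<open>e\<^sub>i\<^sub>n \<mapsto> x\<^sub>i \<partial>\<^sub>n + x\<^sub>n\<^sup>-\<^sup>1 (E\<^sub>i - \<Sum>\<^sub>l x\<^sub>l E\<^sub>i\<^sub>l)\<close> for \<open>i, j < n\<close>.
  Iterating it maps \<open>U(s\<^sub>n)\<close> into the Weyl algebra in \<open>n + (n - 1) + \<dots> + 1\<close> variables.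

  The map is injective: for a suitable weight, the leading terms of the images of the generators are
  multiplicatively independent monomials, and so the images of the ordered monomials, which span
  \<open>U(s\<^sub>n)\<close>, are linearly independent. As the image has polynomial growth and no zero divisors, it
  satisfies the Ore condition. The elements of the Weyl algebra having a right denominator in the image
  therefore form a subring closed under inverses; solving the recursion for \<open>E\<^sub>i\<^sub>j, E\<^sub>i\<close> level by level
  shows that it contains all variables and derivations. Hence both algebras have the same fractions.
\<close>

section \<open>Fractions of right Ore domains\<close>

text \<open>The delicate point is injectivity. An operator is read as a sum of x^a p_a(\<theta>)
  with \<theta>_v = x_v d_v, and a leading term is an exponent a together with a weight. The
  exponent is visible directly, but the degrees in the various \<theta>_v enter only through one
  integer, the weight. The \<theta>_v are therefore given powers of a number K as weights, K larger
  than the length of every word compared, so that their degrees are the digits of that integer in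
  base K. The weights thus depend on the finite set of monomials to be separated. They must also
  make the lower level dominate in the recursion, since otherwise different generators would share
  leading terms: the new x_i d_j would hide \<open>E k i j\<close>, and x_i d_n would hide the
  vector of the lower level.

  The inverse variables are present in the Weyl algebra from the start, whereas the image only
  supplies them as fractions. Hence the comparison is made through denominators: the Ore condition
  is established inside the image and is carried up to the Weyl algebra by clearing
  denominators.\<close>

lemma UN_const:
  assumes "a \<in> S" "\<And>x. x \<in> S \<Longrightarrow> g x = k"
  shows "(\<Union>x\<in>S. g x) = k"
  using assms by blast

lemma Union_const: "(\<And>Y. Y \<in> A \<Longrightarrow> Y = X) \<Longrightarrow> X \<in> A \<Longrightarrow> \<Union>A = X"
  by blast

lemma UN_pair_const:
  assumes "(a, s) \<in> X" and "\<And>b t. (b, t) \<in> X \<Longrightarrow> f b t = Y"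
  shows "(\<Union>(b, t) \<in> X. f b t) = Y"
  using assms by (intro Union_const) (auto intro!: image_eqI[of _ _ "(a, s)"])

locale right_ore_domain = ring R for R (structure) +
  assumes one_neq_zero: "\<one> \<noteq> \<zero>"
    and no_zero_div: "a \<in> carrier R \<Longrightarrow> b \<in> carrier R \<Longrightarrow> a \<otimes> b = \<zero> \<Longrightarrow> a = \<zero> \<or> b = \<zero>"
    and ore: "a \<in> carrier R \<Longrightarrow> b \<in> carrier R \<Longrightarrow> a \<noteq> \<zero> \<Longrightarrow> b \<noteq> \<zero> \<Longrightarrow>
      \<exists>u \<in> carrier R. \<exists>v \<in> carrier R. a \<otimes> u = b \<otimes> v \<and> a \<otimes> u \<noteq> \<zero>"
begin

lemma minus_eq_zeroD:
  assumes "a \<in> carrier R" "b \<in> carrier R" "a \<ominus> b = \<zero>"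
  shows "a = b"
proof -
  have "a = (a \<ominus> b) \<oplus> b" using assms(1,2) by (simp add: minus_eq a_assoc l_neg)
  then show ?thesis using assms by simp
qed

lemma mult_eq_zero_iff:
  "a \<in> carrier R \<Longrightarrow> b \<in> carrier R \<Longrightarrow> a \<otimes> b = \<zero> \<longleftrightarrow> a = \<zero> \<or> b = \<zero>"
  using no_zero_div by auto

lemma right_cancel:
  assumes "a \<in> carrier R" "b \<in> carrier R" "k \<in> carrier R" "k \<noteq> \<zero>" "a \<otimes> k = b \<otimes> k"
  shows "a = b"
proof -
  have "(a \<ominus> b) \<otimes> k = \<zero>"
    using assms by (simp add: minus_eq l_distr l_minus r_neg)
  then have "a \<ominus> b = \<zero>" using assms no_zero_div[of "a \<ominus> b" k] by auto
  then show ?thesis using assms minus_eq_zeroD by simp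
qed

definition frac_rel :: "'a \<Rightarrow> 'a \<Rightarrow> 'a \<Rightarrow> 'a \<Rightarrow> bool" where
  "frac_rel a s b t \<longleftrightarrow> (\<exists>u \<in> carrier R. \<exists>v \<in> carrier R.
     s \<otimes> u = t \<otimes> v \<and> s \<otimes> u \<noteq> \<zero> \<and> a \<otimes> u = b \<otimes> v)"

lemma mem_frac_class:
  "(b, t) \<in> frac_class R a s \<longleftrightarrow> b \<in> carrier R \<and> t \<in> carrier R \<and> t \<noteq> \<zero> \<and> frac_rel a s b t"
  by (auto simp: frac_class_def frac_rel_def)

lemma frac_rel_sym: "frac_rel a s b t \<Longrightarrow> frac_rel b t a s"
  unfolding frac_rel_def by metis

lemma frac_rel_refl: "s \<in> carrier R \<Longrightarrow> s \<noteq> \<zero> \<Longrightarrow> frac_rel a s a s"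
  unfolding frac_rel_def using r_one by (metis one_closed)

text \<open>Comparing the given common denominator with an arbitrary one by the Ore condition,
  \<open>p \<otimes> g = x \<otimes> k\<close>, lets \<open>t\<close> cancel on the left and
  \<open>k\<close> on the right. The existential in \<open>frac_rel\<close> becomes a universal
  statement, on which transitivity and the well-definedness of sums and products rest.\<close>

lemma frac_rel_numerators:
  assumes "a \<in> carrier R" "s \<in> carrier R" "s \<noteq> \<zero>" "b \<in> carrier R" "t \<in> carrier R" "t \<noteq> \<zero>"
    and rel: "frac_rel a s b t"
    and "x \<in> carrier R" "y \<in> carrier R" and eq: "s \<otimes> x = t \<otimes> y"
  shows "a \<otimes> x = b \<otimes> y"
proof (cases "x = \<zero>")
  case True
  then have "y = \<zero>" using assms mult_eq_zero_iff[of t y] by simp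
  then show ?thesis using True assms by simp
next
  case False
  obtain p q where pq: "p \<in> carrier R" "q \<in> carrier R" "s \<otimes> p = t \<otimes> q" "s \<otimes> p \<noteq> \<zero>"
    "a \<otimes> p = b \<otimes> q"
    using rel unfolding frac_rel_def by blast
  have "p \<noteq> \<zero>" using pq assms by auto
  then obtain g k where gk: "g \<in> carrier R" "k \<in> carrier R" "p \<otimes> g = x \<otimes> k" "p \<otimes> g \<noteq> \<zero>"
    using ore[OF pq(1) assms(8)] False by blast
  have k: "k \<noteq> \<zero>" using gk assms by auto
  have "t \<otimes> (q \<otimes> g) = s \<otimes> (p \<otimes> g)" using pq(1-3) gk(1,2) assms(2,5) by (simp flip: m_assoc)
  also have "\<dots> = t \<otimes> (y \<otimes> k)" using gk(1-3) assms(2,5,8,9) eq by (simp flip: m_assoc)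
  finally have "t \<otimes> (q \<otimes> g \<ominus> y \<otimes> k) = \<zero>"
    using assms(5,9) pq(2) gk(1,2) by (simp add: minus_eq r_distr r_minus r_neg)
  then have qg: "q \<otimes> g = y \<otimes> k"
    using assms(5,6,9) pq(2) gk(1,2) mult_eq_zero_iff[of t "q \<otimes> g \<ominus> y \<otimes> k"]
      minus_eq_zeroD[of "q \<otimes> g" "y \<otimes> k"] by simp
  have "a \<otimes> x \<otimes> k = a \<otimes> (p \<otimes> g)" using gk(1-3) assms(1,8) by (simp add: m_assoc)
  also have "\<dots> = b \<otimes> (q \<otimes> g)" using pq(1,2,5) gk(1,2) assms(1,4) by (simp flip: m_assoc)
  also have "\<dots> = b \<otimes> y \<otimes> k" using qg gk(1,2) assms(4,9) by (simp add: m_assoc)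
  finally show ?thesis using right_cancel[of "a \<otimes> x" "b \<otimes> y" k] k gk assms by simp
qed

lemma frac_relI_common:
  assumes "x \<in> carrier R" "y \<in> carrier R" "s \<otimes> x = t \<otimes> y" "s \<otimes> x \<noteq> \<zero>" "a \<otimes> x = b \<otimes> y"
  shows "frac_rel a s b t"
  using assms unfolding frac_rel_def by blast

lemma frac_rel_trans:
  assumes C: "a \<in> carrier R" "s \<in> carrier R" "s \<noteq> \<zero>" "b \<in> carrier R" "t \<in> carrier R" "t \<noteq> \<zero>"
    "c \<in> carrier R" "w \<in> carrier R" "w \<noteq> \<zero>"
    and r1: "frac_rel a s b t" and r2: "frac_rel b t c w"
  shows "frac_rel a s c w"
proof -
  obtain p q where pq: "p \<in> carrier R" "q \<in> carrier R" "s \<otimes> p = t \<otimes> q" "s \<otimes> p \<noteq> \<zero>"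
    using r1 unfolding frac_rel_def by blast
  obtain x y where xy: "x \<in> carrier R" "y \<in> carrier R" "(s \<otimes> p) \<otimes> x = w \<otimes> y" "(s \<otimes> p) \<otimes> x \<noteq> \<zero>"
    using ore[OF m_closed[OF C(2) pq(1)] C(8) pq(4) C(9)] by blast
  have 1: "s \<otimes> (p \<otimes> x) = w \<otimes> y" "s \<otimes> (p \<otimes> x) \<noteq> \<zero>" using xy pq(1) C(2) by (auto simp: m_assoc)
  have 2: "s \<otimes> (p \<otimes> x) = t \<otimes> (q \<otimes> x)" using xy(1) pq(1-3) C(2,5) by (simp flip: m_assoc)
  have "a \<otimes> (p \<otimes> x) = b \<otimes> (q \<otimes> x)"
    using frac_rel_numerators[OF C(1-6) r1 _ _ 2] pq xy by simp
  moreover have "b \<otimes> (q \<otimes> x) = c \<otimes> y"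
    using frac_rel_numerators[OF C(4-9) r2] pq xy 1 2 by simp
  ultimately show ?thesis using frac_relI_common[of "p \<otimes> x" y] pq xy 1 by auto
qed

lemma frac_class_eq_iff:
  assumes C: "a \<in> carrier R" "s \<in> carrier R" "s \<noteq> \<zero>" "b \<in> carrier R" "t \<in> carrier R" "t \<noteq> \<zero>"
  shows "frac_class R a s = frac_class R b t \<longleftrightarrow> frac_rel a s b t"
proof
  assume "frac_class R a s = frac_class R b t"
  then have "(b, t) \<in> frac_class R a s" using frac_rel_refl C by (auto simp: mem_frac_class)
  then show "frac_rel a s b t" by (simp add: mem_frac_class)
next
  assume r: "frac_rel a s b t"
  have "p \<in> frac_class R b t" if "p \<in> frac_class R a s" for p
    using that frac_rel_trans[OF C(4-6) C(1-3) _ _ _ frac_rel_sym[OF r]]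
    by (cases p) (simp add: mem_frac_class)
  moreover have "p \<in> frac_class R a s" if "p \<in> frac_class R b t" for p
    using that frac_rel_trans[OF C _ _ _ r] by (cases p) (simp add: mem_frac_class)
  ultimately show "frac_class R a s = frac_class R b t" by blast
qed

lemma frac_class_self:
  "a \<in> carrier R \<Longrightarrow> s \<in> carrier R \<Longrightarrow> s \<noteq> \<zero> \<Longrightarrow> (a, s) \<in> frac_class R a s"
  by (simp add: mem_frac_class frac_rel_refl)

lemma frac_rel_mult:
  assumes C: "a \<in> carrier R" "s \<in> carrier R" "s \<noteq> \<zero>" "b \<in> carrier R" "t \<in> carrier R" "t \<noteq> \<zero>"
    and C': "a' \<in> carrier R" "s' \<in> carrier R" "s' \<noteq> \<zero>" "b' \<in> carrier R" "t' \<in> carrier R" "t' \<noteq> \<zero>"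
    and r: "frac_rel a s a' s'" "frac_rel b t b' t'"
    and uv: "u \<in> carrier R" "v \<in> carrier R" "v \<noteq> \<zero>" "b \<otimes> v = s \<otimes> u"
    and uv': "u' \<in> carrier R" "v' \<in> carrier R" "v' \<noteq> \<zero>" "b' \<otimes> v' = s' \<otimes> u'"
  shows "frac_rel (a \<otimes> u) (t \<otimes> v) (a' \<otimes> u') (t' \<otimes> v')"
proof -
  have nz: "t \<otimes> v \<noteq> \<zero>" "t' \<otimes> v' \<noteq> \<zero>" using C(5,6) C'(5,6) uv(2,3) uv'(2,3) by (auto simp: mult_eq_zero_iff)
  then obtain x y where xy: "x \<in> carrier R" "y \<in> carrier R"
    "(t \<otimes> v) \<otimes> x = (t' \<otimes> v') \<otimes> y" "(t \<otimes> v) \<otimes> x \<noteq> \<zero>"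
    using ore[OF m_closed[OF C(5) uv(2)] m_closed[OF C'(5) uv'(2)]] by blast
  have "t \<otimes> (v \<otimes> x) = t' \<otimes> (v' \<otimes> y)" using xy(1-3) C(1,2,4,5) C'(1,2,4,5) uv(1,2) uv'(1,2) by (simp add: m_assoc)
  then have "b \<otimes> (v \<otimes> x) = b' \<otimes> (v' \<otimes> y)"
    using frac_rel_numerators[OF C(4-6) C'(4-6) r(2)] xy(1,2) uv(1,2) uv'(1,2) by simp
  then have "(b \<otimes> v) \<otimes> x = (b' \<otimes> v') \<otimes> y" using xy(1-3) C(1,2,4,5) C'(1,2,4,5) uv(1,2) uv'(1,2) by (simp add: m_assoc)
  then have "(s \<otimes> u) \<otimes> x = (s' \<otimes> u') \<otimes> y" using uv(4) uv'(4) by simp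
  then have "s \<otimes> (u \<otimes> x) = s' \<otimes> (u' \<otimes> y)" using xy(1-3) C(1,2,4,5) C'(1,2,4,5) uv(1,2) uv'(1,2) by (simp add: m_assoc)
  then have "a \<otimes> (u \<otimes> x) = a' \<otimes> (u' \<otimes> y)"
    using frac_rel_numerators[OF C(1-3) C'(1-3) r(1)] xy(1,2) uv(1,2) uv'(1,2) by simp
  then have "(a \<otimes> u) \<otimes> x = (a' \<otimes> u') \<otimes> y" using xy(1-3) C(1,2,4,5) C'(1,2,4,5) uv(1,2) uv'(1,2) by (simp add: m_assoc)
  then show ?thesis using frac_relI_common xy by blast
qed

lemma frac_rel_add:
  assumes C: "a \<in> carrier R" "s \<in> carrier R" "s \<noteq> \<zero>" "b \<in> carrier R" "t \<in> carrier R" "t \<noteq> \<zero>"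
    and C': "a' \<in> carrier R" "s' \<in> carrier R" "s' \<noteq> \<zero>" "b' \<in> carrier R" "t' \<in> carrier R" "t' \<noteq> \<zero>"
    and r: "frac_rel a s a' s'" "frac_rel b t b' t'"
    and uv: "u \<in> carrier R" "v \<in> carrier R" "s \<otimes> u = t \<otimes> v" "s \<otimes> u \<noteq> \<zero>"
    and uv': "u' \<in> carrier R" "v' \<in> carrier R" "s' \<otimes> u' = t' \<otimes> v'" "s' \<otimes> u' \<noteq> \<zero>"
  shows "frac_rel (a \<otimes> u \<oplus> b \<otimes> v) (s \<otimes> u) (a' \<otimes> u' \<oplus> b' \<otimes> v') (s' \<otimes> u')"
proof -
  obtain x y where xy: "x \<in> carrier R" "y \<in> carrier R"
    "(s \<otimes> u) \<otimes> x = (s' \<otimes> u') \<otimes> y" "(s \<otimes> u) \<otimes> x \<noteq> \<zero>"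
    using ore[OF m_closed[OF C(2) uv(1)] m_closed[OF C'(2) uv'(1)] uv(4) uv'(4)] by blast
  have "s \<otimes> (u \<otimes> x) = s' \<otimes> (u' \<otimes> y)" using xy(1-3) C(1,2,4,5) C'(1,2,4,5) uv(1,2) uv'(1,2) by (simp add: m_assoc)
  then have 1: "a \<otimes> (u \<otimes> x) = a' \<otimes> (u' \<otimes> y)"
    using frac_rel_numerators[OF C(1-3) C'(1-3) r(1)] xy(1,2) uv(1,2) uv'(1,2) by simp
  have "(t \<otimes> v) \<otimes> x = (t' \<otimes> v') \<otimes> y" using xy(3) uv(3) uv'(3) by simp
  then have "t \<otimes> (v \<otimes> x) = t' \<otimes> (v' \<otimes> y)" using xy(1,2) C(1,2,4,5) C'(1,2,4,5) uv(1,2) uv'(1,2) by (simp add: m_assoc)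
  then have 2: "b \<otimes> (v \<otimes> x) = b' \<otimes> (v' \<otimes> y)"
    using frac_rel_numerators[OF C(4-6) C'(4-6) r(2)] xy(1,2) uv(1,2) uv'(1,2) by simp
  have "(a \<otimes> u \<oplus> b \<otimes> v) \<otimes> x = (a' \<otimes> u' \<oplus> b' \<otimes> v') \<otimes> y"
    using 1 2 xy(1,2) C(1,2,4,5) C'(1,2,4,5) uv(1,2) uv'(1,2) by (simp add: l_distr m_assoc)
  then show ?thesis using frac_relI_common xy by blast
qed

lemma frac_mult_eq:
  assumes C: "a \<in> carrier R" "s \<in> carrier R" "s \<noteq> \<zero>" "b \<in> carrier R" "t \<in> carrier R" "t \<noteq> \<zero>"
    and uv: "u \<in> carrier R" "v \<in> carrier R" "v \<noteq> \<zero>" "b \<otimes> v = s \<otimes> u"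
  shows "frac_mult R (frac_class R a s) (frac_class R b t) = frac_class R (a \<otimes> u) (t \<otimes> v)"
proof -
  have *: "frac_class R (a' \<otimes> u') (t' \<otimes> v') = frac_class R (a \<otimes> u) (t \<otimes> v)"
    if "(a', s') \<in> frac_class R a s" "(b', t') \<in> frac_class R b t"
      "u' \<in> carrier R" "v' \<in> carrier R - {\<zero>}" "b' \<otimes> v' = s' \<otimes> u'" for a' s' b' t' u' v'
  proof -
    have "frac_rel (a' \<otimes> u') (t' \<otimes> v') (a \<otimes> u) (t \<otimes> v)"
      using that(1,2) unfolding mem_frac_class
      by (intro frac_rel_mult[OF _ _ _ _ _ _ C frac_rel_sym frac_rel_sym _ _ _ that(5) uv])
        (use that(3,4) in simp_all)
    then show ?thesis
      using that(1-4) C uv(1-3) unfolding mem_frac_class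
      by (subst frac_class_eq_iff) (simp_all add: mult_eq_zero_iff)
  qed
  show ?thesis
    unfolding frac_mult_def
  proof (rule Union_const, goal_cases)
    case (1 Y)
    then show ?case by (elim CollectE exE conjE) (hypsubst, rule *, assumption+)
  next
    case 2
    show ?case
      by (rule CollectI) (intro exI conjI, rule refl, rule frac_class_self[OF C(1-3)],
        rule frac_class_self[OF C(4-6)], use uv in simp_all)
  qed
qed

lemma frac_add_eq:
  assumes C: "a \<in> carrier R" "s \<in> carrier R" "s \<noteq> \<zero>" "b \<in> carrier R" "t \<in> carrier R" "t \<noteq> \<zero>"
    and uv: "u \<in> carrier R" "v \<in> carrier R" "s \<otimes> u = t \<otimes> v" "s \<otimes> u \<noteq> \<zero>"
  shows "frac_add R (frac_class R a s) (frac_class R b t) = frac_class R (a \<otimes> u \<oplus> b \<otimes> v) (s \<otimes> u)"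
proof -
  have *: "frac_class R (a' \<otimes> u' \<oplus> b' \<otimes> v') (s' \<otimes> u') = frac_class R (a \<otimes> u \<oplus> b \<otimes> v) (s \<otimes> u)"
    if "(a', s') \<in> frac_class R a s" "(b', t') \<in> frac_class R b t"
      "u' \<in> carrier R" "v' \<in> carrier R" "s' \<otimes> u' = t' \<otimes> v'" "s' \<otimes> u' \<noteq> \<zero>" for a' s' b' t' u' v'
  proof -
    have "frac_rel (a' \<otimes> u' \<oplus> b' \<otimes> v') (s' \<otimes> u') (a \<otimes> u \<oplus> b \<otimes> v) (s \<otimes> u)"
      using that(1,2) unfolding mem_frac_class
      by (intro frac_rel_add[OF _ _ _ _ _ _ C frac_rel_sym frac_rel_sym _ _ that(5,6) uv])
        (use that(3,4) in simp_all)
    then show ?thesis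
      using that(1-4,6) C uv(1,2,4) unfolding mem_frac_class
      by (subst frac_class_eq_iff) simp_all
  qed
  show ?thesis
    unfolding frac_add_def
  proof (rule Union_const, goal_cases)
    case (1 Y)
    then show ?case by (elim CollectE exE conjE) (hypsubst, rule *, assumption+)
  next
    case 2
    show ?case
      by (rule CollectI)
        (intro exI conjI, rule refl, rule frac_class_self[OF C(1-3)], rule frac_class_self[OF C(4-6)], (rule uv)+)
  qed
qed

end

text \<open>By \<open>denom\<close> the ring \<open>S\<close> lies between the image of
  \<open>R\<close> and its right fractions, so both have the same fractions. The Ore condition is
  assumed for \<open>S\<close> only; a common multiple found there becomes one in \<open>R\<close>
  after its cofactors are multiplied by a common denominator.\<close>

lemma alg_isomorphic_skew_fraction_field:
  fixes R :: "(complex, 'a) module" (structure) and S :: "(complex, 'b) module"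
  assumes R: "ring R" and S: "right_ore_domain S"
    and h: "h \<in> Ring.ring_hom R S" and inj: "inj_on h (carrier R)"
    and scale_closed: "\<And>c x. x \<in> carrier R \<Longrightarrow> c \<odot> x \<in> carrier R"
    and h_scale: "\<And>c x. x \<in> carrier R \<Longrightarrow> h (c \<odot> x) = c \<odot>\<^bsub>S\<^esub> h x"
    and scale_closed': "\<And>c x. x \<in> carrier S \<Longrightarrow> c \<odot>\<^bsub>S\<^esub> x \<in> carrier S"
    and scale_mult: "\<And>c x y. x \<in> carrier S \<Longrightarrow> y \<in> carrier S \<Longrightarrow>
      c \<odot>\<^bsub>S\<^esub> x \<otimes>\<^bsub>S\<^esub> y = c \<odot>\<^bsub>S\<^esub> (x \<otimes>\<^bsub>S\<^esub> y)"
    and denom: "\<And>d. d \<in> carrier S \<Longrightarrow>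
      \<exists>s \<in> carrier R. h s \<noteq> \<zero>\<^bsub>S\<^esub> \<and> d \<otimes>\<^bsub>S\<^esub> h s \<in> h ` carrier R"
  shows "alg_isomorphic (skew_fraction_field R) (skew_fraction_field S)"
proof -
  let ?F = "skew_fraction_field R" and ?G = "skew_fraction_field S"
  interpret R: ring R by (rule R)
  interpret S: right_ore_domain S by (rule S)
  interpret h: ring_hom_ring R S h by (rule ring_hom_ringI2) (use R S.ring_axioms h in auto)
  have h0: "h x = \<zero>\<^bsub>S\<^esub> \<longleftrightarrow> x = \<zero>" if "x \<in> carrier R" for x
    using inj that inj_onD[of h "carrier R" x "\<zero>"] by auto
  have heq: "h x = h y \<longleftrightarrow> x = y" if "x \<in> carrier R" "y \<in> carrier R" for x y
    using inj that by (auto dest: inj_onD)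
  \<comment> \<open>The denominators are found in succession: \<open>k1\<close> clears
    \<open>d\<close>, then \<open>k2\<close> clears \<open>e\<close> times \<open>h k1\<close>, and
    the further factor \<open>h k2\<close> leaves \<open>d\<close> cleared.\<close>
  have common: "\<exists>k \<in> carrier R. \<exists>d' \<in> carrier R. \<exists>e' \<in> carrier R. k \<noteq> \<zero> \<and>
      d \<otimes>\<^bsub>S\<^esub> h k = h d' \<and> e \<otimes>\<^bsub>S\<^esub> h k = h e'"
    if d: "d \<in> carrier S" and e: "e \<in> carrier S" for d e
  proof -
    obtain k1 x where k1: "k1 \<in> carrier R" "h k1 \<noteq> \<zero>\<^bsub>S\<^esub>" "x \<in> carrier R" "d \<otimes>\<^bsub>S\<^esub> h k1 = h x"
      using denom[OF d] by auto
    have "e \<otimes>\<^bsub>S\<^esub> h k1 \<in> carrier S" using e k1 by simp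
    then obtain k2 y where k2: "k2 \<in> carrier R" "h k2 \<noteq> \<zero>\<^bsub>S\<^esub>" "y \<in> carrier R"
      "(e \<otimes>\<^bsub>S\<^esub> h k1) \<otimes>\<^bsub>S\<^esub> h k2 = h y"
      using denom[of "e \<otimes>\<^bsub>S\<^esub> h k1"] by auto
    have "h (k1 \<otimes> k2) \<noteq> \<zero>\<^bsub>S\<^esub>" using k1 k2 by (simp add: S.mult_eq_zero_iff)
    then have "k1 \<otimes> k2 \<noteq> \<zero>" using h.hom_zero by metis
    moreover have "d \<otimes>\<^bsub>S\<^esub> h (k1 \<otimes> k2) = h (x \<otimes> k2)"
      using k1 k2 d by (simp flip: S.m_assoc)
    moreover have "e \<otimes>\<^bsub>S\<^esub> h (k1 \<otimes> k2) = h y"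
      using k1 k2 e by (simp add: S.m_assoc)
    ultimately show ?thesis using k1 k2 by (meson R.m_closed)
  qed
  have R_ore: "right_ore_domain R"
  proof
    show "\<one> \<noteq> \<zero>" using S.one_neq_zero h0[of "\<one>"] by auto
    show "a = \<zero> \<or> b = \<zero>"
      if "a \<in> carrier R" "b \<in> carrier R" "a \<otimes> b = \<zero>" for a b
    proof -
      have "h a \<otimes>\<^bsub>S\<^esub> h b = \<zero>\<^bsub>S\<^esub>" using that h.hom_mult[of a b] by simp
      then show ?thesis using S.mult_eq_zero_iff[of "h a" "h b"] h0 that by simp
    qed
    show "\<exists>u \<in> carrier R. \<exists>v \<in> carrier R. a \<otimes> u = b \<otimes> v \<and> a \<otimes> u \<noteq> \<zero>"
      if ab: "a \<in> carrier R" "b \<in> carrier R" "a \<noteq> \<zero>" "b \<noteq> \<zero>" for a b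
    proof -
      obtain u v where uv: "u \<in> carrier S" "v \<in> carrier S" "h a \<otimes>\<^bsub>S\<^esub> u = h b \<otimes>\<^bsub>S\<^esub> v"
        "h a \<otimes>\<^bsub>S\<^esub> u \<noteq> \<zero>\<^bsub>S\<^esub>"
        using S.ore[of "h a" "h b"] ab h0 by auto
      obtain k u' v' where k: "k \<in> carrier R" "u' \<in> carrier R" "v' \<in> carrier R" "k \<noteq> \<zero>"
        "u \<otimes>\<^bsub>S\<^esub> h k = h u'" "v \<otimes>\<^bsub>S\<^esub> h k = h v'"
        using common[OF uv(1,2)] by auto
      have "h (a \<otimes> u') = h a \<otimes>\<^bsub>S\<^esub> u \<otimes>\<^bsub>S\<^esub> h k"
        using k ab uv(1,2) by (simp add: S.m_assoc)
      moreover have "h (b \<otimes> v') = h a \<otimes>\<^bsub>S\<^esub> u \<otimes>\<^bsub>S\<^esub> h k"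
        unfolding uv(3) using k ab uv(1,2) by (simp add: S.m_assoc)
      moreover have "h a \<otimes>\<^bsub>S\<^esub> u \<otimes>\<^bsub>S\<^esub> h k \<noteq> \<zero>\<^bsub>S\<^esub>"
        using uv k h0 ab by (auto simp: S.mult_eq_zero_iff)
      ultimately show ?thesis
        using k ab heq[of "a \<otimes> u'" "b \<otimes> v'"] h0[of "a \<otimes> u'"] by auto
    qed
  qed
  interpret R: right_ore_domain R by (rule R_ore)
  have rel: "S.frac_rel (h a) (h s) (h b) (h t) \<longleftrightarrow> R.frac_rel a s b t"
    if C: "a \<in> carrier R" "s \<in> carrier R" "s \<noteq> \<zero>" "b \<in> carrier R" "t \<in> carrier R" "t \<noteq> \<zero>"
    for a s b t
  proof
    assume "S.frac_rel (h a) (h s) (h b) (h t)"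
    then obtain u v where uv: "u \<in> carrier S" "v \<in> carrier S" "h s \<otimes>\<^bsub>S\<^esub> u = h t \<otimes>\<^bsub>S\<^esub> v"
      "h s \<otimes>\<^bsub>S\<^esub> u \<noteq> \<zero>\<^bsub>S\<^esub>" "h a \<otimes>\<^bsub>S\<^esub> u = h b \<otimes>\<^bsub>S\<^esub> v"
      unfolding S.frac_rel_def by auto
    obtain k u' v' where k: "k \<in> carrier R" "u' \<in> carrier R" "v' \<in> carrier R" "k \<noteq> \<zero>"
      "u \<otimes>\<^bsub>S\<^esub> h k = h u'" "v \<otimes>\<^bsub>S\<^esub> h k = h v'"
      using common[OF uv(1,2)] by auto
    have su: "h (s \<otimes> u') = h s \<otimes>\<^bsub>S\<^esub> u \<otimes>\<^bsub>S\<^esub> h k"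
      using k C uv(1,2) by (simp add: S.m_assoc)
    moreover have "h (t \<otimes> v') = h s \<otimes>\<^bsub>S\<^esub> u \<otimes>\<^bsub>S\<^esub> h k"
      unfolding uv(3) using k C uv(1,2) by (simp add: S.m_assoc)
    ultimately have 1: "s \<otimes> u' = t \<otimes> v'" using k C heq by (metis R.m_closed)
    have "h (a \<otimes> u') = h a \<otimes>\<^bsub>S\<^esub> u \<otimes>\<^bsub>S\<^esub> h k"
      using k C uv(1,2) by (simp add: S.m_assoc)
    moreover have "h (b \<otimes> v') = h a \<otimes>\<^bsub>S\<^esub> u \<otimes>\<^bsub>S\<^esub> h k"
      unfolding uv(5) using k C uv(1,2) by (simp add: S.m_assoc)
    ultimately have 2: "a \<otimes> u' = b \<otimes> v'" using k C heq by (metis R.m_closed)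
    have "h (s \<otimes> u') \<noteq> \<zero>\<^bsub>S\<^esub>"
      unfolding su using uv k h0 C by (auto simp: S.mult_eq_zero_iff)
    then have "s \<otimes> u' \<noteq> \<zero>" by auto
    then show "R.frac_rel a s b t" using R.frac_relI_common[OF k(2,3) 1 _ 2] by simp
  next
    assume "R.frac_rel a s b t"
    then obtain u v where uv: "u \<in> carrier R" "v \<in> carrier R" "s \<otimes> u = t \<otimes> v"
      "s \<otimes> u \<noteq> \<zero>" "a \<otimes> u = b \<otimes> v"
      unfolding R.frac_rel_def by auto
    have "h (s \<otimes> u) \<noteq> \<zero>\<^bsub>S\<^esub>"
      using h0 R.m_closed[OF C(2) uv(1)] uv(4) by blast
    moreover note arg_cong[OF uv(3), of h] arg_cong[OF uv(5), of h]
    ultimately show "S.frac_rel (h a) (h s) (h b) (h t)"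
      using S.frac_relI_common[of "h u" "h v"] uv(1,2) C by simp
  qed
  define H where "H X = (\<Union>(a, s) \<in> X. frac_class S (h a) (h s))" for X
  have H: "H (frac_class R a s) = frac_class S (h a) (h s)"
    if C: "a \<in> carrier R" "s \<in> carrier R" "s \<noteq> \<zero>" for a s
  proof -
    have "frac_class S (h b) (h t) = frac_class S (h a) (h s)" if "(b, t) \<in> frac_class R a s" for b t
      using that C rel[of a s b t] h0 by (subst eq_commute, subst S.frac_class_eq_iff) (auto simp: R.mem_frac_class)
    then show ?thesis
      unfolding H_def by (intro UN_pair_const[OF R.frac_class_self[OF C]])
  qed
  have car: "X \<in> carrier ?F \<longleftrightarrow>
      (\<exists>a s. X = frac_class R a s \<and> a \<in> carrier R \<and> s \<in> carrier R \<and> s \<noteq> \<zero>)" for X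
    by (auto simp: skew_fraction_field_def)
  have carS: "X \<in> carrier ?G \<longleftrightarrow>
      (\<exists>a s. X = frac_class S a s \<and> a \<in> carrier S \<and> s \<in> carrier S \<and> s \<noteq> \<zero>\<^bsub>S\<^esub>)" for X
    by (auto simp: skew_fraction_field_def)
  have "H \<in> alg_iso ?F ?G"
    unfolding alg_iso_def
  proof (intro CollectI conjI allI ballI ring_iso_memI)
    fix X assume "X \<in> carrier ?F"
    then obtain a s where X: "X = frac_class R a s" "a \<in> carrier R" "s \<in> carrier R" "s \<noteq> \<zero>"
      using car by auto
    then show "H X \<in> carrier ?G"
      unfolding carS using h0 by (intro exI[of _ "h a"] exI[of _ "h s"]) (auto simp: H)
    fix c
    have 1: "(c \<odot>\<^bsub>?F\<^esub> X) = frac_class R (c \<odot> a) s"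
    proof -
      have "frac_class R (c \<odot> b) t = frac_class R (c \<odot> a) s" if "(b, t) \<in> frac_class R a s" for b t
      proof -
        from that obtain u v where uv: "u \<in> carrier R" "v \<in> carrier R" "s \<otimes> u = t \<otimes> v"
          "s \<otimes> u \<noteq> \<zero>" "a \<otimes> u = b \<otimes> v" and bt: "b \<in> carrier R" "t \<in> carrier R" "t \<noteq> \<zero>"
          unfolding R.mem_frac_class R.frac_rel_def by auto
        \<comment> \<open>Compatibility of scalars with products is assumed in \<open>S\<close>; it
          is verified there and pulled back along the injective \<open>h\<close>.\<close>
        have "h ((c \<odot> a) \<otimes> u) = h ((c \<odot> b) \<otimes> v)"
          using X uv(1,2) bt arg_cong[OF uv(5), of h] by (simp add: scale_closed h_scale scale_mult)
        then have "(c \<odot> a) \<otimes> u = (c \<odot> b) \<otimes> v"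
          using heq[OF R.m_closed[OF scale_closed[OF X(2)] uv(1)] R.m_closed[OF scale_closed[OF bt(1)] uv(2)]]
          by blast
        then have "R.frac_rel (c \<odot> a) s (c \<odot> b) t" using R.frac_relI_common uv by blast
        then show ?thesis using X bt scale_closed by (metis R.frac_class_eq_iff)
      qed
      then show ?thesis
        unfolding X(1) skew_fraction_field_def
        by (simp, intro UN_pair_const[OF R.frac_class_self[OF X(2-4)]])
    qed
    have 2: "(c \<odot>\<^bsub>?G\<^esub> H X) = frac_class S (c \<odot>\<^bsub>S\<^esub> h a) (h s)"
    proof -
      have C: "h a \<in> carrier S" "h s \<in> carrier S" "h s \<noteq> \<zero>\<^bsub>S\<^esub>" using X h0 by auto
      have "frac_class S (c \<odot>\<^bsub>S\<^esub> b) t = frac_class S (c \<odot>\<^bsub>S\<^esub> h a) (h s)"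
        if "(b, t) \<in> frac_class S (h a) (h s)" for b t
      proof -
        from that obtain u v where uv: "u \<in> carrier S" "v \<in> carrier S" "h s \<otimes>\<^bsub>S\<^esub> u = t \<otimes>\<^bsub>S\<^esub> v"
          "h s \<otimes>\<^bsub>S\<^esub> u \<noteq> \<zero>\<^bsub>S\<^esub>" "h a \<otimes>\<^bsub>S\<^esub> u = b \<otimes>\<^bsub>S\<^esub> v" and bt: "b \<in> carrier S" "t \<in> carrier S" "t \<noteq> \<zero>\<^bsub>S\<^esub>"
          unfolding S.mem_frac_class S.frac_rel_def by auto
        have "(c \<odot>\<^bsub>S\<^esub> h a) \<otimes>\<^bsub>S\<^esub> u = (c \<odot>\<^bsub>S\<^esub> b) \<otimes>\<^bsub>S\<^esub> v"
          using X uv bt C by (simp add: scale_mult)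
        then have "S.frac_rel (c \<odot>\<^bsub>S\<^esub> h a) (h s) (c \<odot>\<^bsub>S\<^esub> b) t" using S.frac_relI_common uv by blast
        then show ?thesis using C bt scale_closed' by (metis S.frac_class_eq_iff)
      qed
      then show ?thesis
        unfolding X(1) H[OF X(2-4)] skew_fraction_field_def
        by (simp, intro UN_pair_const[OF S.frac_class_self[OF C]])
    qed
    show "H (c \<odot>\<^bsub>?F\<^esub> X) = c \<odot>\<^bsub>?G\<^esub> H X"
      unfolding 1 2 using X scale_closed by (simp add: H h_scale)
  next
    fix X Y assume "X \<in> carrier ?F" "Y \<in> carrier ?F"
    then obtain a s b t where X: "X = frac_class R a s" "a \<in> carrier R" "s \<in> carrier R" "s \<noteq> \<zero>"
      and Y: "Y = frac_class R b t" "b \<in> carrier R" "t \<in> carrier R" "t \<noteq> \<zero>"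
      using car by meson
    have nz: "h s \<noteq> \<zero>\<^bsub>S\<^esub>" "h t \<noteq> \<zero>\<^bsub>S\<^esub>" using X Y h0 by auto
    have "\<exists>u \<in> carrier R. \<exists>v \<in> carrier R. v \<noteq> \<zero> \<and> b \<otimes> v = s \<otimes> u"
    proof (cases "b = \<zero>")
      case True
      then show ?thesis using X by (intro bexI[of _ "\<zero>"] bexI[of _ "\<one>"]) (auto simp: R.one_neq_zero)
    next
      case False
      then obtain v u where "v \<in> carrier R" "u \<in> carrier R" "b \<otimes> v = s \<otimes> u" "b \<otimes> v \<noteq> \<zero>"
        using R.ore[of b s] X Y by auto
      then show ?thesis using Y by (intro bexI[of _ u] bexI[of _ v]) auto
    qed
    then obtain u v where uv: "u \<in> carrier R" "v \<in> carrier R" "v \<noteq> \<zero>" "b \<otimes> v = s \<otimes> u"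
      by auto
    have huv: "h b \<otimes>\<^bsub>S\<^esub> h v = h s \<otimes>\<^bsub>S\<^esub> h u" "h v \<noteq> \<zero>\<^bsub>S\<^esub>"
      using arg_cong[OF uv(4), of h] uv(1-3) X Y h0 by auto
    show "H (X \<otimes>\<^bsub>?F\<^esub> Y) = H X \<otimes>\<^bsub>?G\<^esub> H Y"
      using X Y uv nz huv R.frac_mult_eq[OF X(2-4) Y(2-4) uv]
        S.frac_mult_eq[of "h a" "h s" "h b" "h t" "h u" "h v"]
      by (simp add: H skew_fraction_field_def R.mult_eq_zero_iff)
    obtain p q where pq: "p \<in> carrier R" "q \<in> carrier R" "s \<otimes> p = t \<otimes> q" "s \<otimes> p \<noteq> \<zero>"
      using R.ore[of s t] X Y by auto
    have hpq: "h s \<otimes>\<^bsub>S\<^esub> h p = h t \<otimes>\<^bsub>S\<^esub> h q" "h s \<otimes>\<^bsub>S\<^esub> h p \<noteq> \<zero>\<^bsub>S\<^esub>"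
      using arg_cong[OF pq(3), of h] pq(1,2,4) X Y h0[of "s \<otimes> p"] by auto
    show "H (X \<oplus>\<^bsub>?F\<^esub> Y) = H X \<oplus>\<^bsub>?G\<^esub> H Y"
    proof -
      have "X \<oplus>\<^bsub>?F\<^esub> Y = frac_class R (a \<otimes> p \<oplus> b \<otimes> q) (s \<otimes> p)"
        using R.frac_add_eq[OF X(2-4) Y(2-4) pq] X(1) Y(1) by (simp add: skew_fraction_field_def)
      moreover have "H X \<oplus>\<^bsub>?G\<^esub> H Y =
          frac_class S (h a \<otimes>\<^bsub>S\<^esub> h p \<oplus>\<^bsub>S\<^esub> h b \<otimes>\<^bsub>S\<^esub> h q) (h s \<otimes>\<^bsub>S\<^esub> h p)"
        using S.frac_add_eq[of "h a" "h s" "h b" "h t" "h p" "h q"] X Y pq(1,2) nz hpq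
        by (simp add: skew_fraction_field_def H)
      moreover have "H (frac_class R (a \<otimes> p \<oplus> b \<otimes> q) (s \<otimes> p)) =
          frac_class S (h (a \<otimes> p \<oplus> b \<otimes> q)) (h (s \<otimes> p))"
        using X Y pq(1,2,4) by (intro H) auto
      ultimately show ?thesis using X Y pq(1,2) by simp
    qed
  next
    show "H \<one>\<^bsub>?F\<^esub> = \<one>\<^bsub>?G\<^esub>"
      using R.one_neq_zero by (simp add: skew_fraction_field_def H)
  next
    show "bij_betw H (carrier ?F) (carrier ?G)"
    proof (rule bij_betwI')
      fix X Y assume "X \<in> carrier ?F" "Y \<in> carrier ?F"
      then obtain a s b t where X: "X = frac_class R a s" "a \<in> carrier R" "s \<in> carrier R" "s \<noteq> \<zero>"
        and Y: "Y = frac_class R b t" "b \<in> carrier R" "t \<in> carrier R" "t \<noteq> \<zero>"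
        using car by meson
      then show "(H X = H Y) = (X = Y)"
        using h0 by (simp add: H S.frac_class_eq_iff R.frac_class_eq_iff rel)
    next
      fix X assume "X \<in> carrier ?F"
      then obtain a s where X: "X = frac_class R a s" "a \<in> carrier R" "s \<in> carrier R" "s \<noteq> \<zero>"
        using car by auto
      then show "H X \<in> carrier ?G"
        unfolding carS using h0 by (intro exI[of _ "h a"] exI[of _ "h s"]) (auto simp: H)
    next
      fix Y assume "Y \<in> carrier ?G"
      then obtain d e where Y: "Y = frac_class S d e" and de: "d \<in> carrier S" "e \<in> carrier S" "e \<noteq> \<zero>\<^bsub>S\<^esub>"
        using carS by meson
      \<comment> \<open>Surjectivity: extending d e^-1 by a common denominator puts numerator and
        denominator into the image of \<open>h\<close>.\<close>
      obtain k a s where k: "k \<in> carrier R" "a \<in> carrier R" "s \<in> carrier R" "k \<noteq> \<zero>"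
        "d \<otimes>\<^bsub>S\<^esub> h k = h a" "e \<otimes>\<^bsub>S\<^esub> h k = h s"
        using common[OF de(1,2)] by auto
      have "h s \<noteq> \<zero>\<^bsub>S\<^esub>" using k(6)[symmetric] k(1,4) de h0 by (simp add: S.mult_eq_zero_iff)
      then have s: "s \<noteq> \<zero>" by auto
      have "S.frac_rel d e (h a) (h s)"
        by (rule S.frac_relI_common[of "h k" "\<one>\<^bsub>S\<^esub>"]) (use k \<open>h s \<noteq> _\<close> in auto)
      then have "Y = H (frac_class R a s)"
        using Y de k s \<open>h s \<noteq> _\<close> by (simp add: H S.frac_class_eq_iff)
      then show "\<exists>X \<in> carrier ?F. Y = H X" using car k s by blast
    qed
  qed
  then show ?thesis unfolding alg_isomorphic_def by blast
qed

alias lookup = Poly_Mapping.lookup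
alias keys = Poly_Mapping.keys
alias single = Poly_Mapping.single

section \<open>Linear operators on Laurent polynomials\<close>

text \<open>The operators act on Laurent polynomials in infinitely many variables, so that the Weyl
  algebras of all levels of the recursion lie in one type of class \<open>ring_1\<close> and
  operators of different levels can be multiplied and seen to commute.\<close>

typedef lop = "{f :: laurent \<Rightarrow> laurent. (\<forall>p q. f (p + q) = f p + f q) \<and>
    (\<forall>c p. f (single 0 c * p) = single 0 c * f p)}"
  morphisms app Abs_lop
  by (rule exI[of _ "\<lambda>_. 0"]) auto

setup_lifting type_definition_lop

instantiation lop :: ring_1
begin

lift_definition zero_lop :: lop is "\<lambda>_. 0" by simp
lift_definition one_lop :: lop is "\<lambda>p. p" by simp
lift_definition plus_lop :: "lop \<Rightarrow> lop \<Rightarrow> lop" is "\<lambda>f g p. f p + g p"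
  by (simp add: algebra_simps)
lift_definition minus_lop :: "lop \<Rightarrow> lop \<Rightarrow> lop" is "\<lambda>f g p. f p - g p"
  by (simp add: algebra_simps)
lift_definition uminus_lop :: "lop \<Rightarrow> lop" is "\<lambda>f p. - f p"
  by simp
lift_definition times_lop :: "lop \<Rightarrow> lop \<Rightarrow> lop" is "\<lambda>f g p. f (g p)"
  by simp

instance
proof
  show "(0 :: lop) \<noteq> 1"
    by transfer (metis zero_neq_one)
qed (transfer; simp add: fun_eq_iff algebra_simps)+

end

lift_definition scl :: "complex \<Rightarrow> lop \<Rightarrow> lop" is "\<lambda>c f p. single 0 c * f p"
  by (simp add: algebra_simps)

interpretation lop: vector_space scl
  by standard (transfer; simp add: fun_eq_iff algebra_simps single_add mult_single flip: mult.assoc)+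

lemma scl_mult_left: "scl c f * g = scl c (f * g)"
  by transfer simp

lemma scl_mult_right: "f * scl c g = scl c (f * g)"
  by transfer simp

lemma app_zero [simp]: "app 0 p = 0" by transfer simp
lemma app_one [simp]: "app 1 p = p" by transfer simp
lemma app_plus [simp]: "app (f + g) p = app f p + app g p" by transfer simp
lemma app_times [simp]: "app (f * g) p = app f (app g p)" by transfer simp
lemma app_scl [simp]: "app (scl c f) p = single 0 c * app f p" by transfer simp
lemma app_add_right: "app f (p + q) = app f p + app f q" by transfer simp
lemma app_scale_right: "app f (single 0 c * p) = single 0 c * app f p"
  by transfer simp
lemma lop_eqI: "(\<And>p. app f p = app g p) \<Longrightarrow> f = g" by transfer auto

lemma app_zero_right [simp]: "app f 0 = 0"
  using app_add_right[of f 0 0] by simp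

lemma app_sum_right: "app f (sum g A) = (\<Sum>i\<in>A. app f (g i))"
  by (induction A rule: infinite_finite_induct) (simp_all add: app_add_right)

abbreviation lmon :: "(nat \<Rightarrow>\<^sub>0 int) \<Rightarrow> laurent" where
  "lmon m \<equiv> single m 1"

lemma lookup_single_0_mult: "lookup (single 0 c * p) k = c * lookup p k"
  for p :: laurent
  by (simp add: mult_map_scale_conv_mult[symmetric] map.rep_eq when_def)

lemma laurent_expand: "p = (\<Sum>m\<in>keys p. single 0 (lookup p m) * lmon m)" for p :: laurent
  by (rule poly_mapping_eqI)
    (simp add: lookup_sum lookup_single_0_mult lookup_single when_def if_distrib[of "(*) _"] sum.delta' in_keys_iff
      cong: if_cong)

lemma app_expand: "app f p = (\<Sum>m\<in>keys p. single 0 (lookup p m) * app f (lmon m))"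
  by (subst laurent_expand[of p]) (simp add: app_sum_right app_scale_right)

text \<open>For a differential operator, written as a finite sum of x^a p_a(\<theta>) with
  \<theta>_v = x_v d_v, this is the value p_a(m). Zero divisors and leading terms are studied
  through these coefficient functions.\<close>

definition cf :: "lop \<Rightarrow> (nat \<Rightarrow>\<^sub>0 int) \<Rightarrow> (nat \<Rightarrow>\<^sub>0 int) \<Rightarrow> complex" where
  "cf f a m = lookup (app f (lmon m)) (m + a)"

lemma app_mono: "lookup (app f (lmon m)) k = cf f (k - m) m"
  by (simp add: cf_def)

lemma cf_eqI: "(\<And>a m. cf f a m = cf g a m) \<Longrightarrow> f = g"
proof (rule lop_eqI)
  fix p assume *: "\<And>a m. cf f a m = cf g a m"
  have "app f (lmon m) = app g (lmon m)" for m
    by (rule poly_mapping_eqI) (simp add: app_mono *)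
  then show "app f p = app g p" by (subst (1 2) app_expand) simp
qed

lemma cf_zero [simp]: "cf 0 a m = 0" by (simp add: cf_def)
lemma cf_one: "cf 1 a m = (if a = 0 then 1 else 0)" by (simp add: cf_def lookup_single when_def)
lemma cf_add: "cf (f + g) a m = cf f a m + cf g a m" by (simp add: cf_def lookup_add)
lemma cf_scl: "cf (scl c f) a m = c * cf f a m" by (simp add: cf_def lookup_single_0_mult)

text \<open>The right factor moves the exponent \<open>m\<close> to \<open>m + b\<close> before the
  left one acts, whence the shifted argument of \<open>cf f\<close>. The set \<open>S\<close> is
  left free so that a singleton can serve for a monomial or a derivation.\<close>

lemma cf_mult:
  assumes "finite S" "\<And>b. cf g b m \<noteq> 0 \<Longrightarrow> b \<in> S"
  shows "cf (f * g) a m = (\<Sum>b\<in>S. cf f (a - b) (m + b) * cf g b m)"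
proof -
  have "cf (f * g) a m = (\<Sum>k\<in>keys (app g (lmon m)). cf g (k - m) m * cf f (m + a - k) k)"
    by (subst cf_def, simp, subst app_expand)
      (simp add: lookup_sum lookup_single_0_mult app_mono)
  also have "\<dots> = (\<Sum>b\<in>(\<lambda>k. k - m) ` keys (app g (lmon m)). cf g b m * cf f (a - b) (m + b))"
    by (subst sum.reindex) (auto simp: inj_on_def algebra_simps)
  also have "\<dots> = (\<Sum>b\<in>S. cf f (a - b) (m + b) * cf g b m)"
  proof (rule sum.mono_neutral_cong_left)
    show "(\<lambda>k. k - m) ` keys (app g (lmon m)) \<subseteq> S"
      using assms(2) by (auto simp: in_keys_iff app_mono)
    show "\<forall>i\<in>S - (\<lambda>k. k - m) ` keys (app g (lmon m)). cf f (a - i) (m + i) * cf g i m = 0"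
    proof
      fix i assume i: "i \<in> S - (\<lambda>k. k - m) ` keys (app g (lmon m))"
      then have "i + m \<notin> keys (app g (lmon m))" by (auto simp: image_iff)
      then show "cf f (a - i) (m + i) * cf g i m = 0" by (simp add: in_keys_iff app_mono)
    qed
  qed (use assms in auto)
  finally show ?thesis .
qed

lift_definition mulop :: "(nat \<Rightarrow>\<^sub>0 int) \<Rightarrow> lop" is "\<lambda>m p. lmon m * p"
  by (simp add: algebra_simps)

lemma app_mulop: "app (mulop m) p = lmon m * p" by (simp add: mulop.rep_eq)

lemma mulop_mult: "mulop k * mulop m = mulop (k + m)"
  by (rule lop_eqI) (simp add: app_mulop mult_single flip: mult.assoc)

lemma mulop_zero [simp]: "mulop 0 = 1"
  by (rule lop_eqI) (simp add: app_mulop)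

lemma mulop_commute: "mulop k * mulop m = mulop m * mulop k"
  by (simp add: mulop_mult add.commute)

lemma cf_mulop: "cf (mulop k) a m = (if a = k then 1 else 0)"
  by (simp add: cf_def app_mulop mult_single lookup_single when_def add.commute) 

lift_definition pder :: "nat \<Rightarrow> lop" is "\<lambda>v p. \<Sum>m\<in>keys p.
    single (m - single v 1) (of_int (lookup m v) * lookup p m)"
proof (intro CollectI conjI allI)
  fix v :: nat and p q :: laurent and c :: complex
  show "(\<Sum>m\<in>keys (p + q). single (m - single v 1) (of_int (lookup m v) * lookup (p + q) m)) =
    (\<Sum>m\<in>keys p. single (m - single v 1) (of_int (lookup m v) * lookup p m)) +
    (\<Sum>m\<in>keys q. single (m - single v 1) (of_int (lookup m v) * lookup q m))"
    by (rule setsum_keys_plus_distrib) (simp_all add: single_add algebra_simps)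
  have "(\<Sum>m\<in>keys (single 0 c * p). single (m - single v 1)
      (of_int (lookup m v) * lookup (single 0 c * p) m)) =
    (\<Sum>m\<in>keys p. single (m - single v 1)
      (of_int (lookup m v) * lookup (single 0 c * p) m))"
    by (rule sum.mono_neutral_left) (auto simp: in_keys_iff lookup_single_0_mult)
  then show "(\<Sum>m\<in>keys (single 0 c * p). single (m - single v 1)
      (of_int (lookup m v) * lookup (single 0 c * p) m)) =
    single 0 c * (\<Sum>m\<in>keys p. single (m - single v 1)
      (of_int (lookup m v) * lookup p m))"
    by (simp add: sum_distrib_left mult_single lookup_single_0_mult mult.left_commute)
qed

lemma app_pder_mono:
  "app (pder v) (lmon m) = single (m - single v 1) (of_int (lookup m v))"
  by (simp add: pder.rep_eq)

lemma cf_pder: "cf (pder v) a m = (if a = - single v 1 then of_int (lookup m v) else 0)"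
proof -
  have "m - single v 1 = m + a \<longleftrightarrow> a = - single v 1"
    by (metis add_left_cancel diff_conv_add_uminus)
  then show ?thesis by (simp add: cf_def app_pder_mono lookup_single when_def)
qed

lemma pder_commute: "pder v * pder w = pder w * pder v"
proof (rule cf_eqI)
  fix a m
  have 1: "cf (pder v * pder w) a m =
      cf (pder v) (a + single w 1) (m - single w 1) * of_int (lookup m w)" for v w
    by (subst cf_mult[of "{- single w 1}"]) (auto simp: cf_pder split: if_splits)
  have "a + single w 1 = - single v 1 \<longleftrightarrow>
      a + single v 1 = - single w 1"
    by (simp add: eq_neg_iff_add_eq_0 add_ac)
  then show "cf (pder v * pder w) a m = cf (pder w * pder v) a m"
    by (auto simp: 1 cf_pder lookup_minus lookup_single when_def)
qed

lemma pder_mulop: "pder v * mulop k = mulop k * pder v + scl (of_int (lookup k v)) (mulop (k - single v 1))"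
proof (rule cf_eqI)
  fix a m
  have 1: "cf (pder v * mulop k) a m = cf (pder v) (a - k) (m + k)"
    by (subst cf_mult[of "{k}"]) (auto simp: cf_mulop split: if_splits)
  have 2: "cf (mulop k * pder v) a m =
      cf (mulop k) (a + single v 1) (m - single v 1) * of_int (lookup m v)"
    by (subst cf_mult[of "{- single v 1}"]) (auto simp: cf_pder split: if_splits)
  have "a + single v 1 = k \<longleftrightarrow> a - k = - single v 1"
    by (auto simp: algebra_simps eq_neg_iff_add_eq_0)
  moreover have "a = k - single v 1 \<longleftrightarrow> a - k = - single v 1"
    by (auto simp: algebra_simps)
  ultimately show "cf (pder v * mulop k) a m =
      cf (mulop k * pder v + scl (of_int (lookup k v)) (mulop (k - single v 1))) a m"
    by (simp add: 1 2 cf_add cf_scl cf_mulop cf_pder lookup_add)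
qed

section \<open>Free algebras modulo Lie relations\<close>

abbreviation fscale :: "complex \<Rightarrow> ('g word \<Rightarrow>\<^sub>0 complex) \<Rightarrow> ('g word \<Rightarrow>\<^sub>0 complex)" where
  "fscale c p \<equiv> single 0 c * p"

interpretation fa: vector_space "fscale :: complex \<Rightarrow> ('g word \<Rightarrow>\<^sub>0 complex) \<Rightarrow> _"
  by standard (simp_all add: algebra_simps single_add mult_single flip: mult.assoc)

lemma letters_zero [simp]: "letters 0 = []"
  by (simp add: zero_word_def)

lemma free_expand: "p = (\<Sum>w\<in>keys p. single w (lookup p w))"
  by (rule poly_mapping_eqI)
    (simp add: lookup_sum lookup_single when_def sum.delta in_keys_iff)

lemma fscale_commute: "p * single 0 c = fscale c p" for p :: "'g word \<Rightarrow>\<^sub>0 complex"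
proof -
  have "(\<Sum>w\<in>keys p. single w (lookup p w)) * single 0 c =
      fscale c (\<Sum>w\<in>keys p. single w (lookup p w))"
    by (simp add: sum_distrib_left sum_distrib_right mult_single mult.commute)
  then show ?thesis by (simp flip: free_expand)
qed

lemma mult_fscale_right: "p * fscale c q = fscale c (p * q)" for p :: "'g word \<Rightarrow>\<^sub>0 complex"
  by (metis fscale_commute mult.assoc)

lemma free_alg_closed:
  "0 \<in> carrier (free_alg X)"
  "1 \<in> carrier (free_alg X)"
  "single 0 c \<in> carrier (free_alg X)"
  "p \<in> carrier (free_alg X) \<Longrightarrow> q \<in> carrier (free_alg X) \<Longrightarrow> p + q \<in> carrier (free_alg X)"
  "p \<in> carrier (free_alg X) \<Longrightarrow> q \<in> carrier (free_alg X) \<Longrightarrow> p * q \<in> carrier (free_alg X)"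
  "p \<in> carrier (free_alg X) \<Longrightarrow> - p \<in> carrier (free_alg X)"
proof -
  show "0 \<in> carrier (free_alg X)" "1 \<in> carrier (free_alg X)"
    "single 0 c \<in> carrier (free_alg X)"
    by (auto simp: free_alg_def)
  show "p + q \<in> carrier (free_alg X)" if "p \<in> carrier (free_alg X)" "q \<in> carrier (free_alg X)"
    using that Poly_Mapping.keys_add[of p q] by (auto simp: free_alg_def)
  show "p * q \<in> carrier (free_alg X)" if p: "p \<in> carrier (free_alg X)" and q: "q \<in> carrier (free_alg X)"
  proof -
    have "set (letters w) \<subseteq> X" if w: "w \<in> keys (p * q)" for w
    proof -
      obtain u v where "w = u + v" "u \<in> keys p" "v \<in> keys q" using w keys_mult[of p q] by blast
      then show ?thesis using p q by (auto simp: free_alg_def plus_word_def)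
    qed
    then show ?thesis by (auto simp: free_alg_def)
  qed
  show "- p \<in> carrier (free_alg X)" if "p \<in> carrier (free_alg X)"
    using that by (auto simp: free_alg_def in_keys_iff)
qed

lemma free_alg_simps:
  "x \<otimes>\<^bsub>free_alg X\<^esub> y = x * y" "x \<oplus>\<^bsub>free_alg X\<^esub> y = x + y" "\<one>\<^bsub>free_alg X\<^esub> = 1" "\<zero>\<^bsub>free_alg X\<^esub> = 0"
  "c \<odot>\<^bsub>free_alg X\<^esub> x = fscale c x"
  by (simp_all add: free_alg_def)

lemma ring_free_alg: "ring (free_alg X)"
proof (rule ringI)
  show "abelian_group (free_alg X)"
    by (rule abelian_groupI)
      (auto simp: free_alg_simps free_alg_closed algebra_simps
        intro: bexI[of _ "- _"] free_alg_closed)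
  show "Group.monoid (free_alg X)"
    by (rule Group.monoidI) (auto simp: free_alg_simps free_alg_closed algebra_simps)
qed (auto simp: free_alg_simps algebra_simps)

lemma letter_closed: "x \<in> X \<Longrightarrow> letter x \<in> carrier (free_alg X)"
  by (simp add: letter_def free_alg_def)

lemma prod_letters: "prod_list (map letter xs) = single (Word xs) 1"
  by (induction xs) (simp_all add: letter_def mult_single plus_word_def flip: zero_word_def)

definition ev :: "('g \<Rightarrow> lop) \<Rightarrow> ('g word \<Rightarrow>\<^sub>0 complex) \<Rightarrow> lop" where
  "ev \<phi> p = (\<Sum>w\<in>keys p. scl (lookup p w) (prod_list (map \<phi> (letters w))))"

lemma ev_add: "ev \<phi> (p + q) = ev \<phi> p + ev \<phi> q"
  unfolding ev_def by (rule setsum_keys_plus_distrib) (simp_all add: lop.scale_left_distrib)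

lemma ev_zero [simp]: "ev \<phi> 0 = 0"
  by (simp add: ev_def)

lemma ev_sum: "ev \<phi> (sum f A) = (\<Sum>i\<in>A. ev \<phi> (f i))"
  by (induction A rule: infinite_finite_induct) (simp_all add: ev_add)

lemma ev_single: "ev \<phi> (single w c) = scl c (prod_list (map \<phi> (letters w)))"
  by (simp add: ev_def)

lemma ev_one [simp]: "ev \<phi> 1 = 1"
  by (simp add: ev_def)

lemma ev_letter [simp]: "ev \<phi> (letter x) = \<phi> x"
  by (simp add: letter_def ev_single)

lemma ev_mult: "ev \<phi> (p * q) = ev \<phi> p * ev \<phi> q"
proof -
  have "p * q = (\<Sum>v\<in>keys p. \<Sum>w\<in>keys q. single (v + w) (lookup p v * lookup q w))"
    by (subst (1) free_expand[of p], subst (1) free_expand[of q])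
      (simp add: sum_product mult_single)
  then have "ev \<phi> (p * q) = (\<Sum>v\<in>keys p. \<Sum>w\<in>keys q.
      scl (lookup p v * lookup q w) (prod_list (map \<phi> (letters v)) * prod_list (map \<phi> (letters w))))"
    by (simp add: ev_sum ev_single plus_word_def)
  also have "\<dots> = ev \<phi> p * ev \<phi> q"
    unfolding ev_def sum_product by (simp add: scl_mult_left scl_mult_right mult.commute)
  finally show ?thesis .
qed

lemma ev_fscale: "ev \<phi> (fscale c p) = scl c (ev \<phi> p)"
  by (simp add: ev_mult ev_single scl_mult_left)

lemma ev_minus: "ev \<phi> (p - q) = ev \<phi> p - ev \<phi> q"
  using ev_add[of \<phi> "p - q" q] by (simp add: algebra_simps)

text \<open>
  The spanning half of the Poincare-Birkhoff-Witt theorem, modulo an ideal \<open>J\<close> containing the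
  relations of a Lie algebra with basis \<open>b 0, \<dots>, b (q - 1)\<close>.
\<close>

locale straightening =
  fixes X :: "'g set" and J :: "('g word \<Rightarrow>\<^sub>0 complex) set"
    and q :: nat and b :: "nat \<Rightarrow> 'g" and coef :: "'g \<Rightarrow> nat \<Rightarrow> complex" and br :: "'g \<Rightarrow> 'g \<Rightarrow> 'g"
  assumes J_subspace: "fa.subspace J"
    and J_left: "p \<in> carrier (free_alg X) \<Longrightarrow> j \<in> J \<Longrightarrow> p * j \<in> J"
    and J_right: "p \<in> carrier (free_alg X) \<Longrightarrow> j \<in> J \<Longrightarrow> j * p \<in> J"
    and b_in: "i < q \<Longrightarrow> b i \<in> X"
    and br_in: "x \<in> X \<Longrightarrow> y \<in> X \<Longrightarrow> br x y \<in> X"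
    and comm: "x \<in> X \<Longrightarrow> y \<in> X \<Longrightarrow> letter x * letter y - letter y * letter x - letter (br x y) \<in> J"
    and lin: "x \<in> X \<Longrightarrow> letter x - (\<Sum>k<q. fscale (coef x k) (letter (b k))) \<in> J"
begin

definition mon :: "nat list \<Rightarrow> 'g word \<Rightarrow>\<^sub>0 complex" where
  "mon v = prod_list (map (\<lambda>i. letter (b i)) v)"

definition lists_upto :: "nat \<Rightarrow> nat list set" where
  "lists_upto N = {v. set v \<subseteq> {..<q} \<and> length v \<le> N}"

abbreviation sorted_upto :: "nat \<Rightarrow> nat list set" where
  "sorted_upto N \<equiv> {v \<in> lists_upto N. sorted v}"

lemma finite_sorted_upto: "finite (sorted_upto N)"
  by (rule finite_subset[OF _ finite_lists_length_le[of "{..<q}" N]]) (auto simp: lists_upto_def)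

definition L :: "nat \<Rightarrow> ('g word \<Rightarrow>\<^sub>0 complex) set" where
  "L N = fa.span (mon ` lists_upto N \<union> J)"

lemma mon_Nil [simp]: "mon [] = 1" and mon_Cons: "mon (x # v) = letter (b x) * mon v"
  by (simp_all add: mon_def)

lemma mon_closed: "set v \<subseteq> {..<q} \<Longrightarrow> mon v \<in> carrier (free_alg X)"
  by (induction v) (auto simp: mon_Cons free_alg_closed letter_closed b_in)

lemma L_subspace: "fa.subspace (L N)"
  by (simp add: L_def)

lemmas L_add = fa.subspace_add[OF L_subspace]
  and L_scale = fa.subspace_scale[OF L_subspace]
  and L_sum = fa.subspace_sum[OF L_subspace]
  and L_zero = fa.subspace_0[OF L_subspace]

lemma L_mono: "N \<le> M \<Longrightarrow> L N \<subseteq> L M"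
  unfolding L_def by (rule fa.span_mono) (auto simp: lists_upto_def)

lemma J_L: "j \<in> J \<Longrightarrow> j \<in> L N"
  unfolding L_def by (rule fa.span_base) simp

lemma mon_L: "set v \<subseteq> {..<q} \<Longrightarrow> length v \<le> N \<Longrightarrow> mon v \<in> L N"
  unfolding L_def by (rule fa.span_base) (auto simp: lists_upto_def)

lemma letter_L:
  assumes i: "i < q" and p: "p \<in> L N"
  shows "letter (b i) * p \<in> L (Suc N)"
proof -
  have "fa.subspace {p. letter (b i) * p \<in> L (Suc N)}"
    by (rule fa.subspaceI) (auto simp: L_zero distrib_left L_add mult_fscale_right L_scale)
  moreover have "letter (b i) * x \<in> L (Suc N)" if "x \<in> mon ` lists_upto N \<union> J" for x
    using that
  proof
    assume "x \<in> mon ` lists_upto N"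
    then obtain v where v: "x = mon v" "set v \<subseteq> {..<q}" "length v \<le> N" by (auto simp: lists_upto_def)
    have "mon (i # v) \<in> L (Suc N)" by (rule mon_L) (use v i in auto)
    then show ?thesis by (simp add: v mon_Cons)
  next
    assume "x \<in> J"
    then show ?thesis by (intro J_L J_left letter_closed b_in i)
  qed
  ultimately show ?thesis using fa.span_induct[of p "mon ` lists_upto N \<union> J" "\<lambda>p. letter (b i) * p \<in> L (Suc N)"]
      p unfolding L_def by blast
qed

lemma letter_word_L:
  assumes x: "x \<in> X" and p: "p \<in> L N" "p \<in> carrier (free_alg X)"
  shows "letter x * p \<in> L (Suc N)"
proof -
  have "(letter x - (\<Sum>k<q. fscale (coef x k) (letter (b k)))) * p \<in> L (Suc N)"
    by (intro J_L J_right p lin x)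
  moreover have "(\<Sum>k<q. fscale (coef x k) (letter (b k))) * p \<in> L (Suc N)"
    unfolding sum_distrib_right mult.assoc using p(1) by (intro L_sum L_scale letter_L) auto
  ultimately show ?thesis using L_add by (fastforce simp: left_diff_distrib)
qed

lemma word_L:
  "set xs \<subseteq> X \<Longrightarrow> prod_list (map letter xs) \<in> L (length xs) \<and> prod_list (map letter xs) \<in> carrier (free_alg X)"
proof (induction xs)
  case Nil
  then show ?case using mon_L[of "[]" 0] by (simp add: free_alg_closed)
next
  case (Cons x xs)
  then show ?case by (simp add: letter_word_L free_alg_closed letter_closed)
qed

text \<open>Exchanging two neighbours costs their bracket, a single letter, so the error is shorter
  by one than the words themselves.\<close>

lemma swap_L:
  assumes "i < q" "j < q" "set v \<subseteq> {..<q}"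
  shows "mon (i # j # v) - mon (j # i # v) \<in> L (Suc (length v))"
proof -
  let ?B = "br (b i) (b j)"
  have "(letter (b i) * letter (b j) - letter (b j) * letter (b i) - letter ?B) * mon v \<in> L (Suc (length v))"
    by (intro J_L J_right mon_closed comm b_in assms)
  moreover have "letter ?B * mon v \<in> L (Suc (length v))"
    by (intro letter_word_L br_in b_in mon_L mon_closed assms order_refl)
  ultimately have "(letter (b i) * letter (b j) - letter (b j) * letter (b i) - letter ?B) * mon v +
      letter ?B * mon v \<in> L (Suc (length v))" by (rule L_add)
  then show ?thesis by (simp add: mon_Cons algebra_simps)
qed

lemma insort_L:
  "x < q \<Longrightarrow> set v \<subseteq> {..<q} \<Longrightarrow> mon (x # v) - mon (insort x v) \<in> L (length v)"
proof (induction v)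
  case (Cons y v)
  show ?case
  proof (cases "x \<le> y")
    case False
    have "mon (x # y # v) - mon (y # x # v) \<in> L (Suc (length v))"
      using Cons.prems by (intro swap_L) auto
    moreover have "letter (b y) * (mon (x # v) - mon (insort x v)) \<in> L (Suc (length v))"
      using Cons by (intro letter_L) auto
    ultimately have "mon (x # y # v) - mon (y # x # v) + letter (b y) * (mon (x # v) - mon (insort x v))
        \<in> L (Suc (length v))" by (rule L_add)
    then show ?thesis using False by (simp add: mon_Cons algebra_simps)
  qed (simp add: L_zero)
qed (simp add: L_zero)

lemma sort_L: "set v \<subseteq> {..<q} \<Longrightarrow> mon v - mon (sort v) \<in> L (length v - 1)"
proof (induction v)
  case (Cons x v)
  show ?case
  proof (cases v)
    case Nil
    then show ?thesis by (simp add: L_zero)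
  next
    case (Cons y v')
    \<comment> \<open>The tail is nonempty in this case, so the truncated
      \<open>length v - 1\<close> is a true predecessor and multiplying by a letter stays within
      \<open>length v\<close>.\<close>
    have "letter (b x) * (mon v - mon (sort v)) \<in> L (Suc (length v - 1))"
      using Cons.IH Cons.prems by (intro letter_L) auto
    then have "letter (b x) * (mon v - mon (sort v)) \<in> L (length v)" using Cons by simp
    moreover have "mon (x # sort v) - mon (insort x (sort v)) \<in> L (length (sort v))"
      using Cons.prems by (intro insort_L) auto
    ultimately have "letter (b x) * (mon v - mon (sort v)) + (mon (x # sort v) - mon (insort x (sort v)))
        \<in> L (length v)" using L_add by simp
    then show ?thesis by (simp add: mon_Cons algebra_simps)
  qed
qed (simp add: L_zero)

definition S :: "nat \<Rightarrow> ('g word \<Rightarrow>\<^sub>0 complex) set" where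
  "S N = fa.span (mon ` sorted_upto N \<union> J)"

text \<open>Replacing a word by its sorted form leaves an error of smaller length, which lies in the
  sorted span by strong induction.\<close>

lemma L_eq_S: "L N \<subseteq> S N"
proof (induction N rule: less_induct)
  case (less N)
  have "mon v \<in> S N" if v: "v \<in> lists_upto N" for v
  proof (cases v)
    case Nil
    then show ?thesis unfolding S_def by (intro fa.span_base UnI1 image_eqI[of _ _ "[]"]) (auto simp: lists_upto_def)
  next
    case (Cons x v')
    have "mon v - mon (sort v) \<in> L (length v - 1)" using v by (intro sort_L) (simp add: lists_upto_def)
    moreover have "L (length v - 1) \<subseteq> S (length v - 1)" using v Cons by (intro less) (simp add: lists_upto_def)
    moreover have "S (length v - 1) \<subseteq> S N"
      unfolding S_def using v by (intro fa.span_mono) (auto simp: lists_upto_def)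
    ultimately have "mon v - mon (sort v) \<in> S N" by blast
    moreover have "mon (sort v) \<in> S N"
      unfolding S_def using v by (intro fa.span_base) (auto simp: lists_upto_def)
    ultimately have "(mon v - mon (sort v)) + mon (sort v) \<in> S N"
      unfolding S_def by (rule fa.span_add)
    then show ?thesis by simp
  qed
  moreover have "J \<subseteq> S N" unfolding S_def using fa.span_superset by blast
  ultimately have "mon ` lists_upto N \<union> J \<subseteq> S N" by blast
  then show ?case unfolding L_def S_def by (intro fa.span_minimal) auto
qed

theorem word_straightening:
  assumes "set (letters w) \<subseteq> X" "length (letters w) \<le> N"
  shows "single w 1 \<in> S N"
proof -
  have "prod_list (map letter (letters w)) \<in> L N"
    using word_L[OF assms(1)] L_mono[OF assms(2)] by blast
  then show ?thesis using L_eq_S by (auto simp: prod_letters)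
qed

lemma poly_straightening:
  assumes p: "\<And>w. w \<in> keys p \<Longrightarrow> set (letters w) \<subseteq> X \<and> length (letters w) \<le> N"
  shows "\<exists>a. p - (\<Sum>v\<in>sorted_upto N. fscale (a v) (mon v)) \<in> J"
proof -
  have "single w (lookup p w) \<in> S N" if "w \<in> keys p" for w
  proof -
    have "fscale (lookup p w) (single w 1) \<in> S N"
      using word_straightening[of w N] p[OF that] unfolding S_def by (intro fa.span_scale) auto
    then show ?thesis by (simp add: mult_single)
  qed
  then have "(\<Sum>w\<in>keys p. single w (lookup p w)) \<in> S N"
    unfolding S_def by (rule fa.span_sum)
  then have "p \<in> S N" by (simp flip: free_expand)
  then obtain s j where sj: "p = s + j" "s \<in> fa.span (mon ` sorted_upto N)" "j \<in> fa.span J"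
    unfolding S_def fa.span_Un by auto
  have "\<exists>a. s = (\<Sum>v\<in>sorted_upto N. fscale (a v) (mon v))"
    using sj(2)
  proof (induction rule: fa.span_induct_alt)
    case base
    show ?case by (rule exI[of _ "\<lambda>_. 0"]) simp
  next
    case (step c x y)
    then obtain a v0 where a: "y = (\<Sum>v\<in>sorted_upto N. fscale (a v) (mon v))"
      and v0: "x = mon v0" "v0 \<in> sorted_upto N" by auto
    have "(\<Sum>v\<in>sorted_upto N. fscale (a v + (if v = v0 then c else 0)) (mon v)) =
        (\<Sum>v\<in>sorted_upto N. fscale (a v) (mon v) + (if v = v0 then fscale c (mon v0) else 0))"
      by (intro sum.cong) (auto simp: single_add distrib_right)
    also have "\<dots> = fscale c x + y" using finite_sorted_upto v0 by (simp add: sum.distrib a)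
    finally show ?case by (intro exI) (rule sym)
  qed
  then obtain a where a: "s = (\<Sum>v\<in>sorted_upto N. fscale (a v) (mon v))" ..
  have "j \<in> J" using sj(3) J_subspace fa.span_eq_iff[of J] by metis
  then show ?thesis by (intro exI[of _ a]) (simp add: sj(1) flip: a)
qed

end

section \<open>Regular operators\<close>

text \<open>The coefficients of differential operators are polynomial functions of the exponent.
  Evaluating them along curves with polynomial coordinates reduces every question about them to
  polynomials in the single variable t.\<close>

definition polycurve :: "(nat \<Rightarrow> nat \<Rightarrow>\<^sub>0 int) \<Rightarrow> bool" where
  "polycurve \<gamma> \<longleftrightarrow>
    (\<exists>g :: nat \<Rightarrow> complex poly. \<forall>v t. of_int (lookup (\<gamma> t) v) = poly (g v) (of_nat t))"

lemma polycurve_add: "polycurve \<gamma> \<Longrightarrow> polycurve (\<lambda>t. \<gamma> t + b)"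
  unfolding polycurve_def
proof (elim exE)
  fix g :: "nat \<Rightarrow> complex poly"
  assume "\<forall>v t. of_int (lookup (\<gamma> t) v) = poly (g v) (of_nat t)"
  then show "\<exists>g :: nat \<Rightarrow> complex poly. \<forall>v t. of_int (lookup (\<gamma> t + b) v) = poly (g v) (of_nat t)"
    by (intro exI[of _ "\<lambda>v. g v + [:of_int (lookup b v):]"]) (simp add: lookup_add)
qed

lemma polycurve_line: "polycurve (\<lambda>t. a + frag_cmul (int t) b)"
  unfolding polycurve_def
  by (intro exI[of _ "\<lambda>v. [:of_int (lookup a v), of_int (lookup b v):]"]) (simp add: lookup_add)

definition supp :: "lop \<Rightarrow> (nat \<Rightarrow>\<^sub>0 int) set" where
  "supp f = {a. \<exists>m. cf f a m \<noteq> 0}"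

text \<open>Polynomiality is demanded along all polynomial curves and not only along one line,
  because a product evaluates its left factor on translates of the curve.\<close>

definition regular :: "lop \<Rightarrow> bool" where
  "regular f \<longleftrightarrow> finite (supp f) \<and>
    (\<forall>a \<gamma>. polycurve \<gamma> \<longrightarrow> (\<exists>q. \<forall>t. cf f a (\<gamma> t) = poly q (of_nat t)))"

lemma cf_mult_supp: "finite (supp g) \<Longrightarrow> cf (f * g) a m = (\<Sum>b\<in>supp g. cf f (a - b) (m + b) * cf g b m)"
  by (rule cf_mult) (auto simp: supp_def)

lemma regular_one: "regular 1"
  unfolding regular_def
proof (intro conjI allI impI)
  show "finite (supp 1)"
    by (rule finite_subset[of _ "{0}"]) (auto simp: supp_def cf_one)
  show "\<exists>q. \<forall>t. cf 1 a (\<gamma> t) = poly q (of_nat t)" for a and \<gamma> :: "nat \<Rightarrow> nat \<Rightarrow>\<^sub>0 int"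
    by (rule exI[of _ "[:if a = 0 then 1 else 0:]"]) (simp add: cf_one)
qed

lemma regular_mulop: "regular (mulop k)"
  unfolding regular_def
proof (intro conjI allI impI)
  show "finite (supp (mulop k))"
    by (rule finite_subset[of _ "{k}"]) (auto simp: supp_def cf_mulop)
  show "\<exists>q. \<forall>t. cf (mulop k) a (\<gamma> t) = poly q (of_nat t)" for a and \<gamma> :: "nat \<Rightarrow> nat \<Rightarrow>\<^sub>0 int"
    by (rule exI[of _ "[:if a = k then 1 else 0:]"]) (simp add: cf_mulop)
qed

lemma regular_pder: "regular (pder v)"
  unfolding regular_def
proof (intro conjI allI impI)
  show "finite (supp (pder v))"
    by (rule finite_subset[of _ "{- single v 1}"]) (auto simp: supp_def cf_pder)
  fix a and \<gamma> :: "nat \<Rightarrow> nat \<Rightarrow>\<^sub>0 int"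
  assume "polycurve \<gamma>"
  then obtain g :: "nat \<Rightarrow> complex poly" where "\<And>v t. of_int (lookup (\<gamma> t) v) = poly (g v) (of_nat t)"
    unfolding polycurve_def by auto
  then show "\<exists>q. \<forall>t. cf (pder v) a (\<gamma> t) = poly q (of_nat t)"
    by (intro exI[of _ "if a = - single v 1 then g v else 0"]) (simp add: cf_pder)
qed

lemma regular_add:
  assumes "regular f" "regular g"
  shows "regular (f + g)"
  unfolding regular_def
proof (intro conjI allI impI)
  show "finite (supp (f + g))"
    by (rule finite_subset[of _ "supp f \<union> supp g"]) (use assms in \<open>auto simp: supp_def cf_add regular_def\<close>)
  fix a and \<gamma> :: "nat \<Rightarrow> nat \<Rightarrow>\<^sub>0 int"
  assume "polycurve \<gamma>"
  then obtain p q where "\<And>t. cf f a (\<gamma> t) = poly p (of_nat t)" "\<And>t. cf g a (\<gamma> t) = poly q (of_nat t)"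
    using assms unfolding regular_def by meson
  then show "\<exists>q. \<forall>t. cf (f + g) a (\<gamma> t) = poly q (of_nat t)"
    by (intro exI[of _ "p + q"]) (simp add: cf_add)
qed

lemma regular_scl:
  assumes "regular f"
  shows "regular (scl c f)"
  unfolding regular_def
proof (intro conjI allI impI)
  show "finite (supp (scl c f))"
    by (rule finite_subset[of _ "supp f"]) (use assms in \<open>auto simp: supp_def cf_scl regular_def\<close>)
  fix a and \<gamma> :: "nat \<Rightarrow> nat \<Rightarrow>\<^sub>0 int"
  assume "polycurve \<gamma>"
  then obtain p where "\<And>t. cf f a (\<gamma> t) = poly p (of_nat t)"
    using assms unfolding regular_def by meson
  then show "\<exists>q. \<forall>t. cf (scl c f) a (\<gamma> t) = poly q (of_nat t)"
    by (intro exI[of _ "smult c p"]) (simp add: cf_scl)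
qed

lemma regular_mult:
  assumes f: "regular f" and g: "regular g"
  shows "regular (f * g)"
  unfolding regular_def
proof (intro conjI allI impI)
  have fin: "finite (supp f)" "finite (supp g)" using assms by (auto simp: regular_def)
  have "a \<in> (\<lambda>(x, y). x + y) ` (supp f \<times> supp g)" if a: "a \<in> supp (f * g)" for a
  proof -
    obtain m where "cf (f * g) a m \<noteq> 0" using a by (auto simp: supp_def)
    then have "\<exists>b\<in>supp g. cf f (a - b) (m + b) * cf g b m \<noteq> 0"
      unfolding cf_mult_supp[OF fin(2)] by (meson sum.neutral)
    then obtain b where "b \<in> supp g" "cf f (a - b) (m + b) \<noteq> 0" by auto
    then have "b \<in> supp g" "a - b \<in> supp f" by (auto simp: supp_def)
    then show ?thesis by (intro image_eqI[of _ _ "(a - b, b)"]) auto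
  qed
  then show "finite (supp (f * g))"
    using fin by (meson finite_SigmaI finite_imageI finite_subset subsetI)
  fix a and \<gamma> :: "nat \<Rightarrow> nat \<Rightarrow>\<^sub>0 int"
  assume \<gamma>: "polycurve \<gamma>"
  have "\<exists>p. \<forall>t. cf f (a - b) (\<gamma> t + b) = poly p (of_nat t)" for b
    using f polycurve_add[OF \<gamma>, of b] unfolding regular_def by blast
  then obtain p where p: "\<And>b t. cf f (a - b) (\<gamma> t + b) = poly (p b) (of_nat t)" by metis
  have "\<exists>q. \<forall>t. cf g b (\<gamma> t) = poly q (of_nat t)" for b
    using g \<gamma> unfolding regular_def by blast
  then obtain q where q: "\<And>b t. cf g b (\<gamma> t) = poly (q b) (of_nat t)" by metis
  show "\<exists>q. \<forall>t. cf (f * g) a (\<gamma> t) = poly q (of_nat t)"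
    by (intro exI[of _ "\<Sum>b\<in>supp g. p b * q b"]) (simp add: cf_mult_supp[OF fin(2)] p q poly_sum)
qed

lemma poly_of_nat_zero:
  fixes q :: "complex poly"
  assumes "\<And>t :: nat. poly q (of_nat t) = 0"
  shows "q = 0"
proof (rule ccontr)
  assume "q \<noteq> 0"
  then have "finite {x. poly q x = 0}" by (rule poly_roots_finite)
  then have "finite (range (of_nat :: nat \<Rightarrow> complex))"
    by (rule finite_subset[rotated]) (use assms in auto)
  moreover have "inj (of_nat :: nat \<Rightarrow> complex)" by (simp add: inj_def)
  ultimately show False using finite_imageD infinite_UNIV_nat by blast
qed

lemma supp_empty: "supp f = {} \<Longrightarrow> f = 0"
  by (rule cf_eqI) (auto simp: supp_def)

text \<open>In the ordered group of exponents the largest exponents \<alpha> and \<beta> of the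
  factors contribute alone to the coefficient at \<alpha> + \<beta>. It is a product of two
  functions that are nonzero at possibly different points; on a line through both points they become
  nonzero polynomials in one variable.\<close>

theorem regular_no_zero_divisors:
  assumes f: "regular f" "f \<noteq> 0" and g: "regular g" "g \<noteq> 0"
  shows "f * g \<noteq> 0"
proof
  assume fg: "f * g = 0"
  have fin: "finite (supp f)" "finite (supp g)" using assms by (auto simp: regular_def)
  have ne: "supp f \<noteq> {}" "supp g \<noteq> {}" using supp_empty f g by auto
  define \<alpha> \<beta> where "\<alpha> = Max (supp f)" and "\<beta> = Max (supp g)"
  have "\<alpha> \<in> supp f" "\<beta> \<in> supp g" unfolding \<alpha>_def \<beta>_def using fin ne by auto
  then obtain m1 m2 where m: "cf f \<alpha> m1 \<noteq> 0" "cf g \<beta> m2 \<noteq> 0" by (auto simp: supp_def)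
  have top: "cf f \<alpha> (x + \<beta>) * cf g \<beta> x = 0" for x
  proof -
    have "cf (f * g) (\<alpha> + \<beta>) x = (\<Sum>b\<in>supp g. if b = \<beta> then cf f \<alpha> (x + \<beta>) * cf g \<beta> x else 0)"
      unfolding cf_mult_supp[OF fin(2)]
    proof (intro sum.cong refl)
      fix b assume b: "b \<in> supp g"
      have "cf f (\<alpha> + \<beta> - b) (x + b) = 0" if "b \<noteq> \<beta>"
      proof -
        have "b < \<beta>" using that b fin unfolding \<beta>_def by (simp add: less_le)
        then have "\<alpha> < \<alpha> + \<beta> - b" by (simp add: less_diff_eq)
        then have "\<alpha> + \<beta> - b \<notin> supp f" using fin unfolding \<alpha>_def by (meson Max_ge leD)
        then show ?thesis by (simp add: supp_def)
      qed
      then show "cf f (\<alpha> + \<beta> - b) (x + b) * cf g b x = (if b = \<beta> then cf f \<alpha> (x + \<beta>) * cf g \<beta> x else 0)"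
        by auto
    qed
    also have "\<dots> = cf f \<alpha> (x + \<beta>) * cf g \<beta> x" using \<open>\<beta> \<in> supp g\<close> fin by simp
    finally show ?thesis using fg by simp
  qed
  \<comment> \<open>The line passes through \<open>m2\<close> at t = 0, where the coefficient of
    \<open>g\<close> is nonzero, and through \<open>m1 - \<beta>\<close> at t = 1, where the shifted
    coefficient of \<open>f\<close> is.\<close>
  define \<gamma> where "\<gamma> t = m2 + frag_cmul (int t) (m1 - \<beta> - m2)" for t
  have \<gamma>: "polycurve \<gamma>" "polycurve (\<lambda>t. \<gamma> t + \<beta>)"
    unfolding \<gamma>_def by (intro polycurve_line polycurve_add)+
  obtain p q where pq: "\<And>t. cf f \<alpha> (\<gamma> t + \<beta>) = poly p (of_nat t)" "\<And>t. cf g \<beta> (\<gamma> t) = poly q (of_nat t)"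
    using f(1) g(1) \<gamma> unfolding regular_def by meson
  have "\<gamma> 0 = m2" "\<gamma> 1 + \<beta> = m1" by (simp_all add: \<gamma>_def)
  then have "poly q 0 \<noteq> 0" "poly p 1 \<noteq> 0" using m pq(1)[of 1] pq(2)[of 0] by auto
  then have "p * q \<noteq> 0" by auto
  moreover have "p * q = 0"
  proof (rule poly_of_nat_zero)
    show "poly (p * q) (of_nat t) = 0" for t
      using top[of "\<gamma> t"] unfolding pq by simp
  qed
  ultimately show False by simp
qed

section \<open>The Weyl algebra as an algebra of operators\<close>

definition lop_alg :: "(complex, lop) module" where
  "lop_alg = \<lparr>carrier = UNIV, monoid.mult = (*), one = 1, zero = 0, add = (+), module.smult = scl\<rparr>"

text \<open>A copy of \<open>weyl_alg r\<close> acting on all variables. It is produced by the same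
  closure \<open>subalg_gen\<close>, so that inductions on the two sides correspond.\<close>

definition weyl_ops :: "nat \<Rightarrow> lop set" where
  "weyl_ops r = subalg_gen lop_alg
     (\<Union>i<r. {mulop (single i 1), mulop (single i (- 1)), pder i})"

lemma weyl_ops_closed:
  "1 \<in> weyl_ops r"
  "f \<in> weyl_ops r \<Longrightarrow> g \<in> weyl_ops r \<Longrightarrow> f + g \<in> weyl_ops r"
  "f \<in> weyl_ops r \<Longrightarrow> g \<in> weyl_ops r \<Longrightarrow> f * g \<in> weyl_ops r"
  "f \<in> weyl_ops r \<Longrightarrow> scl c f \<in> weyl_ops r"
  "i < r \<Longrightarrow> mulop (single i 1) \<in> weyl_ops r"
  "i < r \<Longrightarrow> mulop (single i (- 1)) \<in> weyl_ops r"
  "i < r \<Longrightarrow> pder i \<in> weyl_ops r"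
  using subalg_gen.one[of lop_alg] subalg_gen.add[of _ lop_alg _ _] subalg_gen.mult[of _ lop_alg]
    subalg_gen.scale[of _ lop_alg]
  unfolding weyl_ops_def by (auto simp: lop_alg_def intro!: subalg_gen.gen)

lemma scl_minus_one: "scl (- 1) f = - f"
  using lop.scale_minus_left[of 1 f] by simp

lemma weyl_ops_zero: "0 \<in> weyl_ops r"
  using weyl_ops_closed(4)[OF weyl_ops_closed(1), of 0] by simp

lemma weyl_ops_uminus: "f \<in> weyl_ops r \<Longrightarrow> - f \<in> weyl_ops r"
  using weyl_ops_closed(4)[of f r "- 1"] by (simp add: scl_minus_one)

lemma weyl_ops_minus: "f \<in> weyl_ops r \<Longrightarrow> g \<in> weyl_ops r \<Longrightarrow> f - g \<in> weyl_ops r"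
  using weyl_ops_closed(2)[of f r "- g"] weyl_ops_uminus by simp

lemma weyl_ops_sum: "(\<And>i. i \<in> A \<Longrightarrow> f i \<in> weyl_ops r) \<Longrightarrow> sum f A \<in> weyl_ops r"
  by (induction A rule: infinite_finite_induct) (auto simp: weyl_ops_zero weyl_ops_closed)

lemma weyl_ops_induct [consumes 1, case_names var inv pder one add mult scale]:
  assumes "f \<in> weyl_ops r"
    and "\<And>i. i < r \<Longrightarrow> P (mulop (single i 1))"
    and "\<And>i. i < r \<Longrightarrow> P (mulop (single i (- 1)))"
    and "\<And>i. i < r \<Longrightarrow> P (pder i)"
    and "P 1"
    and "\<And>f g. f \<in> weyl_ops r \<Longrightarrow> g \<in> weyl_ops r \<Longrightarrow> P f \<Longrightarrow> P g \<Longrightarrow> P (f + g)"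
    and "\<And>f g. f \<in> weyl_ops r \<Longrightarrow> g \<in> weyl_ops r \<Longrightarrow> P f \<Longrightarrow> P g \<Longrightarrow> P (f * g)"
    and "\<And>c f. f \<in> weyl_ops r \<Longrightarrow> P f \<Longrightarrow> P (scl c f)"
  shows "P f"
  using assms(1) unfolding weyl_ops_def
proof (induction rule: subalg_gen.induct)
  case (gen x)
  then show ?case using assms(2-4) by auto
qed (use assms(5-8) in \<open>auto simp: lop_alg_def weyl_ops_def\<close>)

lemma regular_weyl_ops: "f \<in> weyl_ops r \<Longrightarrow> regular f"
  by (induction rule: weyl_ops_induct)
    (auto intro: regular_mulop regular_pder regular_one regular_add regular_mult regular_scl)

lemma laurent_polys_closed:
  "p \<in> laurent_polys r \<Longrightarrow> q \<in> laurent_polys r \<Longrightarrow> p + q \<in> laurent_polys r"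
  "p \<in> laurent_polys r \<Longrightarrow> q \<in> laurent_polys r \<Longrightarrow> p * q \<in> laurent_polys r"
proof -
  show "p + q \<in> laurent_polys r" if "p \<in> laurent_polys r" "q \<in> laurent_polys r"
    using that Poly_Mapping.keys_add[of p q] unfolding laurent_polys_def by blast
  show "p * q \<in> laurent_polys r" if "p \<in> laurent_polys r" "q \<in> laurent_polys r"
  proof -
    have "keys m \<subseteq> {..<r}" if m: "m \<in> keys (p * q)" for m
    proof -
      obtain a b where "m = a + b" "a \<in> keys p" "b \<in> keys q" using m keys_mult[of p q] by blast
      then show ?thesis
        using \<open>p \<in> _\<close> \<open>q \<in> _\<close> Poly_Mapping.keys_add[of a b] unfolding laurent_polys_def by blast
    qed
    then show ?thesis by (simp add: laurent_polys_def)
  qed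
qed

lemma single_in_laurent_polys: "keys m \<subseteq> {..<r} \<Longrightarrow> single m c \<in> laurent_polys r"
  by (simp add: laurent_polys_def)

lemma zero_in_laurent_polys: "0 \<in> laurent_polys r"
  by (simp add: laurent_polys_def)

lemma sum_in_laurent_polys: "(\<And>i. i \<in> A \<Longrightarrow> f i \<in> laurent_polys r) \<Longrightarrow> sum f A \<in> laurent_polys r"
  by (induction A rule: infinite_finite_induct) (auto simp: zero_in_laurent_polys laurent_polys_closed)

lemma keys_single_subset: "i < r \<Longrightarrow> keys (single i (k :: int)) \<subseteq> {..<r}"
  by auto

lemma app_weyl_ops:
  assumes "f \<in> weyl_ops r" "p \<in> laurent_polys r"
  shows "app f p \<in> laurent_polys r"
  using assms
proof (induction arbitrary: p rule: weyl_ops_induct)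
  case (pder i)
  show ?case
    unfolding pder.rep_eq
  proof (intro sum_in_laurent_polys single_in_laurent_polys)
    fix m assume "m \<in> keys p"
    then have "keys m \<subseteq> {..<r}" using pder by (auto simp: laurent_polys_def)
    moreover have "keys (m - single i 1) \<subseteq> keys m \<union> keys (single i (1 :: int))"
      by (rule keys_diff)
    ultimately show "keys (m - single i 1) \<subseteq> {..<r}"
      using keys_single_subset[OF pder(1), of 1] by blast
  qed
next
  case (var i)
  then show ?case
    unfolding app_mulop
    by (intro laurent_polys_closed(2) single_in_laurent_polys keys_single_subset)
next
  case (inv i)
  then show ?case
    unfolding app_mulop
    by (intro laurent_polys_closed(2) single_in_laurent_polys keys_single_subset)
next
  case (scale c f)
  then show ?case
    unfolding app_scl by (intro laurent_polys_closed(2) single_in_laurent_polys) simp_all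
qed (simp_all add: laurent_polys_closed)

text \<open>A generator with index below \<open>r\<close> does not see the other variables, so
  monomials in those behave as scalars.\<close>

lemma weyl_ops_commute_mulop:
  assumes "f \<in> weyl_ops r" "keys m \<inter> {..<r} = {}"
  shows "f * mulop m = mulop m * f"
  using assms(1)
proof (induction rule: weyl_ops_induct)
  case (pder i)
  then have "i \<notin> keys m" using assms(2) by auto
  then have "lookup m i = 0" by (simp add: in_keys_iff)
  then show ?case by (simp add: pder_mulop)
next
  case (mult f g)
  then show ?case by (metis mult.assoc)
qed (auto simp: mulop_commute algebra_simps scl_mult_left scl_mult_right)

definition restr :: "nat \<Rightarrow> lop \<Rightarrow> laurent \<Rightarrow> laurent" where
  "restr r f = restrict (app f) (laurent_polys r)"

text \<open>Every monomial splits into a part in the first \<open>r\<close> variables and a foreign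
  factor. The operators commute with the foreign factor, so their values on the first
  \<open>r\<close> variables determine them.\<close>

lemma restr_inj:
  assumes f: "f \<in> weyl_ops r" and g: "g \<in> weyl_ops r" and eq: "restr r f = restr r g"
  shows "f = g"
proof (rule lop_eqI)
  have low: "app f p = app g p" if "p \<in> laurent_polys r" for p
    using that fun_cong[OF eq, of p] by (simp add: restr_def)
  have mon: "app f (lmon m) = app g (lmon m)" for m
  proof -
    define a where "a = (\<Sum>i\<in>keys m \<inter> {..<r}. single i (lookup m i))"
    have la: "lookup a i = (if i < r then lookup m i else 0)" for i
      by (auto simp: a_def lookup_sum lookup_single when_def sum.delta in_keys_iff)
    have ka: "keys a \<subseteq> {..<r}" by (auto simp: in_keys_iff la split: if_splits)
    have kb: "keys (m - a) \<inter> {..<r} = {}" by (auto simp: in_keys_iff la lookup_minus)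
    have m: "lmon m = app (mulop (m - a)) (lmon a)" by (simp add: app_mulop mult_single)
    have "app f (lmon m) = app (mulop (m - a)) (app f (lmon a))"
      unfolding m by (metis app_times weyl_ops_commute_mulop[OF f kb])
    also have "\<dots> = app (mulop (m - a)) (app g (lmon a))"
      using low[OF single_in_laurent_polys[OF ka]] by simp
    also have "\<dots> = app g (lmon m)"
      unfolding m by (metis app_times weyl_ops_commute_mulop[OF g kb])
    finally show ?thesis .
  qed
  show "app f p = app g p" for p
    by (subst (1 2) app_expand) (simp add: mon)
qed

lemma restr_mulop: "restr r (mulop (single i k)) = var_power_op r i k"
  by (simp add: restr_def var_power_op_def app_mulop fun_eq_iff)

lemma restr_pder: "restr r (pder i) = partial_op r i"
  by (simp add: restr_def partial_op_def pder.rep_eq fun_eq_iff)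

lemma restr_hom:
  "restr r 1 = \<one>\<^bsub>laurent_end r\<^esub>"
  "restr r (f + g) = restr r f \<oplus>\<^bsub>laurent_end r\<^esub> restr r g"
  "g \<in> weyl_ops r \<Longrightarrow> restr r (f * g) = restr r f \<otimes>\<^bsub>laurent_end r\<^esub> restr r g"
  "restr r (scl c f) = c \<odot>\<^bsub>laurent_end r\<^esub> restr r f"
  by (auto simp: restr_def laurent_end_def fun_eq_iff restrict_def app_weyl_ops)

lemma carrier_weyl_alg: "carrier (weyl_alg r) = restr r ` weyl_ops r"
proof -
  let ?G = "\<Union>i<r. {var_power_op r i 1, var_power_op r i (- 1), partial_op r i}"
  have 1: "x \<in> restr r ` weyl_ops r" if "x \<in> subalg_gen (laurent_end r) ?G" for x
    using that
  proof (induction rule: subalg_gen.induct)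
    case (gen x)
    then show ?case
      by (auto simp flip: restr_mulop restr_pder intro: weyl_ops_closed)
  next
    case one
    then show ?case using restr_hom(1) weyl_ops_closed(1) by (metis image_eqI)
  next
    case (add x y)
    then show ?case by (auto simp flip: restr_hom(2) intro!: imageI weyl_ops_closed)
  next
    case (mult x y)
    then show ?case by (auto simp flip: restr_hom(3) intro!: imageI weyl_ops_closed)
  next
    case (scale x c)
    then show ?case by (auto simp flip: restr_hom(4) intro!: imageI weyl_ops_closed)
  qed
  have 2: "restr r f \<in> subalg_gen (laurent_end r) ?G" if "f \<in> weyl_ops r" for f
    using that
  proof (induction rule: weyl_ops_induct)
    case (var i)
    then show ?case unfolding restr_mulop by (intro subalg_gen.gen) auto
  next
    case (inv i)
    then show ?case unfolding restr_mulop by (intro subalg_gen.gen) auto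
  next
    case (pder i)
    then show ?case unfolding restr_pder by (intro subalg_gen.gen) auto
  qed (auto simp: restr_hom intro: subalg_gen.one subalg_gen.add subalg_gen.mult subalg_gen.scale)
  show ?thesis unfolding weyl_alg_def using 1 2 by auto
qed

definition weyl_op_alg :: "nat \<Rightarrow> (complex, lop) module" where
  "weyl_op_alg r = lop_alg \<lparr>carrier := weyl_ops r\<rparr>"

lemma ring_weyl_op_alg: "ring (weyl_op_alg r)"
  by (rule ringI; (rule abelian_groupI | unfold_locales)?)
    (auto simp: weyl_op_alg_def lop_alg_def algebra_simps weyl_ops_closed weyl_ops_zero
      intro!: bexI[of _ "- _"] weyl_ops_uminus)

lemma weyl_alg_simps:
  "monoid.mult (weyl_alg r) = monoid.mult (laurent_end r)"
  "one (weyl_alg r) = one (laurent_end r)"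
  "ring.add (weyl_alg r) = ring.add (laurent_end r)"
  "ring.zero (weyl_alg r) = ring.zero (laurent_end r)"
  "module.smult (weyl_alg r) = module.smult (laurent_end r)"
  by (simp_all add: weyl_alg_def)

lemma restr_ring_iso: "restr r \<in> ring_iso (weyl_op_alg r) (weyl_alg r)"
  by (rule ring_iso_memI)
    (auto simp: carrier_weyl_alg weyl_op_alg_def lop_alg_def bij_betw_def inj_on_def restr_inj restr_hom weyl_alg_simps)

lemma restr_zero: "restr r 0 = \<zero>\<^bsub>weyl_alg r\<^esub>"
  by (simp add: restr_def weyl_alg_def laurent_end_def fun_eq_iff)

text \<open>The ring laws are transported from \<open>lop\<close>, where they hold by the type
  class, along the isomorphism \<open>restr\<close>.\<close>

lemma ring_weyl_alg: "ring (weyl_alg r)"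
proof -
  have "ring ((weyl_alg r) \<lparr>zero := restr r \<zero>\<^bsub>weyl_op_alg r\<^esub>\<rparr>)"
    by (rule ring.ring_iso_imp_img_ring[OF ring_weyl_op_alg restr_ring_iso])
  moreover have "restr r \<one>\<^bsub>weyl_op_alg r\<^esub> = \<one>\<^bsub>weyl_alg r\<^esub>" "restr r \<zero>\<^bsub>weyl_op_alg r\<^esub> = \<zero>\<^bsub>weyl_alg r\<^esub>"
    using restr_hom(1) restr_zero by (simp_all add: weyl_op_alg_def lop_alg_def weyl_alg_def)
  ultimately show ?thesis by simp
qed

section \<open>One induction step for the operators of the Lie algebra, in an abstract ring\<close>

locale gl_step =
  fixes k :: nat and x d :: "nat \<Rightarrow> 'a :: ring_1" and y :: 'a and F :: "nat \<Rightarrow> nat \<Rightarrow> 'a" and f :: "nat \<Rightarrow> 'a"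
  assumes xx: "x i * x j = x j * x i"
    and dd: "d i * d j = d j * d i"
    and dx: "i \<le> k \<Longrightarrow> j \<le> k \<Longrightarrow> d i * x j = x j * d i + (if i = j then 1 else 0)"
    and yx: "y * x i = x i * y"
    and xky: "x k * y = 1"
    and dy: "i \<le> k \<Longrightarrow> d i * y = y * d i - (if i = k then y * y else 0)"
    and Fx: "i < k \<Longrightarrow> j < k \<Longrightarrow> l \<le> k \<Longrightarrow> F i j * x l = x l * F i j"
    and Fy: "i < k \<Longrightarrow> j < k \<Longrightarrow> F i j * y = y * F i j"
    and Fd: "i < k \<Longrightarrow> j < k \<Longrightarrow> l \<le> k \<Longrightarrow> F i j * d l = d l * F i j"
    and fx: "i < k \<Longrightarrow> l \<le> k \<Longrightarrow> f i * x l = x l * f i"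
    and fy: "i < k \<Longrightarrow> f i * y = y * f i"
    and fd: "i < k \<Longrightarrow> l \<le> k \<Longrightarrow> f i * d l = d l * f i"
    and ff: "f i * f j = f j * f i"
    and Ff: "i < k \<Longrightarrow> j < k \<Longrightarrow> l < k \<Longrightarrow> F i j * f l = f l * F i j + (if j = l then f i else 0)"
    and FF: "i < k \<Longrightarrow> j < k \<Longrightarrow> l < k \<Longrightarrow> m < k \<Longrightarrow>
      F i j * F l m = F l m * F i j + (if j = l then F i m else 0) - (if m = i then F l j else 0)"
begin

definition G where "G i = (\<Sum>l<k. x l * F i l)"
text \<open>The product \<open>y * H i\<close> is the correction to x_i d_k in the last column. This
  combination commutes with all x_l and with d_k, while its commutator with d_l for l < k is
  \<open>F i l\<close>.\<close>

definition H where "H i = f i - G i"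

lemma left: "a * b = c \<Longrightarrow> a * (b * z) = c * (z :: 'a)"
  by (simp flip: mult.assoc)

lemma xx_left: "x i * (x j * z) = x j * (x i * z)"
  by (metis mult.assoc xx)

lemma dd_left: "d i * (d j * z) = d j * (d i * z)"
  by (metis mult.assoc dd)

lemma Gx: "i < k \<Longrightarrow> l \<le> k \<Longrightarrow> G i * x l = x l * G i"
  unfolding G_def sum_distrib_left sum_distrib_right
  by (rule sum.cong) (auto simp: mult.assoc Fx xx_left)

lemma Gy: "i < k \<Longrightarrow> G i * y = y * G i"
  unfolding G_def sum_distrib_left sum_distrib_right
  by (rule sum.cong) (auto simp: mult.assoc Fy left[OF yx])

lemma Gd:
  assumes i: "i < k" and l: "l \<le> k"
  shows "G i * d l = d l * G i - (if l < k then F i l else 0)"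
proof -
  have "d l * G i = (\<Sum>m<k. x m * F i m * d l + (if m = l then F i l else 0))"
    unfolding G_def sum_distrib_left
    by (rule sum.cong) (use i l in \<open>auto simp: mult.assoc Fd left[OF dx] distrib_right\<close>)
  also have "\<dots> = G i * d l + (if l < k then F i l else 0)"
    by (simp add: G_def sum_distrib_right sum.distrib sum.delta)
  finally show ?thesis by simp
qed

lemma Hx: "i < k \<Longrightarrow> l \<le> k \<Longrightarrow> H i * x l = x l * H i"
  by (simp add: H_def algebra_simps Gx fx)

lemma Hy: "i < k \<Longrightarrow> H i * y = y * H i"
  by (simp add: H_def algebra_simps Gy fy)

lemma Hd: "i < k \<Longrightarrow> l \<le> k \<Longrightarrow> H i * d l = d l * H i + (if l < k then F i l else 0)"
  by (simp add: H_def algebra_simps Gd fd)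

lemma FG:
  assumes "i < k" "j < k" "l < k"
  shows "F i j * G l = G l * F i j + (if j = l then G i else 0) - x i * F l j"
proof -
  have "F i j * G l = (\<Sum>m<k. x m * F l m * F i j + (if j = l then x m * F i m else 0) - (if m = i then x i * F l j else 0))"
    unfolding G_def sum_distrib_left
  proof (rule sum.cong)
    fix m assume "m \<in> {..<k}"
    then have m: "m < k" by simp
    have "F i j * (x m * F l m) = x m * (F i j * F l m)"
      using assms m by (simp add: left[OF Fx] mult.assoc)
    also have "\<dots> = x m * F l m * F i j + (if j = l then x m * F i m else 0) - (if m = i then x i * F l j else 0)"
      unfolding FF[OF assms m] by (simp add: distrib_left right_diff_distrib mult.assoc)
    finally show "F i j * (x m * F l m) =
      x m * F l m * F i j + (if j = l then x m * F i m else 0) - (if m = i then x i * F l j else 0)" .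
  qed simp
  also have "\<dots> = G l * F i j + (if j = l then G i else 0) - x i * F l j"
    using assms by (simp add: G_def sum_distrib_right sum.distrib sum_subtractf sum.delta)
  finally show ?thesis .
qed

lemma FH:
  "i < k \<Longrightarrow> j < k \<Longrightarrow> l < k \<Longrightarrow> F i j * H l = H l * F i j + (if j = l then H i else 0) + x i * F l j"
  by (simp add: H_def algebra_simps FG Ff)

text \<open>The failure of the \<open>H i\<close> to commute is forced: since d_k y = y d_k - y^2,
  commuting x_i d_k with \<open>y * H l\<close> leaves terms in y^2, and the commutator found here
  is exactly what cancels them.\<close>

lemma HH:
  assumes i: "i < k" and l: "l < k"
  shows "H i * H l = H l * H i + x i * H l - x l * H i"
proof -
  have "f i * G l = (\<Sum>m<k. x m * F l m * f i - (if m = i then x i * f l else 0))"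
    unfolding G_def sum_distrib_left
    by (rule sum.cong) (use i l in \<open>auto simp: left[OF fx] Ff mult.assoc algebra_simps\<close>)
  also have "\<dots> = G l * f i - x i * f l"
    using i by (simp add: G_def sum_distrib_right sum_subtractf sum.delta)
  finally have 1: "f i * H l = H l * f i + x i * f l"
    by (simp add: H_def algebra_simps ff)
  have "G i * H l = (\<Sum>m<k. H l * (x m * F i m) + (if m = l then x l * H i else 0) + x i * (x m * F l m))"
    unfolding G_def sum_distrib_right
    by (rule sum.cong) (use i l in \<open>auto simp: left[OF Hx] FH mult.assoc algebra_simps xx_left\<close>)
  also have "\<dots> = H l * G i + x l * H i + x i * G l"
    using l by (simp add: G_def sum_distrib_left sum.distrib sum.delta)
  finally have 2: "G i * H l = H l * G i + x l * H i + x i * G l" .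
  have "H i * H l = f i * H l - G i * H l" by (simp add: H_def left_diff_distrib)
  also have "\<dots> = H l * H i + x i * H l - x l * H i"
    unfolding 1 2 by (simp add: H_def algebra_simps)
  finally show ?thesis .
qed

definition e where
  "e i j = (if i = k then x k * d j else if j = k then x i * d k + y * H i else x i * d j + F i j)"

lemmas comm_rules = dx dy Fx Fy Fd Hx Hy Hd FH yx xky
lemmas comm_left = comm_rules[THEN left]

lemma e_x:
  assumes "i \<le> k" "j \<le> k" "l \<le> k"
  shows "e i j * x l - x l * e i j = (if j = l then x i else 0)"
proof -
  consider "l = k" | "l \<noteq> k" by blast
  then show ?thesis
    by cases (use assms in \<open>simp_all add: e_def algebra_simps comm_rules comm_left xx_left\<close>)
qed

text \<open>An entry lies in the last row, in the inner block or in the last column, and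
  antisymmetry reduces the nine pairs to six. Each is decided by moving the factors into a fixed
  order with \<open>comm_rules\<close>.\<close>

lemma e_e:
  assumes "i \<le> k" "j \<le> k" "l \<le> k" "m \<le> k"
  shows "e i j * e l m - e l m * e i j = (if j = l then e i m else 0) - (if m = i then e l j else 0)"
proof -
  note S = e_def algebra_simps comm_rules comm_left xx xx_left dd dd_left
  have AA: "e k j * e k m - e k m * e k j = (if j = k then e k m else 0) - (if m = k then e k j else 0)"
    if "j \<le> k" "m \<le> k" for j m
    using that by (simp add: S)
  have AB: "e k j * e l m - e l m * e k j = (if j = l then e k m else 0)"
    if "j \<le> k" "l < k" "m < k" for j l m
    using that by (simp add: S)
  have AC: "e k j * e l k - e l k * e k j = (if j = l then e k k else 0) - e l j"
    if "j \<le> k" "l < k" for j l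
    using that by (simp add: S)
  have BB: "e i j * e l m - e l m * e i j = (if j = l then e i m else 0) - (if m = i then e l j else 0)"
    if "i < k" "j < k" "l < k" "m < k" for i j l m
  proof -
    \<comment> \<open>The products of two \<open>F\<close> are split off, because \<open>FF\<close>
      as a rewrite rule would exchange the factors back and forth; the relation is applied once,
      separately.\<close>
    have "e i j * e l m - e l m * e i j - (F i j * F l m - F l m * F i j) =
        (if j = l then x i * d m else 0) - (if m = i then x l * d j else 0)"
      using that by (simp add: S)
    moreover have "F i j * F l m - F l m * F i j = (if j = l then F i m else 0) - (if m = i then F l j else 0)"
      using FF[OF that] by simp
    ultimately have "e i j * e l m - e l m * e i j =
        (if j = l then x i * d m else 0) - (if m = i then x l * d j else 0) +
        ((if j = l then F i m else 0) - (if m = i then F l j else 0))"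
      by (simp only: diff_eq_eq)
    then show ?thesis using that by (simp add: e_def)
  qed
  have BC: "e i j * e l k - e l k * e i j = (if j = l then e i k else 0)"
    if "i < k" "j < k" "l < k" for i j l
    using that by (simp add: S)
  have CC: "e i k * e l k - e l k * e i k = 0"
    if "i < k" "l < k" for i l
  proof -
    \<comment> \<open>The relation \<open>HH\<close> is likewise applied once by hand, already
      multiplied by y^2, the factor with which products of two \<open>H\<close> occur in the
      commutator.\<close>
    have "y * (y * (H i * H l)) = y * (y * (H l * H i)) + x i * (y * (y * H l)) - x l * (y * (y * H i))"
      unfolding HH[OF that] by (simp add: distrib_left right_diff_distrib left[OF yx] mult.assoc)
    moreover have "e i k * e l k - e l k * e i k =
        y * (y * (H i * H l)) - y * (y * (H l * H i)) - x i * (y * (y * H l)) + x l * (y * (y * H i))"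
      using that by (simp add: S)
    ultimately show ?thesis by simp
  qed
  have anti: "a * b - b * a = c \<Longrightarrow> b * a - a * b = - c" for a b c :: 'a
    by (simp add: algebra_simps)
  \<comment> \<open>The first alternative has precedence, as in \<open>e\<close>: the corner entry
    counts as part of the last row.\<close>
  have kind: "a = k \<or> a < k \<and> b < k \<or> a < k \<and> b = k" if "a \<le> k" "b \<le> k" for a b
    using that by auto
  show ?thesis
    using kind[OF assms(1,2)]
  proof (elim disjE conjE)
    assume i: "i = k"
    show ?thesis
      using kind[OF assms(3,4)]
    proof (elim disjE conjE)
      assume "l = k" then show ?thesis using i AA assms by simp
    next
      assume "l < k" "m < k" then show ?thesis using i AB[of j l m] assms by auto
    next
      assume "l < k" "m = k" then show ?thesis using i AC[of j l] assms by auto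
    qed
  next
    assume i: "i < k" "j < k"
    show ?thesis
      using kind[OF assms(3,4)]
    proof (elim disjE conjE)
      assume "l = k" then show ?thesis using i anti[OF AB[of m i j]] assms by auto
    next
      assume "l < k" "m < k" then show ?thesis using i BB by simp
    next
      assume "l < k" "m = k" then show ?thesis using i BC[of i j l] by auto
    qed
  next
    assume i: "i < k" "j = k"
    show ?thesis
      using kind[OF assms(3,4)]
    proof (elim disjE conjE)
      assume "l = k" then show ?thesis using i anti[OF AC[of m i]] assms by auto
    next
      assume "l < k" "m < k" then show ?thesis using i anti[OF BC[of l m i]] by auto
    next
      assume "l < k" "m = k" then show ?thesis using i CC[of i l] by auto
    qed
  qed
qed

end

section \<open>The iterated differential operators\<close>

lemma weyl_ops_mono: "r \<le> r' \<Longrightarrow> weyl_ops r \<subseteq> weyl_ops r'"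
proof
  fix f assume "r \<le> r'" "f \<in> weyl_ops r"
  from this(2,1) show "f \<in> weyl_ops r'"
    by (induction rule: weyl_ops_induct) (auto intro: weyl_ops_closed)
qed

lemma weyl_ops_commute_single:
  assumes "f \<in> weyl_ops r" "r \<le> v"
  shows "f * mulop (single v k) = mulop (single v k) * f"
  by (rule weyl_ops_commute_mulop[OF assms(1)]) (use assms(2) in auto)

lemma weyl_ops_commute_pder:
  assumes "f \<in> weyl_ops r" "r \<le> v"
  shows "f * pder v = pder v * f"
  using assms(1)
proof (induction rule: weyl_ops_induct)
  case (mult f g)
  then show ?case by (metis mult.assoc)
qed (use assms(2) in \<open>auto simp: pder_mulop pder_commute algebra_simps scl_mult_left scl_mult_right lookup_single\<close>)

abbreviation X :: "nat \<Rightarrow> lop" where "X v \<equiv> mulop (single v 1)"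
abbreviation Xinv :: "nat \<Rightarrow> lop" where "Xinv v \<equiv> mulop (single v (- 1))"

definition tri :: "nat \<Rightarrow> nat" where "tri n = n * (n + 1) div 2"

lemma tri_0 [simp]: "tri 0 = 0" by (simp add: tri_def)

lemma tri_Suc [simp]: "tri (Suc n) = tri n + Suc n"
proof -
  have "Suc n * (Suc n + 1) = n * (n + 1) + Suc n * 2" by (simp add: algebra_simps)
  then show ?thesis
    unfolding tri_def using div_mult_self1[of 2 "n * (n + 1)" "Suc n"] by (simp only:)
qed

lemma tri_mono: "m \<le> n \<Longrightarrow> tri m \<le> tri n"
  by (rule lift_Suc_mono_le[of tri]) auto

text \<open>
  Level \<open>k \<ge> 1\<close> of the recursion uses \<open>k\<close> variables, numbered after those of the lower levels.
\<close>

definition vidx :: "nat \<Rightarrow> nat \<Rightarrow> nat" where "vidx k i = tri (k - 1) + i"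

lemma vidx_less_tri: "i < k \<Longrightarrow> vidx k i < tri k"
  by (cases k) (simp_all add: vidx_def)

lemma vidx_ge_tri: "tri n \<le> vidx (Suc n) i"
  by (simp add: vidx_def)

lemma vidx_eq_iff: "vidx k i = vidx k j \<longleftrightarrow> i = j"
  by (simp add: vidx_def)

text \<open>Indices start at 0, so the distinguished index of level \<open>Suc k\<close> is
  \<open>k\<close>. The vectors of level \<open>k\<close> act as multiplication by its own
  variables, which is why \<open>X (vidx k i)\<close> stands for E_i in the last column.\<close>

fun E :: "nat \<Rightarrow> nat \<Rightarrow> nat \<Rightarrow> lop" where
  "E 0 i j = 0"
| "E (Suc k) i j =
    (if i = k then X (vidx (Suc k) k) * pder (vidx (Suc k) j)
     else if j = k then X (vidx (Suc k) i) * pder (vidx (Suc k) k) +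
       Xinv (vidx (Suc k) k) * (X (vidx k i) - (\<Sum>l<k. X (vidx (Suc k) l) * E k i l))
     else X (vidx (Suc k) i) * pder (vidx (Suc k) j) + E k i j)"

lemma X_weyl: "i < k \<Longrightarrow> k \<le> n \<Longrightarrow> X (vidx k i) \<in> weyl_ops (tri n)"
  using vidx_less_tri[of i k] tri_mono[of k n] by (intro weyl_ops_closed) simp

lemma Xinv_weyl: "i < k \<Longrightarrow> k \<le> n \<Longrightarrow> Xinv (vidx k i) \<in> weyl_ops (tri n)"
  using vidx_less_tri[of i k] tri_mono[of k n] by (intro weyl_ops_closed) simp

lemma pder_weyl: "i < k \<Longrightarrow> k \<le> n \<Longrightarrow> pder (vidx k i) \<in> weyl_ops (tri n)"
  using vidx_less_tri[of i k] tri_mono[of k n] by (intro weyl_ops_closed) simp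

lemma E_weyl: "i < n \<Longrightarrow> j < n \<Longrightarrow> E n i j \<in> weyl_ops (tri n)"
proof (induction n arbitrary: i j)
  case (Suc n)
  have IH: "E n i j \<in> weyl_ops (tri (Suc n))" if "i < n" "j < n" for i j
    using Suc.IH[OF that] weyl_ops_mono[of "tri n" "tri (Suc n)"] by auto
  show ?case
    using Suc.prems
    by (auto simp del: tri_Suc
      intro!: weyl_ops_closed(2,3) weyl_ops_minus weyl_ops_sum X_weyl Xinv_weyl pder_weyl IH)
qed simp

lemma pder_X: "pder v * X w = X w * pder v + (if v = w then 1 else 0)"
  by (auto simp: pder_mulop lookup_single)

lemma pder_Xinv: "pder v * Xinv w = Xinv w * pder v - (if v = w then Xinv w * Xinv w else 0)"
proof -
  have "single w (- 1) - single w 1 =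
      single w (- 1) + single w (- 1 :: int)"
    by (simp flip: single_diff single_add)
  then have "mulop (single w (- 1) - single w 1) = Xinv w * Xinv w"
    by (simp only: mulop_mult)
  then show ?thesis by (auto simp: pder_mulop lookup_single scl_minus_one)
qed

lemma X_Xinv: "X v * Xinv v = 1"
  by (simp add: mulop_mult flip: single_add)

text \<open>The relations with the vectors are carried along because the next step needs them as the
  hypothesis \<open>Ff\<close>. The hypotheses that old and new operators commute hold because each
  level has its own variables.\<close>

lemma E_relations:
  "(\<forall>i<n. \<forall>j<n. \<forall>l<n. \<forall>m<n. E n i j * E n l m - E n l m * E n i j =
      (if j = l then E n i m else 0) - (if m = i then E n l j else 0)) \<and>
    (\<forall>i<n. \<forall>j<n. \<forall>l<n. E n i j * X (vidx n l) - X (vidx n l) * E n i j =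
      (if j = l then X (vidx n i) else 0))"
proof (induction n)
  case (Suc n)
  have ge: "tri n \<le> vidx (Suc n) i" for i by (rule vidx_ge_tri)
  have Xn: "X (vidx n i) \<in> weyl_ops (tri n)" if "i < n" for i using X_weyl[OF that order_refl] .
  have ne: "vidx (Suc n) l \<noteq> vidx n i" if "i < n" for i l
    using ge[of l] vidx_less_tri[OF that] by simp
  interpret gl_step n "\<lambda>i. X (vidx (Suc n) i)" "\<lambda>i. pder (vidx (Suc n) i)" "Xinv (vidx (Suc n) n)"
    "E n" "\<lambda>i. X (vidx n i)"
  proof
    show "E n i j * E n l m = E n l m * E n i j + (if j = l then E n i m else 0) - (if m = i then E n l j else 0)"
      if "i < n" "j < n" "l < n" "m < n" for i j l m
      using Suc.IH that by (simp add: diff_eq_eq algebra_simps)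
    show "E n i j * X (vidx n l) = X (vidx n l) * E n i j + (if j = l then X (vidx n i) else 0)"
      if "i < n" "j < n" "l < n" for i j l
      using Suc.IH that by (simp add: diff_eq_eq algebra_simps)
  qed (auto simp: pder_X pder_Xinv X_Xinv vidx_eq_iff ne pder_commute mulop_commute
      intro: weyl_ops_commute_single[OF E_weyl ge] weyl_ops_commute_pder[OF E_weyl ge]
        weyl_ops_commute_pder[OF Xn ge])
  have e: "E (Suc n) i j = e i j" for i j
    by (simp add: e_def H_def G_def)
  show ?case
    unfolding e using e_e e_x by (simp only: less_Suc_eq_le) blast
qed simp

text \<open>The recursion for \<^const>\<open>E\<close> can be solved for the generators of the previous level.\<close>

lemma weyl_ops_generated:
  assumes one: "1 \<in> Q"
    and add: "\<And>f g. f \<in> Q \<Longrightarrow> g \<in> Q \<Longrightarrow> f + g \<in> Q"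
    and mult: "\<And>f g. f \<in> Q \<Longrightarrow> g \<in> Q \<Longrightarrow> f * g \<in> Q"
    and scale: "\<And>c f. f \<in> Q \<Longrightarrow> scl c f \<in> Q"
    and inv: "\<And>v. v < tri n \<Longrightarrow> X v \<in> Q \<Longrightarrow> Xinv v \<in> Q"
    and X: "\<And>i. i < n \<Longrightarrow> X (vidx n i) \<in> Q"
    and E: "\<And>i j. i < n \<Longrightarrow> j < n \<Longrightarrow> E n i j \<in> Q"
  shows "weyl_ops (tri n) \<subseteq> Q"
proof -
  have uminus: "- f \<in> Q" if "f \<in> Q" for f
    using scale[OF that, of "- 1"] by (simp add: scl_minus_one)
  have minus: "f - g \<in> Q" if "f \<in> Q" "g \<in> Q" for f g
    using add[OF that(1) uminus[OF that(2)]] by simp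
  have zero: "0 \<in> Q" using scale[OF one, of 0] by simp
  have sum: "(\<Sum>i<m. f i) \<in> Q" if "\<And>i. i < m \<Longrightarrow> f i \<in> Q" for m :: nat and f
    using that by (induction m) (auto simp: zero add)
  have step: "X v \<in> Q \<and> pder v \<in> Q" if "v < tri m" "m \<le> n"
    "\<And>i. i < m \<Longrightarrow> X (vidx m i) \<in> Q" "\<And>i j. i < m \<Longrightarrow> j < m \<Longrightarrow> E m i j \<in> Q" for m v
    using that
  proof (induction m arbitrary: v)
    case (Suc m)
    let ?v = "vidx (Suc m)"
    have "?v m < tri (Suc m)" using vidx_less_tri[of m "Suc m"] by (simp del: tri_Suc)
    then have "?v m < tri n" using tri_mono[OF Suc.prems(2)] by (simp del: tri_Suc)
    then have y: "Xinv (?v m) \<in> Q" using inv Suc.prems(3) by simp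
    have yx: "Xinv (?v m) * X (?v m) = 1" using X_Xinv mulop_commute by metis
    \<comment> \<open>A level is solved in this order: dividing the last row by x_m gives the
      derivations, subtracting from the inner block gives \<open>E m\<close>, and the last column
      then yields the variables of the level below.\<close>
    have d: "pder (?v j) \<in> Q" if "j \<le> m" for j
    proof -
      have "Xinv (?v m) * E (Suc m) m j = pder (?v j)"
        by (simp add: yx flip: mult.assoc)
      then show ?thesis using mult[OF y Suc.prems(4)[of m j]] that by simp
    qed
    have Em: "E m i j \<in> Q" if "i < m" "j < m" for i j
    proof -
      have "E m i j = E (Suc m) i j - X (?v i) * pder (?v j)" using that by simp
      also have "\<dots> \<in> Q"
        by (intro minus mult Suc.prems(3,4) d) (use that in auto)
      finally show ?thesis .
    qed
    have Xm: "X (vidx m i) \<in> Q" if "i < m" for i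
    proof -
      have "X (vidx m i) = X (?v m) * (E (Suc m) i m - X (?v i) * pder (?v m)) + (\<Sum>l<m. X (?v l) * E m i l)"
        using that by (simp add: X_Xinv flip: mult.assoc)
      also have "\<dots> \<in> Q"
        by (intro add mult minus sum Suc.prems(3,4) d Em) (use that in auto)
      finally show ?thesis .
    qed
    show ?case
    proof (cases "v < tri m")
      case True
      then show ?thesis using Suc.IH Suc.prems(2) Xm Em by simp
    next
      case False
      then obtain i where "i \<le> m" "v = ?v i" using Suc.prems(1)
        by (auto simp: vidx_def intro: that[of "v - tri m"])
      then show ?thesis using Suc.prems(3) d by simp
    qed
  qed simp
  have XQ: "X v \<in> Q" "pder v \<in> Q" if "v < tri n" for v using step[OF that] X E by auto
  show ?thesis
  proof
    fix f assume "f \<in> weyl_ops (tri n)"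
    then show "f \<in> Q"
      by (induction rule: weyl_ops_induct) (auto simp: XQ inv one add mult scale)
  qed
qed

section \<open>Leading terms\<close>

locale leading =
  fixes r :: nat and d :: "nat \<Rightarrow> int" and t :: "nat \<Rightarrow> nat"
  assumes t_pos: "t v > 0"
begin

definition pt :: "nat \<Rightarrow> (nat \<Rightarrow>\<^sub>0 int) \<Rightarrow> (nat \<Rightarrow>\<^sub>0 int)" where
  "pt s m = (\<Sum>v<r. single v (int s ^ t v)) + m"

definition wt :: "(nat \<Rightarrow>\<^sub>0 int) \<Rightarrow> int" where
  "wt a = (\<Sum>v<r. d v * lookup a v)"

abbreviation scaled :: "lop \<Rightarrow> int \<Rightarrow> (nat \<Rightarrow>\<^sub>0 int) \<Rightarrow> (nat \<Rightarrow>\<^sub>0 int) \<Rightarrow> nat \<Rightarrow> complex" where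
  "scaled f w a m s \<equiv> cf f a (pt s m) * of_nat s powi (wt a - w)"

text \<open>
  Substituting \<open>s ^ t v\<close> for the eigenvalue of \<open>x\<^sub>v \<partial>\<^sub>v\<close> and letting \<open>s\<close> tend to infinity reads off
  the part of top weight, where \<open>x\<^sub>v\<close> has weight \<open>d v\<close> and \<open>x\<^sub>v \<partial>\<^sub>v\<close> has weight \<open>t v\<close>. The arbitrary
  base point \<open>m\<close> makes the notion multiplicative.
\<close>

definition symbol :: "lop \<Rightarrow> int \<Rightarrow> ((nat \<Rightarrow>\<^sub>0 int) \<Rightarrow> complex) \<Rightarrow> bool" where
  "symbol f w \<sigma> \<longleftrightarrow> (\<forall>a m. (\<lambda>s. scaled f w a m s) \<longlonglongrightarrow> \<sigma> a)"

text \<open>In top weight only one exponent remains, with coefficient 1. Being monic with a single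
  exponent is the property that survives multiplication without any cancellation.\<close>

definition lead :: "lop \<Rightarrow> int \<Rightarrow> (nat \<Rightarrow>\<^sub>0 int) \<Rightarrow> bool" where
  "lead f w \<alpha> \<longleftrightarrow> symbol f w (\<lambda>a. if a = \<alpha> then 1 else 0)"

lemma wt_add: "wt (a + b) = wt a + wt b"
  by (simp add: wt_def lookup_add distrib_left sum.distrib)

lemma wt_minus: "wt (a - b) = wt a - wt b"
  by (simp add: wt_def lookup_minus right_diff_distrib sum_subtractf)

lemma wt_zero [simp]: "wt 0 = 0"
  by (simp add: wt_def)

lemma wt_single: "v < r \<Longrightarrow> wt (single v k) = d v * k"
  by (simp add: wt_def lookup_single when_def if_distrib[of "(*) _"] sum.delta' cong: if_cong)

lemma pt_add: "pt s m + b = pt s (m + b)"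
  by (simp add: pt_def add.assoc)

lemma lookup_pt: "v < r \<Longrightarrow> lookup (pt s m) v = int s ^ t v + lookup m v"
  by (simp add: pt_def lookup_add lookup_sum lookup_single when_def sum.delta)

lemma symbol_add: "symbol f w \<sigma> \<Longrightarrow> symbol g w \<tau> \<Longrightarrow> symbol (f + g) w (\<lambda>a. \<sigma> a + \<tau> a)"
  unfolding symbol_def by (auto simp: cf_add distrib_right intro!: tendsto_add)

lemma symbol_scl: "symbol f w \<sigma> \<Longrightarrow> symbol (scl c f) w (\<lambda>a. c * \<sigma> a)"
  unfolding symbol_def by (auto simp: cf_scl mult.assoc intro!: tendsto_mult_left)

lemma symbol_zero: "symbol 0 w (\<lambda>_. 0)"
  unfolding symbol_def by simp

lemma symbol_sum:
  "(\<And>i. i \<in> A \<Longrightarrow> symbol (f i) w (\<sigma> i)) \<Longrightarrow> symbol (sum f A) w (\<lambda>a. \<Sum>i\<in>A. \<sigma> i a)"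
  by (induction A rule: infinite_finite_induct) (auto simp: symbol_zero intro: symbol_add)

text \<open>Measured against a larger weight, a convergent sequence acquires a negative power of
  \<open>s\<close> and tends to 0.\<close>

lemma symbol_raise:
  assumes "symbol f w \<sigma>" "w < w'"
  shows "symbol f w' (\<lambda>_. 0)"
  unfolding symbol_def
proof (intro allI)
  fix a m
  define k where "k = nat (w' - w)"
  have k: "w' = w + int k" "k > 0" using assms(2) by (auto simp: k_def)
  have "(\<lambda>s. scaled f w a m s * inverse (of_nat s ^ k)) \<longlonglongrightarrow> \<sigma> a * 0"
  proof (rule tendsto_mult)
    show "(\<lambda>s. scaled f w a m s) \<longlonglongrightarrow> \<sigma> a"
      using assms(1) by (simp add: symbol_def)
    have "(\<lambda>s. inverse (of_nat s) ^ k :: complex) \<longlonglongrightarrow> 0 ^ k"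
      by (intro tendsto_power lim_inverse_n)
    then show "(\<lambda>s. inverse (of_nat s ^ k) :: complex) \<longlonglongrightarrow> 0"
      using k(2) by (simp add: power_inverse zero_power)
  qed
  then have "(\<lambda>s. scaled f w a m s * inverse (of_nat s ^ k)) \<longlonglongrightarrow> 0" by simp
  then show "(\<lambda>s. scaled f w' a m s) \<longlonglongrightarrow> 0"
  proof (rule Lim_transform_eventually)
    show "\<forall>\<^sub>F s in sequentially. scaled f w a m s * inverse (of_nat s ^ k) =
        scaled f w' a m s"
      using eventually_gt_at_top[of 0]
    proof eventually_elim
      case (elim s)
      have "(of_nat s :: complex) powi (wt a - w') = of_nat s powi (wt a - w) / of_nat s powi (int k)"
        using power_int_diff[of "of_nat s :: complex" "wt a - w" "int k"] elim k
        by (simp add: diff_diff_add)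
      then show ?case by (simp add: field_simps)
    qed
  qed
qed

text \<open>In the convolution formula the limit keeps only the summand \<open>b = \<beta>\<close>.
  The finite support of the right factor permits taking the limit inside the sum.\<close>

lemma lead_mult:
  assumes f: "lead f w \<alpha>" and g: "lead g v \<beta>" "finite (supp g)"
  shows "lead (f * g) (w + v) (\<alpha> + \<beta>)"
  unfolding lead_def symbol_def
proof (intro allI)
  fix a m
  have F: "(\<lambda>s. scaled f w b m s) \<longlonglongrightarrow> (if b = \<alpha> then 1 else 0)" for b m
    using f unfolding lead_def symbol_def by blast
  have G: "(\<lambda>s. scaled g v b m s) \<longlonglongrightarrow> (if b = \<beta> then 1 else 0)" for b m
    using g unfolding lead_def symbol_def by blast
  have \<beta>: "\<beta> \<in> supp g"
  proof (rule ccontr)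
    assume "\<beta> \<notin> supp g"
    then have "(\<lambda>s. 0 :: complex) \<longlonglongrightarrow> 1" using G[of \<beta> 0] by (simp add: supp_def)
    then show False using LIMSEQ_unique[OF tendsto_const] by (metis zero_neq_one)
  qed
  have "(\<lambda>s. \<Sum>b\<in>supp g. (scaled f w (a - b) (m + b) s) *
      (scaled g v b m s)) \<longlonglongrightarrow>
      (\<Sum>b\<in>supp g. (if a - b = \<alpha> then 1 else 0) * (if b = \<beta> then 1 else 0))"
    by (intro tendsto_sum tendsto_mult F G)
  also have "(\<Sum>b\<in>supp g. (if a - b = \<alpha> then 1 else 0) * (if b = \<beta> then 1 else 0)) =
      (\<Sum>b\<in>supp g. if b = \<beta> then (if a - \<beta> = \<alpha> then 1 else 0) else 0 :: complex)"
    by (intro sum.cong) auto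
  also have "\<dots> = (if a = \<alpha> + \<beta> then 1 else 0)"
    using \<beta> g(2) by (auto simp: sum.delta algebra_simps)
  finally have lim: "(\<lambda>s. \<Sum>b\<in>supp g. (scaled f w (a - b) (m + b) s) *
      (scaled g v b m s)) \<longlonglongrightarrow> (if a = \<alpha> + \<beta> then 1 else 0)" .
  show "(\<lambda>s. scaled (f * g) (w + v) a m s) \<longlonglongrightarrow> (if a = \<alpha> + \<beta> then 1 else 0)"
  proof (rule Lim_transform_eventually[OF lim])
    show "\<forall>\<^sub>F s in sequentially. (\<Sum>b\<in>supp g. (scaled f w (a - b) (m + b) s) *
      (scaled g v b m s)) = scaled (f * g) (w + v) a m s"
      using eventually_gt_at_top[of 0]
    proof eventually_elim
      case (elim s)
      have "(of_nat s :: complex) powi (wt a - (w + v)) =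
          of_nat s powi (wt (a - b) - w) * of_nat s powi (wt b - v)" for b
        using elim by (simp add: wt_minus algebra_simps flip: power_int_add)
      then show ?case
        unfolding cf_mult_supp[OF g(2)] sum_distrib_right
        by (intro sum.cong) (simp_all add: pt_add mult_ac)
    qed
  qed
qed

lemma lead_mulop: "w = wt k \<Longrightarrow> lead (mulop k) w k"
  unfolding lead_def symbol_def by (auto simp: cf_mulop)

lemma lead_one: "lead 1 0 0"
  using lead_mulop[of 0 0] by simp

text \<open>The coefficient \<open>s ^ t v + lookup m v\<close> is asymptotic to
  \<open>s ^ t v\<close> whatever the base point \<open>m\<close> is; positivity of
  \<open>t v\<close> enters here.\<close>

lemma lead_pder:
  assumes v: "v < r" and w: "w = int (t v) - d v"
  shows "lead (pder v) w (- single v 1)"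
  unfolding lead_def symbol_def
proof (intro allI)
  fix a m
  show "(\<lambda>s. scaled (pder v) w a m s) \<longlonglongrightarrow>
      (if a = - single v 1 then 1 else 0)"
  proof (cases "a = - single v 1")
    case True
    have "wt a = - d v"
      unfolding True using wt_minus[of 0 "single v 1"] wt_single[OF v, of 1] by simp
    then have e: "wt a - w = - int (t v)" using w by simp
    have "(\<lambda>s. 1 + of_int (lookup m v) * inverse (of_nat s) ^ t v :: complex) \<longlonglongrightarrow>
        1 + of_int (lookup m v) * 0 ^ t v"
      by (intro tendsto_intros lim_inverse_n)
    then have lim: "(\<lambda>s. 1 + of_int (lookup m v) * inverse (of_nat s) ^ t v :: complex) \<longlonglongrightarrow> 1"
      using t_pos[of v] by (simp add: zero_power)
    have "(\<lambda>s. scaled (pder v) w a m s) \<longlonglongrightarrow> 1"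
    proof (rule Lim_transform_eventually[OF lim])
      show "\<forall>\<^sub>F s in sequentially. 1 + of_int (lookup m v) * inverse (of_nat s) ^ t v =
          scaled (pder v) w a m s"
        using eventually_gt_at_top[of 0]
      proof eventually_elim
        case (elim s)
        then show ?case
          unfolding e using True v
          by (simp add: cf_pder lookup_pt power_int_minus field_simps)
      qed
    qed
    then show ?thesis using True by simp
  qed (simp add: cf_pder)
qed

lemma lead_add_small:
  assumes "lead f w \<alpha>" "symbol g w (\<lambda>_. 0)"
  shows "lead (f + g) w \<alpha>"
  using symbol_add[OF assms(1)[unfolded lead_def] assms(2)] unfolding lead_def by simp

lemma small_uminus: "symbol g w (\<lambda>_. 0) \<Longrightarrow> symbol (- g) w (\<lambda>_. 0)"
  using symbol_scl[of g w "\<lambda>_. 0" "- 1"] by (simp add: scl_minus_one)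

lemma lead_raise: "lead f w \<alpha> \<Longrightarrow> w < w' \<Longrightarrow> symbol f w' (\<lambda>_. 0)"
  unfolding lead_def by (rule symbol_raise)

lemma lead_prod_list:
  assumes "\<And>x. x \<in> set xs \<Longrightarrow> lead (g x) (w x) (\<alpha> x) \<and> regular (g x)"
  shows "lead (prod_list (map g xs)) (sum_list (map w xs)) (sum_list (map \<alpha> xs)) \<and>
    regular (prod_list (map g xs))"
  using assms
proof (induction xs)
  case Nil
  then show ?case using lead_one regular_one by simp
next
  case (Cons x xs)
  then have "lead (prod_list (map g xs)) (sum_list (map w xs)) (sum_list (map \<alpha> xs))"
    "regular (prod_list (map g xs))" "lead (g x) (w x) (\<alpha> x)" "regular (g x)" by auto
  then show ?case using lead_mult regular_mult by (simp add: regular_def)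
qed

text \<open>In the greatest weight \<open>W\<close> the coefficient at the exponent of
  \<open>x0\<close> sees \<open>x0\<close> alone, so its limit would be both 0 and
  \<open>c x0\<close>. Terms may share a weight or an exponent, as long as the pair tells them
  apart.\<close>

lemma lead_independent:
  assumes L: "finite L" and lead: "\<And>x. x \<in> L \<Longrightarrow> lead (g x) (w x) (\<alpha> x)"
    and inj: "\<And>x y. x \<in> L \<Longrightarrow> y \<in> L \<Longrightarrow> w x = w y \<Longrightarrow> \<alpha> x = \<alpha> y \<Longrightarrow> x = y"
    and zero: "(\<Sum>x\<in>L. scl (c x) (g x)) = 0"
    and nz: "\<And>x. x \<in> L \<Longrightarrow> c x \<noteq> 0"
  shows "L = {}"
proof (rule ccontr)
  assume "L \<noteq> {}"
  define W where "W = Max (w ` L)"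
  have "W \<in> w ` L" unfolding W_def using L \<open>L \<noteq> {}\<close> by (intro Max_in) auto
  then obtain x0 where x0: "x0 \<in> L" "w x0 = W" by auto
  have le: "w x \<le> W" if "x \<in> L" for x unfolding W_def using L that by auto
  have "symbol (g x) W (\<lambda>a. if w x = W \<and> a = \<alpha> x then 1 else 0)" if "x \<in> L" for x
  proof (cases "w x = W")
    case True
    then show ?thesis using lead[OF that] by (simp add: lead_def)
  next
    case False
    then have "w x < W" using le[OF that] by simp
    then show ?thesis using lead_raise[OF lead[OF that]] False by simp
  qed
  then have "symbol (\<Sum>x\<in>L. scl (c x) (g x)) W (\<lambda>a. \<Sum>x\<in>L. c x * (if w x = W \<and> a = \<alpha> x then 1 else 0))"
    by (intro symbol_sum symbol_scl)
  then have "(\<lambda>s. 0) \<longlonglongrightarrow> (\<Sum>x\<in>L. c x * (if w x = W \<and> \<alpha> x0 = \<alpha> x then 1 else 0))"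
    unfolding zero symbol_def by simp
  then have "0 = (\<Sum>x\<in>L. c x * (if w x = W \<and> \<alpha> x0 = \<alpha> x then 1 else 0))"
    using LIMSEQ_unique[OF tendsto_const] by blast
  also have "\<dots> = (\<Sum>x\<in>L. if x = x0 then c x0 else 0)"
    by (intro sum.cong) (use x0 inj in auto)
  also have "\<dots> = c x0" using x0 L by simp
  finally show False using nz x0 by simp
qed

end

section \<open>Weights separating the ordered monomials\<close>

lemma base_representation_unique:
  fixes b c :: "nat \<Rightarrow> nat"
  assumes "\<And>u. u < r \<Longrightarrow> b u < K" "\<And>u. u < r \<Longrightarrow> c u < K"
    and "(\<Sum>u<r. K ^ (r - u) * b u) = (\<Sum>u<r. K ^ (r - u) * c u)"
  shows "\<forall>u<r. b u = c u"
  using assms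
proof (induction r)
  case (Suc r)
  have K: "K > 0" using Suc.prems(1)[of 0] by auto
  have split: "(\<Sum>u<Suc r. K ^ (Suc r - u) * f u) = K * ((\<Sum>u<r. K ^ (r - u) * f u) + f r)" for f :: "nat \<Rightarrow> nat"
    by (simp add: sum_distrib_left distrib_left Suc_diff_le mult.assoc)
  have sums: "(\<Sum>u<r. K ^ (r - u) * b u) + b r = (\<Sum>u<r. K ^ (r - u) * c u) + c r"
    using Suc.prems(3) K unfolding split by simp
  have ex: "\<exists>m. (\<Sum>u<r. K ^ (r - u) * f u) = K * m" for f :: "nat \<Rightarrow> nat"
  proof
    have st: "K ^ (r - u) * f u = K * (K ^ (r - u - 1) * f u)" if "u < r" for u
    proof -
      have "r - u = Suc (r - u - 1)" using that by simp
      then have "K ^ (r - u) = K * K ^ (r - u - 1)" by (metis power_Suc)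
      then show ?thesis by simp
    qed
    show "(\<Sum>u<r. K ^ (r - u) * f u) = K * (\<Sum>u<r. K ^ (r - u - 1) * f u)"
      unfolding sum_distrib_left by (rule sum.cong[OF refl]) (rule st, simp)
  qed
  obtain mb mc where m: "(\<Sum>u<r. K ^ (r - u) * b u) = K * mb" "(\<Sum>u<r. K ^ (r - u) * c u) = K * mc"
    using ex[of b] ex[of c] by blast
  have eq: "K * mb + b r = K * mc + c r" using sums unfolding m .
  then have "(K * mb + b r) mod K = (K * mc + c r) mod K" by simp
  then have br: "b r = c r" using Suc.prems(1,2)[of r] by simp
  then have "(\<Sum>u<r. K ^ (r - u) * b u) = (\<Sum>u<r. K ^ (r - u) * c u)" using sums by simp
  then have "\<forall>u<r. b u = c u" by (intro Suc.IH) (use Suc.prems(1,2) in auto)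
  then show ?case using br by (simp add: less_Suc_eq)
qed simp

definition level :: "nat \<Rightarrow> nat" where "level v = (LEAST k. v < tri k)"

lemma level_vidx: "i < k \<Longrightarrow> level (vidx k i) = k"
  unfolding level_def
proof (rule Least_equality)
  assume i: "i < k"
  show "vidx k i < tri k" by (rule vidx_less_tri[OF i])
  fix m assume m: "vidx k i < tri m"
  show "k \<le> m"
  proof (rule ccontr)
    assume "\<not> k \<le> m"
    then have "tri m \<le> tri (k - 1)" by (intro tri_mono) simp
    then show False using m by (simp add: vidx_def)
  qed
qed

lemma vidx_inj: "vidx k i = vidx l j \<Longrightarrow> i < k \<Longrightarrow> j < l \<Longrightarrow> k = l \<and> i = j"
  using level_vidx vidx_eq_iff by metis

lemma vidx_mono: "k < l \<Longrightarrow> i < k \<Longrightarrow> vidx k i < vidx l j"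
  using vidx_less_tri[of i k] tri_mono[of k "l - 1"] unfolding vidx_def by linarith

text \<open>
  The generators of \<open>s_lie n\<close> are numbered row by row as entries of an \<open>n \<times> (n + 1)\<close> matrix, the
  last column consisting of the vectors.
\<close>

definition ngen :: "nat \<Rightarrow> nat" where "ngen n = n * (n + 1)"
definition idx :: "nat \<Rightarrow> nat \<Rightarrow> nat \<Rightarrow> nat" where "idx n i j = i * (n + 1) + j"
definition grow :: "nat \<Rightarrow> nat \<Rightarrow> nat" where "grow n c = c div (n + 1)"
definition gcol :: "nat \<Rightarrow> nat \<Rightarrow> nat" where "gcol n c = c mod (n + 1)"

lemma grow_idx [simp]: "j \<le> n \<Longrightarrow> grow n (idx n i j) = i"
  unfolding grow_def idx_def by (subst div_mult_self3) auto

lemma gcol_idx [simp]: "j \<le> n \<Longrightarrow> gcol n (idx n i j) = j"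
  unfolding gcol_def idx_def by (subst mod_mult_self3) auto

lemma idx_grow_gcol [simp]: "idx n (grow n c) (gcol n c) = c"
  unfolding grow_def gcol_def idx_def by (rule div_mult_mod_eq)

lemma gcol_le: "gcol n c \<le> n"
  using mod_less_divisor[of "n + 1" c] unfolding gcol_def by linarith

lemma grow_less: "c < ngen n \<Longrightarrow> grow n c < n"
  unfolding grow_def ngen_def by (rule less_mult_imp_div_less)

lemma idx_less: "i < n \<Longrightarrow> j \<le> n \<Longrightarrow> idx n i j < ngen n"
proof -
  assume "i < n" "j \<le> n"
  then have "Suc i * (n + 1) \<le> ngen n" unfolding ngen_def by (intro mult_right_mono) auto
  then show ?thesis using \<open>j \<le> n\<close> by (simp add: idx_def)
qed

definition gen :: "nat \<Rightarrow> nat \<Rightarrow> lop" where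
  "gen n c = (if gcol n c < n then E n (grow n c) (gcol n c) else X (vidx n (grow n c)))"

lemma gen_weyl: "c < ngen n \<Longrightarrow> gen n c \<in> weyl_ops (tri n)"
proof -
  assume "c < ngen n"
  then have "grow n c < n" by (rule grow_less)
  then show ?thesis by (auto simp: gen_def intro: E_weyl X_weyl)
qed

text \<open>The number \<open>K\<close> will exceed the length of all words compared, which makes
  \<theta>-degrees digits in base \<open>K\<close>. The number \<open>T\<close> exceeds every
  \<open>tw v\<close>, so a change of level outweighs any single \<theta>. The weights
  \<open>tw\<close> decrease with the index, so a \<theta> of a lower level beats one of a higher
  level.\<close>

locale gk_weights =
  fixes n K :: nat
  assumes K: "2 \<le> K"
begin

definition T :: int where "T = int (K ^ tri n) + 1"
text \<open>Constant on each level, so that x_i d_j inside a level has exactly the weight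
  \<open>tw\<close> of its derivation. A variable of level k over one of level k + 1 has weight
  \<open>T\<close> times tri (k + 1) - tri k, that is T (k + 1), which grows with k.\<close>

definition dw :: "nat \<Rightarrow> int" where "dw v = - T * int (tri (level v))"
definition tw :: "nat \<Rightarrow> nat" where "tw v = K ^ (tri n - v)"

sublocale leading "tri n" dw tw
  by standard (use K in \<open>simp add: tw_def\<close>)

lemma tw_less_T: "int (tw v) < T"
proof -
  have "tw v \<le> K ^ tri n" unfolding tw_def using K by (intro power_increasing) auto
  then show ?thesis by (simp add: T_def)
qed

lemma T_pos: "T > 0" by (simp add: T_def add_nonneg_pos)

lemma tw_strict: "u < v \<Longrightarrow> v \<le> tri n \<Longrightarrow> tw v < tw u"
  unfolding tw_def using K by (intro power_strict_increasing) auto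

lemma T_mult_less: "k < l \<Longrightarrow> T * int k < T * int l"
  using T_pos by simp

lemma T_le: "k > 0 \<Longrightarrow> T \<le> T * int k"
  using T_pos by simp

lemma tw_less: "int (tw v) < T * int (Suc k)"
  using tw_less_T T_le[of "Suc k"] by (rule less_le_trans) simp

definition wg :: "nat \<Rightarrow> nat \<Rightarrow> int" where
  "wg i j = (if j \<le> i then int (tw (vidx (Suc i) j)) else if j < n then T * int (Suc j) else - T * int (tri n))"

text \<open>On and below the diagonal the leading term is x_i d_j of level i + 1, the level whose
  last row is i. Above it, the leading term is a variable of level j over the last variable of level
  j + 1. Column j = n holds the vectors, which carry no denominator.\<close>

definition ag :: "nat \<Rightarrow> nat \<Rightarrow> (nat \<Rightarrow>\<^sub>0 int)" where
  "ag i j = (if j \<le> i then single (vidx (Suc i) i) 1 - single (vidx (Suc i) j) 1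
    else single (vidx j i) 1 - (if j < n then single (vidx (Suc j) j) 1 else 0))"

lemma vidx_less: "i < k \<Longrightarrow> k \<le> n \<Longrightarrow> vidx k i < tri n"
  using vidx_less_tri[of i k] tri_mono[of k n] by simp

lemma wt_vidx: "i < k \<Longrightarrow> k \<le> n \<Longrightarrow> wt (single (vidx k i) c) = - T * int (tri k) * c"
  by (simp add: wt_single vidx_less dw_def level_vidx)

lemma lead_X: "i < k \<Longrightarrow> k \<le> n \<Longrightarrow> lead (X (vidx k i)) (- T * int (tri k)) (single (vidx k i) 1)"
  by (rule lead_mulop) (simp add: wt_vidx)

lemma lead_Xinv: "i < k \<Longrightarrow> k \<le> n \<Longrightarrow> lead (Xinv (vidx k i)) (T * int (tri k)) (- single (vidx k i) 1)"
  unfolding single_uminus[symmetric] by (rule lead_mulop) (simp add: wt_vidx)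

lemma lead_D: "i < k \<Longrightarrow> k \<le> n \<Longrightarrow>
  lead (pder (vidx k i)) (int (tw (vidx k i)) + T * int (tri k)) (- single (vidx k i) 1)"
  by (rule lead_pder) (simp_all add: vidx_less dw_def level_vidx)

lemma lead_times:
  "lead f w \<alpha> \<Longrightarrow> lead g v \<beta> \<Longrightarrow> g \<in> weyl_ops r \<Longrightarrow> w' = w + v \<Longrightarrow> \<gamma> = \<alpha> + \<beta> \<Longrightarrow> lead (f * g) w' \<gamma>"
  using lead_mult regular_weyl_ops by (auto simp: regular_def)

lemma lead_E: "m \<le> n \<Longrightarrow> i < m \<Longrightarrow> j < m \<Longrightarrow> lead (E m i j) (wg i j) (ag i j)"
proof (induction m arbitrary: i j)
  case (Suc k)
  let ?v = "vidx (Suc k)"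
  have n: "Suc k \<le> n" by fact
  have xd: "lead (X (?v a) * pder (?v b)) (int (tw (?v b)))
      (single (?v a) 1 - single (?v b) 1)"
    if "a \<le> k" "b \<le> k" for a b
    by (rule lead_times[OF lead_X lead_D pder_weyl]) (use that n in \<open>auto simp: algebra_simps\<close>)
  consider (last) "i = k" | (column) "i < k" "j = k" | (inner) "i < k" "j < k"
    using Suc.prems by linarith
  then show ?case
  proof cases
    case last
    then show ?thesis using xd[of k j] Suc.prems by (simp add: wg_def ag_def)
  next
    case column
    have main: "lead (Xinv (?v k) * X (vidx k i)) (wg i k) (ag i k)"
      by (rule lead_times[OF lead_Xinv lead_X X_weyl])
        (use column n in \<open>auto simp: wg_def ag_def algebra_simps\<close>)
    have "symbol (X (?v i) * pder (?v k)) (wg i k) (\<lambda>_. 0)"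
    proof (rule lead_raise[OF xd])
      show "int (tw (?v k)) < wg i k"
        using column n tw_less[of "?v k" k] by (simp add: wg_def del: of_nat_Suc)
    qed (use column in auto)
    \<comment> \<open>Both variables belong to level k + 1 and their weights cancel, so the summand
      has the weight of \<open>E k i l\<close>, which is smaller than that of column k.\<close>
    moreover have "symbol (Xinv (?v k) * (X (?v l) * E k i l)) (wg i k) (\<lambda>_. 0)" if l: "l < k" for l
    proof (rule lead_raise)
      have "lead (X (?v l) * E k i l) (- T * int (tri (Suc k)) + wg i l) (single (?v l) 1 + ag i l)"
        by (rule lead_times[OF lead_X Suc.IH E_weyl]) (use column l n in auto)
      moreover have "X (?v l) * E k i l \<in> weyl_ops (tri n)"
        using X_weyl[of l "Suc k" n] E_weyl[of i k l] weyl_ops_mono[OF tri_mono, of k n] column l n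
        by (intro weyl_ops_closed(3)) auto
      ultimately show "lead (Xinv (?v k) * (X (?v l) * E k i l)) (wg i l)
          (- single (?v k) 1 + (single (?v l) 1 + ag i l))"
        by (intro lead_times[OF lead_Xinv]) (use n in auto)
      show "wg i l < wg i k"
      proof (cases "l \<le> i")
        case True
        then show ?thesis
          using column l n tw_less[of "vidx (Suc i) l" k] by (simp add: wg_def del: of_nat_Suc)
      next
        case False
        then show ?thesis using column l n T_mult_less[of "Suc l" "Suc k"] by (simp add: wg_def)
      qed
    qed
    then have "symbol (- (\<Sum>l<k. Xinv (?v k) * (X (?v l) * E k i l))) (wg i k) (\<lambda>_. 0)"
      using symbol_sum[of "{..<k}" "\<lambda>l. Xinv (?v k) * (X (?v l) * E k i l)" "wg i k" "\<lambda>_ _. 0"]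
      by (intro small_uminus) simp
    ultimately have "symbol (X (?v i) * pder (?v k) + - (\<Sum>l<k. Xinv (?v k) * (X (?v l) * E k i l))) (wg i k) (\<lambda>_. 0)"
      using symbol_add by fastforce
    from lead_add_small[OF main this] show ?thesis
      using column by (simp add: algebra_simps sum_distrib_left)
  next
    case inner
    have "lead (E k i j) (wg i j) (ag i j)" using Suc.IH inner n by simp
    \<comment> \<open>The lower level dominates: on or below the diagonal because \<open>tw\<close>
      decreases with the index, above it because the weight of the entry is at least
      \<open>T\<close>.\<close>
    moreover have "symbol (X (?v i) * pder (?v j)) (wg i j) (\<lambda>_. 0)"
    proof (rule lead_raise[OF xd])
      show "int (tw (?v j)) < wg i j"
      proof (cases "j \<le> i")
        case True
        have "vidx (Suc i) j < ?v j" using inner True by (intro vidx_mono) auto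
        then show ?thesis using True tw_strict[of "vidx (Suc i) j" "?v j"] vidx_less[of j "Suc k"] inner n
          by (simp add: wg_def)
      next
        case False
        then show ?thesis
          using inner n tw_less[of "?v j" j] by (simp add: wg_def del: of_nat_Suc)
      qed
    qed (use inner in auto)
    ultimately show ?thesis using lead_add_small inner by (simp add: add.commute)
  qed
qed simp

definition wgen :: "nat \<Rightarrow> int" where "wgen c = wg (grow n c) (gcol n c)"
definition agen :: "nat \<Rightarrow> (nat \<Rightarrow>\<^sub>0 int)" where "agen c = ag (grow n c) (gcol n c)"

lemma lead_gen:
  assumes "c < ngen n"
  shows "lead (gen n c) (wgen c) (agen c)"
proof -
  have i: "grow n c < n" using assms by (rule grow_less)
  show ?thesis
  proof (cases "gcol n c < n")
    case True
    then show ?thesis using lead_E[of n] i by (simp add: gen_def wgen_def agen_def)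
  next
    case False
    then have "gcol n c = n" using gcol_le[of n c] by linarith
    then show ?thesis using lead_X[of _ n] i by (simp add: gen_def wgen_def agen_def wg_def ag_def)
  qed
qed

definition low :: "nat \<Rightarrow> nat \<Rightarrow> nat" where
  "low u c = (if gcol n c \<le> grow n c \<and> vidx (Suc (grow n c)) (gcol n c) = u then 1 else 0)"

text \<open>Separating the weight of the exponent from the \<theta>-part exhibits the remainder as a
  number in base \<open>K\<close>, with the indicators \<open>low\<close> as digits; these add up
  along a word.\<close>

lemma wgen_eq:
  assumes "c < ngen n"
  shows "wgen c = wt (agen c) + int (\<Sum>u<tri n. K ^ (tri n - u) * low u c)"
proof -
  define i j where ij: "i = grow n c" "j = gcol n c"
  have i: "i < n" using assms unfolding ij by (rule grow_less)
  have j: "j \<le> n" unfolding ij by (rule gcol_le)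
  show ?thesis
  proof (cases "j \<le> i")
    case True
    have "(\<Sum>u<tri n. K ^ (tri n - u) * low u c) = (\<Sum>u<tri n. if u = vidx (Suc i) j then tw u else 0)"
      using True by (intro sum.cong) (auto simp: low_def ij tw_def)
    also have "\<dots> = tw (vidx (Suc i) j)" using vidx_less[of j "Suc i"] i True by simp
    finally show ?thesis
      using True i unfolding wgen_def agen_def ij[symmetric] by (simp add: wg_def ag_def wt_minus wt_vidx)
  next
    case False
    then have sum0: "(\<Sum>u<tri n. K ^ (tri n - u) * low u c) = 0"
      by (simp add: low_def flip: ij)
    show ?thesis
      using False i j
      unfolding sum0 wgen_def agen_def ij[symmetric] by (auto simp: wg_def ag_def wt_minus wt_vidx algebra_simps)
  qed
qed

lemma wgen_list:
  assumes "set v \<subseteq> {..<ngen n}"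
  shows "sum_list (map wgen v) = wt (sum_list (map agen v)) +
    int (\<Sum>u<tri n. K ^ (tri n - u) * sum_list (map (low u) v))"
  using assms
  by (induction v) (simp_all add: wgen_eq wt_add distrib_left sum.distrib)

lemma low_list_le: "sum_list (map (low u) v) \<le> length v"
  by (induction v) (auto simp: low_def)

lemma low_list_count:
  assumes "set v \<subseteq> {..<ngen n}" "j \<le> i" "i < n"
  shows "sum_list (map (low (vidx (Suc i) j)) v) = count_list v (idx n i j)"
proof -
  have "low (vidx (Suc i) j) c = (if c = idx n i j then 1 else 0)" for c
  proof (cases "c = idx n i j")
    case True
    then show ?thesis using assms(2,3) by (simp add: low_def)
  next
    case False
    have "\<not> (gcol n c \<le> grow n c \<and> vidx (Suc (grow n c)) (gcol n c) = vidx (Suc i) j)"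
    proof
      assume a: "gcol n c \<le> grow n c \<and> vidx (Suc (grow n c)) (gcol n c) = vidx (Suc i) j"
      then have "grow n c = i" "gcol n c = j"
        using vidx_inj[of "Suc (grow n c)" "gcol n c" "Suc i" j] assms(2) by auto
      then show False using False idx_grow_gcol[of n c] by metis
    qed
    then show ?thesis using False by (simp add: low_def)
  qed
  then show ?thesis by (induction v) simp_all
qed

lemma lookup_agen_list:
  assumes "set v \<subseteq> {..<q}"
  shows "lookup (sum_list (map agen v)) u = (\<Sum>c<q. int (count_list v c) * lookup (agen c) u)"
  using assms
proof (induction v)
  case (Cons x v)
  have "(\<Sum>c<q. int (count_list (x # v) c) * lookup (agen c) u) =
      (\<Sum>c<q. (if c = x then lookup (agen x) u else 0) + int (count_list v c) * lookup (agen c) u)"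
    by (intro sum.cong) (auto simp: algebra_simps)
  also have "\<dots> = lookup (agen x) u + (\<Sum>c<q. int (count_list v c) * lookup (agen c) u)"
    using Cons.prems by (simp add: sum.distrib)
  finally show ?case using Cons by (simp add: lookup_add)
qed simp

text \<open>With equal exponents, equality of weights is an equality of base \<open>K\<close>
  expansions and yields the counts on and below the diagonal. The columns above it follow from left
  to right: apart from the entry (i, j), the variable \<open>vidx j i\<close> occurs only in entries
  on or below the diagonal and in columns to the left of j.\<close>

lemma leading_exponents_inj:
  assumes v: "set v \<subseteq> {..<ngen n}" "length v < K"
    and v': "set v' \<subseteq> {..<ngen n}" "length v' < K"
    and w: "sum_list (map wgen v) = sum_list (map wgen v')"
    and a: "sum_list (map agen v) = sum_list (map agen v')"
  shows "mset v = mset v'"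
proof -
  let ?q = "ngen n"
  have "(\<Sum>u<tri n. K ^ (tri n - u) * sum_list (map (low u) v)) =
      (\<Sum>u<tri n. K ^ (tri n - u) * sum_list (map (low u) v'))"
    using w unfolding wgen_list[OF v(1)] wgen_list[OF v'(1)] a by linarith
  then have eqlow: "\<forall>u<tri n. sum_list (map (low u) v) = sum_list (map (low u) v')"
    using low_list_le v(2) v'(2) by (intro base_representation_unique) (auto intro: le_less_trans)
  have lo: "count_list v (idx n i j) = count_list v' (idx n i j)" if "j \<le> i" "i < n" for i j
    using low_list_count[OF v(1) that] low_list_count[OF v'(1) that] eqlow vidx_less[of j "Suc i"] that by simp
  have up: "\<forall>i<j. count_list v (idx n i j) = count_list v' (idx n i j)" if "j \<le> n" for j
    using that
  proof (induction j rule: less_induct)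
    case (less j)
    show ?case
    proof (intro allI impI)
      fix i assume ij: "i < j"
      let ?u = "vidx j i" and ?c0 = "idx n i j"
      have c0: "?c0 < ?q"
        using ij less.prems by (intro idx_less) auto
      define D where "D c = int (count_list v c) - int (count_list v' c)" for c
      have "(\<Sum>c<?q. D c * lookup (agen c) ?u) = 0"
        using lookup_agen_list[OF v(1), of ?u] lookup_agen_list[OF v'(1), of ?u] a
        by (simp add: D_def left_diff_distrib sum_subtractf)
      moreover have "D c * lookup (agen c) ?u = (if c = ?c0 then D ?c0 else 0)" if c: "c < ?q" for c
      proof -
        define k l where kl: "k = grow n c" "l = gcol n c"
        have k: "k < n" using c unfolding kl by (rule grow_less)
        have l: "l \<le> n" unfolding kl by (rule gcol_le)
        have ckl: "c = idx n k l" by (simp add: kl)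
        have ag: "agen c = ag k l" by (simp add: agen_def kl)
        consider (low) "l \<le> k" | (up) "k < l" "l < j" | (rest) "k < l" "j \<le> l" by linarith
        then show ?thesis
        proof cases
          case low
          then have "D c = 0" using lo[of l k] k by (simp add: D_def ckl)
          moreover have "c \<noteq> ?c0"
          proof
            assume "c = ?c0"
            then have "k = i" "l = j" using kl ij less.prems by simp_all
            then show False using low ij by simp
          qed
          ultimately show ?thesis by simp
        next
          case up
          then have "D c = 0" using less.IH[of l] l by (simp add: D_def ckl)
          moreover have "c \<noteq> ?c0"
          proof
            assume "c = ?c0"
            then have "l = j" using kl ij less.prems by simp
            then show False using up by simp
          qed
          ultimately show ?thesis by simp
        next
          case rest
          \<comment> \<open>The denominator of a column l \<ge> j is a variable of level l + 1,
            hence not one of level j.\<close>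
          have "vidx (Suc l) l \<noteq> ?u" using vidx_inj[of "Suc l" l j i] ij rest by auto
          moreover have "vidx l k = ?u \<longleftrightarrow> c = ?c0"
          proof
            assume "vidx l k = ?u"
            then show "c = ?c0" using vidx_inj[of l k j i] ij rest ckl by auto
          next
            assume "c = ?c0"
            then have "k = i" "l = j" using kl ij less.prems by simp_all
            then show "vidx l k = ?u" by simp
          qed
          ultimately show ?thesis using rest
            by (auto simp: ag ag_def lookup_minus lookup_single)
        qed
      qed
      ultimately have "(\<Sum>c<?q. if c = ?c0 then D ?c0 else 0) = 0" by simp
      then have "D ?c0 = 0" using c0 by simp
      then show "count_list v ?c0 = count_list v' ?c0" by (simp add: D_def)
    qed
  qed
  show ?thesis
  proof (rule multiset_eqI)
    fix c
    show "count (mset v) c = count (mset v') c"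
    proof (cases "c < ?q")
      case True
      define k l where kl: "k = grow n c" "l = gcol n c"
      have k: "k < n" using True grow_less by (simp add: kl)
      have l: "l \<le> n" unfolding kl by (rule gcol_le)
      have "c = idx n k l" by (simp add: kl)
      then show ?thesis using lo[of l k] up[of l] k l by (cases "l \<le> k") (auto simp: count_mset)
    next
      case False
      then have "c \<notin> set v" "c \<notin> set v'" using v(1) v'(1) by auto
      then show ?thesis by (simp add: count_mset count_list_0_iff)
    qed
  qed
qed

end

text \<open>Leading data determine the multiset of letters, and a sorted word is determined by its
  multiset; the weights are fitted to the finite set \<open>L\<close>.\<close>

theorem pbw_independent:
  assumes L: "finite L" "\<And>v. v \<in> L \<Longrightarrow> sorted v \<and> set v \<subseteq> {..<ngen n}"
    and zero: "(\<Sum>v\<in>L. scl (c v) (prod_list (map (gen n) v))) = 0"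
    and v: "v \<in> L"
  shows "c v = 0"
proof (rule ccontr)
  assume cv: "c v \<noteq> 0"
  \<comment> \<open>One more than every word length, so that letter counts are proper digits; the
    inserted 1 secures \<open>2 \<le> K\<close> even if all words are empty.\<close>
  define K where "K = Max (insert 1 (length ` L)) + 1"
  have len: "length v < K" if "v \<in> L" for v
  proof -
    have "length v \<le> Max (insert 1 (length ` L))" using L(1) that by (intro Max_ge) auto
    then show ?thesis by (simp add: K_def)
  qed
  have Max: "1 \<le> Max (insert 1 (length ` L))" using L(1) by (intro Max_ge) auto
  interpret gk_weights n K by standard (use Max in \<open>simp add: K_def\<close>)
  let ?L = "{v \<in> L. c v \<noteq> 0}"
  have "?L = {}"
  proof (rule lead_independent[where g = "\<lambda>v. prod_list (map (gen n) v)" and c = c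
        and w = "\<lambda>v. sum_list (map wgen v)" and \<alpha> = "\<lambda>v. sum_list (map agen v)"])
    show "finite ?L" using L(1) by simp
    show "lead (prod_list (map (gen n) v)) (sum_list (map wgen v)) (sum_list (map agen v))" if "v \<in> ?L" for v
      using lead_prod_list[of v "gen n" wgen agen] lead_gen regular_weyl_ops[OF gen_weyl] L(2)[of v] that by blast
    show "v = v'" if "v \<in> ?L" "v' \<in> ?L" "sum_list (map wgen v) = sum_list (map wgen v')"
      "sum_list (map agen v) = sum_list (map agen v')" for v v'
    proof -
      have "mset v = mset v'"
        using that L(2)[of v] L(2)[of v'] len by (intro leading_exponents_inj) auto
      then show ?thesis using that L(2)[of v] L(2)[of v'] by (metis (no_types, lifting) mem_Collect_eq properties_for_sort)
    qed
    show "(\<Sum>v\<in>?L. scl (c v) (prod_list (map (gen n) v))) = 0"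
      using zero by (subst (asm) sum.mono_neutral_right[of L ?L]) (use L(1) in auto)
  qed simp
  then show False using v cv by auto
qed

section \<open>The Ore condition from polynomial growth\<close>

lemma power_less_two_power:
  fixes c q :: nat
  shows "\<exists>k. (k * c + 1) ^ q < 2 ^ k"
proof -
  \<comment> \<open>The witness is \<open>2 ^ m\<close>: as
    \<open>2 ^ m * c + 1 \<le> 2 ^ (m + c)\<close>, it is enough that
    \<open>(m + c) * q < 2 ^ m\<close>. The offset 4 is where \<open>3 * t \<le> 2 ^ t\<close>
    starts to hold for good.\<close>
  define t where "t = c + q + 4"
  define m where "m = 2 * t"
  have "3 * (s + 4) \<le> (2 :: nat) ^ (s + 4)" for s
  proof (induction s)
    case (Suc s)
    have "3 * (Suc s + 4) \<le> 2 * (3 * (s + 4))" by simp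
    also have "\<dots> \<le> 2 * 2 ^ (s + 4)" using Suc by (intro mult_left_mono) simp_all
    also have "\<dots> = 2 ^ (Suc s + 4)" by (simp only: add_Suc power_Suc)
    finally show ?case .
  qed simp
  from this[of "c + q"] have t: "3 * t \<le> 2 ^ t" by (simp add: t_def)
  have "m + c \<le> 2 ^ t" using t by (simp add: m_def t_def)
  moreover have "q < 2 ^ t" using less_exp[of t] unfolding t_def by linarith
  ultimately have "(m + c) * q < 2 ^ t * 2 ^ t" by (intro mult_le_less_imp_less) (auto simp: m_def t_def)
  then have mc: "(m + c) * q < 2 ^ m" by (simp add: m_def mult_2 power_add)
  have "c + 1 \<le> 2 ^ c" using less_exp[of c] by linarith
  then have "2 ^ m * (c + 1) \<le> 2 ^ (m + c)" unfolding power_add by (intro mult_left_mono) simp_all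
  then have "2 ^ m * c + 1 \<le> 2 ^ (m + c)" using one_le_power[of "2 :: nat" m] unfolding distrib_left mult_1_right by linarith
  then have "(2 ^ m * c + 1) ^ q \<le> (2 ^ (m + c)) ^ q" by (rule power_mono) simp
  also have "\<dots> < 2 ^ (2 ^ m)" using mc by (simp flip: power_mult)
  finally show ?thesis by blast
qed

text \<open>
  If \<open>a U \<inter> b U = 0\<close>, then the dimension of the filtration doubles every \<open>c\<close> steps, where \<open>c\<close> is the
  degree of \<open>a\<close> and \<open>b\<close>.
\<close>

lemma right_ore_by_growth:
  fixes V B :: "nat \<Rightarrow> lop set"
  assumes V: "\<And>N. V N = lop.span (B N)" and fin: "\<And>N. finite (B N)"
    and card: "\<And>N. card (B N) \<le> (N + 1) ^ q"
    and mult: "\<And>N M f g. f \<in> V N \<Longrightarrow> g \<in> V M \<Longrightarrow> f * g \<in> V (N + M)"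
    and one: "1 \<in> V 0"
    and reg: "\<And>N f. f \<in> V N \<Longrightarrow> regular f"
    and ab: "a \<in> V c" "b \<in> V c" "a \<noteq> 0" "b \<noteq> 0"
  shows "\<exists>N. \<exists>u \<in> V N. \<exists>v \<in> V N. a * u = b * v \<and> a * u \<noteq> 0"
proof (rule ccontr)
  assume "\<not> ?thesis"
  then have no: "a * u = 0" if "u \<in> V N" "v \<in> V N" "a * u = b * v" for u v N using that by blast
  have sub: "lop.subspace (V N)" for N by (simp add: V)
  have cancel: "x = 0" if "f * x = 0" "f \<in> V c" "f \<noteq> 0" "x \<in> V N" for f x N
    using regular_no_zero_divisors[of f x] that reg by blast
  have basis: "\<exists>S. S \<subseteq> V N \<and> lop.independent S \<and> V N \<subseteq> lop.span S \<and> card S = lop.dim (V N) \<and> finite S" for N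
  proof -
    obtain S where S: "S \<subseteq> V N" "lop.independent S" "V N \<subseteq> lop.span S" "card S = lop.dim (V N)"
      using lop.basis_exists[of "V N"] by auto
    then have "finite S" using lop.independent_span_bound[OF fin[of N], of S] V by auto
    then show ?thesis using S by blast
  qed
  have double: "2 * lop.dim (V N) \<le> lop.dim (V (c + N))" for N
  proof -
    obtain S where S: "S \<subseteq> V N" "lop.independent S" "card S = lop.dim (V N)" "finite S" using basis by blast
    obtain S' where S': "V (c + N) \<subseteq> lop.span S'" "card S' = lop.dim (V (c + N))" "finite S'" using basis by blast
    have Sn: "x \<noteq> 0" if "x \<in> S" for x using that S(2) lop.dependent_zero by blast
    have inj: "inj_on ((*) f) S" if f: "f \<in> V c" "f \<noteq> 0" for f
    proof (rule inj_onI)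
      fix x y assume xy: "x \<in> S" "y \<in> S" "f * x = f * y"
      then have "f * (x - y) = 0" by (simp add: right_diff_distrib)
      moreover have "x - y \<in> V N" using xy S(1) lop.subspace_diff[OF sub] by blast
      ultimately have "x - y = 0" by (rule cancel[OF _ f])
      then show "x = y" by simp
    qed
    have disj: "(*) a ` S \<inter> (*) b ` S = {}"
    proof (rule equals0I)
      fix z assume "z \<in> (*) a ` S \<inter> (*) b ` S"
      then obtain x y where xy: "x \<in> S" "y \<in> S" "a * x = b * y" by auto
      then have "a * x = 0" using no[of x N y] S(1) by blast
      then show False using cancel[of a x N] ab xy S(1) Sn by blast
    qed
    define Z where "Z = (*) a ` S \<union> (*) b ` S"
    \<comment> \<open>A dependence reads \<open>a * P = b * (- Q)\<close> with \<open>P\<close> and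
      \<open>Q\<close> in \<open>V N\<close>. Without nonzero common multiples both sides vanish,
      then \<open>P\<close> and \<open>Q\<close> vanish by cancellation, against the independence of
      \<open>S\<close>.\<close>
    have "lop.independent Z"
    proof
      assume "lop.dependent Z"
      then obtain u where u: "\<exists>z\<in>Z. u z \<noteq> 0" "(\<Sum>z\<in>Z. scl (u z) z) = 0"
        using lop.dependent_finite[of Z] S(4) by (auto simp: Z_def)
      define P Q where "P = (\<Sum>x\<in>S. scl (u (a * x)) x)" and "Q = (\<Sum>x\<in>S. scl (u (b * x)) x)"
      have PQ: "P \<in> V N" "Q \<in> V N"
        unfolding P_def Q_def using S(1) by (auto intro!: lop.subspace_sum[OF sub] lop.subspace_scale[OF sub])
      have "(\<Sum>z\<in>Z. scl (u z) z) = a * P + b * Q"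
        unfolding Z_def P_def Q_def sum_distrib_left using S(4) disj inj ab
        by (subst sum.union_disjoint) (auto simp: sum.reindex scl_mult_right)
      then have eq: "a * P = b * (- Q)" using u(2) by (simp add: eq_neg_iff_add_eq_0)
      have Q': "- Q \<in> V N" using lop.subspace_neg[OF sub PQ(2)] .
      have aP: "a * P = 0" by (rule no[OF PQ(1) Q' eq])
      then have bQ: "b * Q = 0" using eq by simp
      have P0: "(\<Sum>x\<in>S. scl (u (a * x)) x) = 0"
        using cancel[OF aP ab(1,3) PQ(1)] by (simp add: P_def)
      have Q0: "(\<Sum>x\<in>S. scl (u (b * x)) x) = 0"
        using cancel[OF bQ ab(2,4) PQ(2)] by (simp add: Q_def)
      have "u (a * x) = 0" "u (b * x) = 0" if "x \<in> S" for x
        using lop.independentD[OF S(2,4) subset_refl P0 that] lop.independentD[OF S(2,4) subset_refl Q0 that]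
        by auto
      then show False using u(1) by (auto simp: Z_def)
    qed
    moreover have "Z \<subseteq> lop.span S'"
    proof -
      have "Z \<subseteq> V (c + N)" unfolding Z_def using S(1) ab mult by blast
      then show ?thesis using S'(1) by blast
    qed
    ultimately have "card Z \<le> card S'" using lop.independent_span_bound[OF S'(3)] by blast
    moreover have "card Z = 2 * card S"
      unfolding Z_def using S(4) disj inj ab by (subst card_Un_disjoint) (auto simp: card_image)
    ultimately show ?thesis using S S' by simp
  qed
  have d0: "1 \<le> lop.dim (V 0)"
  proof -
    obtain S where S: "V 0 \<subseteq> lop.span S" "card S = lop.dim (V 0)" "finite S" using basis by blast
    have "S \<noteq> {}"
    proof
      assume "S = {}"
      then have "(1 :: lop) = 0" using S(1) one by auto
      then show False by simp
    qed
    then show ?thesis using S card_gt_0_iff[of S] by simp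
  qed
  have "2 ^ k \<le> lop.dim (V (k * c))" for k
  proof (induction k)
    case (Suc k)
    then show ?case using double[of "k * c"] by simp
  qed (use d0 in simp)
  moreover have "lop.dim (V N) \<le> (N + 1) ^ q" for N
    using lop.dim_le_card[OF eq_refl[OF V] fin] card by (rule le_trans)
  ultimately have "2 ^ k \<le> (k * c + 1) ^ q" for k by (meson le_trans)
  then show False using power_less_two_power[of c q] by (meson not_le)
qed

section \<open>The representation of the Lie algebra by differential operators\<close>

text \<open>Coefficients are passed as functions: entrywise formulas for sums and products of
  matrices hold only for indices below \<open>n\<close>, and \<open>rep_mat_cong\<close> restricts
  attention to those.\<close>

definition rep_mat :: "nat \<Rightarrow> (nat \<Rightarrow> nat \<Rightarrow> complex) \<Rightarrow> lop" where
  "rep_mat n a = (\<Sum>i<n. \<Sum>j<n. scl (a i j) (E n i j))"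

definition rep_vec :: "nat \<Rightarrow> (nat \<Rightarrow> complex) \<Rightarrow> lop" where
  "rep_vec n w = (\<Sum>i<n. scl (w i) (X (vidx n i)))"

definition rep :: "nat \<Rightarrow> complex mat \<times> complex vec \<Rightarrow> lop" where
  "rep n x = rep_mat n (\<lambda>i j. fst x $$ (i, j)) + rep_vec n (\<lambda>i. snd x $ i)"

lemma rep_mat_cong: "(\<And>i j. i < n \<Longrightarrow> j < n \<Longrightarrow> a i j = b i j) \<Longrightarrow> rep_mat n a = rep_mat n b"
  by (simp add: rep_mat_def)

lemma rep_vec_cong: "(\<And>i. i < n \<Longrightarrow> v i = w i) \<Longrightarrow> rep_vec n v = rep_vec n w"
  by (simp add: rep_vec_def)

lemma rep_mat_add: "rep_mat n (\<lambda>i j. a i j + b i j) = rep_mat n a + rep_mat n b"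
  by (simp add: rep_mat_def lop.scale_left_distrib sum.distrib)

lemma rep_vec_add: "rep_vec n (\<lambda>i. v i + w i) = rep_vec n v + rep_vec n w"
  by (simp add: rep_vec_def lop.scale_left_distrib sum.distrib)

lemma rep_mat_diff: "rep_mat n (\<lambda>i j. a i j - b i j) = rep_mat n a - rep_mat n b"
  by (simp add: rep_mat_def lop.scale_left_diff_distrib sum_subtractf)

lemma rep_vec_diff: "rep_vec n (\<lambda>i. v i - w i) = rep_vec n v - rep_vec n w"
  by (simp add: rep_vec_def lop.scale_left_diff_distrib sum_subtractf)

lemma rep_mat_scale: "rep_mat n (\<lambda>i j. c * a i j) = scl c (rep_mat n a)"
  by (simp add: rep_mat_def lop.scale_sum_right)

lemma rep_vec_scale: "rep_vec n (\<lambda>i. c * w i) = scl c (rep_vec n w)"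
  by (simp add: rep_vec_def lop.scale_sum_right)

lemma E_comm_E: "i < n \<Longrightarrow> j < n \<Longrightarrow> l < n \<Longrightarrow> m < n \<Longrightarrow>
    E n i j * E n l m - E n l m * E n i j = (if j = l then E n i m else 0) - (if m = i then E n l j else 0)"
  and E_comm_X: "i < n \<Longrightarrow> j < n \<Longrightarrow> l < n \<Longrightarrow>
    E n i j * X (vidx n l) - X (vidx n l) * E n i j = (if j = l then X (vidx n i) else 0)"
  using E_relations[of n] by blast+

lemma E_comm_rep_mat:
  assumes ij: "i < n" "j < n"
  shows "E n i j * rep_mat n b - rep_mat n b * E n i j =
    (\<Sum>m<n. scl (b j m) (E n i m)) - (\<Sum>l<n. scl (b l i) (E n l j))"
proof -
  have "E n i j * rep_mat n b - rep_mat n b * E n i j =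
      (\<Sum>l<n. \<Sum>m<n. scl (b l m) (E n i j * E n l m - E n l m * E n i j))"
    by (simp add: rep_mat_def sum_distrib_left sum_distrib_right scl_mult_left scl_mult_right
        lop.scale_right_diff_distrib sum_subtractf)
  also have "\<dots> = (\<Sum>l<n. \<Sum>m<n. (if j = l then scl (b l m) (E n i m) else 0) -
      (if m = i then scl (b l m) (E n l j) else 0))"
    by (intro sum.cong refl) (use E_comm_E[OF ij] in \<open>simp add: lop.scale_right_diff_distrib\<close>)
  also have "\<dots> = (\<Sum>l<n. (if j = l then \<Sum>m<n. scl (b l m) (E n i m) else 0) - scl (b l i) (E n l j))"
    by (intro sum.cong refl) (use ij in \<open>simp add: sum_subtractf\<close>)
  also have "\<dots> = (\<Sum>m<n. scl (b j m) (E n i m)) - (\<Sum>l<n. scl (b l i) (E n l j))"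
    using ij by (simp add: sum_subtractf)
  finally show ?thesis .
qed

lemma rep_mat_comm:
  "rep_mat n a * rep_mat n b - rep_mat n b * rep_mat n a =
    rep_mat n (\<lambda>i m. \<Sum>j<n. a i j * b j m) - rep_mat n (\<lambda>l j. \<Sum>i<n. b l i * a i j)"
proof -
  have "rep_mat n a * rep_mat n b - rep_mat n b * rep_mat n a =
      (\<Sum>i<n. \<Sum>j<n. scl (a i j) (E n i j * rep_mat n b - rep_mat n b * E n i j))"
    by (simp add: rep_mat_def[of n a] sum_distrib_left sum_distrib_right scl_mult_left scl_mult_right
        lop.scale_right_diff_distrib sum_subtractf)
  also have "\<dots> = (\<Sum>i<n. \<Sum>j<n. \<Sum>m<n. scl (a i j * b j m) (E n i m)) -
      (\<Sum>i<n. \<Sum>j<n. \<Sum>l<n. scl (b l i * a i j) (E n l j))"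
    by (simp add: E_comm_rep_mat lop.scale_right_diff_distrib lop.scale_sum_right sum_subtractf mult.commute)
  also have "(\<Sum>i<n. \<Sum>j<n. \<Sum>m<n. scl (a i j * b j m) (E n i m)) = rep_mat n (\<lambda>i m. \<Sum>j<n. a i j * b j m)"
    unfolding rep_mat_def lop.scale_sum_left by (intro sum.cong refl sum.swap)
  also have "(\<Sum>i<n. \<Sum>j<n. \<Sum>l<n. scl (b l i * a i j) (E n l j)) = rep_mat n (\<lambda>l j. \<Sum>i<n. b l i * a i j)"
  proof -
    have "(\<Sum>i<n. \<Sum>j<n. \<Sum>l<n. scl (b l i * a i j) (E n l j)) =
        (\<Sum>i<n. \<Sum>l<n. \<Sum>j<n. scl (b l i * a i j) (E n l j))"
      by (intro sum.cong refl sum.swap)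
    also have "\<dots> = (\<Sum>l<n. \<Sum>i<n. \<Sum>j<n. scl (b l i * a i j) (E n l j))"
      by (rule sum.swap)
    also have "\<dots> = (\<Sum>l<n. \<Sum>j<n. \<Sum>i<n. scl (b l i * a i j) (E n l j))"
      by (intro sum.cong refl sum.swap)
    finally show ?thesis by (simp add: rep_mat_def lop.scale_sum_left)
  qed
  finally show ?thesis .
qed

lemma rep_mat_vec_comm:
  "rep_mat n a * rep_vec n w - rep_vec n w * rep_mat n a = rep_vec n (\<lambda>i. \<Sum>j<n. a i j * w j)"
proof -
  have E: "E n i j * rep_vec n w - rep_vec n w * E n i j = scl (w j) (X (vidx n i))"
    if ij: "i < n" "j < n" for i j
  proof -
    have "E n i j * rep_vec n w - rep_vec n w * E n i j =
        (\<Sum>l<n. scl (w l) (E n i j * X (vidx n l) - X (vidx n l) * E n i j))"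
      by (simp add: rep_vec_def sum_distrib_left sum_distrib_right scl_mult_left scl_mult_right
          lop.scale_right_diff_distrib sum_subtractf)
    also have "\<dots> = (\<Sum>l<n. if j = l then scl (w l) (X (vidx n i)) else 0)"
      by (intro sum.cong refl) (use E_comm_X[OF ij] in simp)
    finally show ?thesis using ij by simp
  qed
  have "rep_mat n a * rep_vec n w - rep_vec n w * rep_mat n a =
      (\<Sum>i<n. \<Sum>j<n. scl (a i j) (E n i j * rep_vec n w - rep_vec n w * E n i j))"
    by (simp add: rep_mat_def sum_distrib_left sum_distrib_right scl_mult_left scl_mult_right
        lop.scale_right_diff_distrib sum_subtractf)
  also have "\<dots> = (\<Sum>i<n. \<Sum>j<n. scl (a i j * w j) (X (vidx n i)))"
    by (simp add: E)
  also have "\<dots> = rep_vec n (\<lambda>i. \<Sum>j<n. a i j * w j)"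
    by (simp add: rep_vec_def lop.scale_sum_left)
  finally show ?thesis .
qed

lemma rep_vec_comm: "rep_vec n v * rep_vec n w = rep_vec n w * rep_vec n v"
  unfolding rep_vec_def sum_product scl_mult_left scl_mult_right
  by (subst sum.swap) (simp add: mulop_commute mult.commute)

lemma carrier_s_lie: "carrier (s_lie n) = carrier_mat n n \<times> carrier_vec n"
  by (simp add: s_lie_def)

lemma rep_lie_add:
  assumes "x \<in> carrier (s_lie n)" "y \<in> carrier (s_lie n)"
  shows "rep n (lie_add (s_lie n) x y) = rep n x + rep n y"
proof -
  obtain A v B w where xy: "x = (A, v)" "y = (B, w)" "A \<in> carrier_mat n n" "B \<in> carrier_mat n n"
    "v \<in> carrier_vec n" "w \<in> carrier_vec n"
    using assms by (auto simp: carrier_s_lie)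
  have "rep_mat n (\<lambda>i j. (A + B) $$ (i, j)) = rep_mat n (\<lambda>i j. A $$ (i, j) + B $$ (i, j))"
    by (rule rep_mat_cong) (use xy in auto)
  moreover have "rep_vec n (\<lambda>i. (v + w) $ i) = rep_vec n (\<lambda>i. v $ i + w $ i)"
    by (rule rep_vec_cong) (use xy in auto)
  ultimately show ?thesis by (simp add: xy rep_def s_lie_def rep_mat_add rep_vec_add)
qed

lemma rep_lie_scale:
  assumes "x \<in> carrier (s_lie n)"
  shows "rep n (lie_scale (s_lie n) c x) = scl c (rep n x)"
proof -
  obtain A v where x: "x = (A, v)" "A \<in> carrier_mat n n" "v \<in> carrier_vec n"
    using assms by (auto simp: carrier_s_lie)
  have "rep_mat n (\<lambda>i j. (c \<cdot>\<^sub>m A) $$ (i, j)) = rep_mat n (\<lambda>i j. c * A $$ (i, j))"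
    by (rule rep_mat_cong) (use x in auto)
  moreover have "rep_vec n (\<lambda>i. (c \<cdot>\<^sub>v v) $ i) = rep_vec n (\<lambda>i. c * v $ i)"
    by (rule rep_vec_cong) (use x in auto)
  ultimately show ?thesis
    by (simp add: x rep_def s_lie_def rep_mat_scale rep_vec_scale lop.scale_right_distrib)
qed

lemma mat_mult_entry:
  "A \<in> carrier_mat n n \<Longrightarrow> B \<in> carrier_mat n n \<Longrightarrow> i < n \<Longrightarrow> j < n \<Longrightarrow>
    (A * B) $$ (i, j) = (\<Sum>k<n. A $$ (i, k) * B $$ (k, j))"
  by (auto simp: scalar_prod_def lessThan_atLeast0 intro!: sum.cong)

lemma mat_vec_entry:
  "A \<in> carrier_mat n n \<Longrightarrow> v \<in> carrier_vec n \<Longrightarrow> i < n \<Longrightarrow> (A *\<^sub>v v) $ i = (\<Sum>k<n. A $$ (i, k) * v $ k)"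
  by (auto simp: scalar_prod_def lessThan_atLeast0 intro!: sum.cong)

lemma rep_lie_bracket:
  assumes "x \<in> carrier (s_lie n)" "y \<in> carrier (s_lie n)"
  shows "rep n (lie_bracket (s_lie n) x y) = rep n x * rep n y - rep n y * rep n x"
proof -
  obtain A v B w where xy: "x = (A, v)" "y = (B, w)" and C: "A \<in> carrier_mat n n" "B \<in> carrier_mat n n"
    "v \<in> carrier_vec n" "w \<in> carrier_vec n"
    using assms by (auto simp: carrier_s_lie)
  define a b c d where "a = rep_mat n (\<lambda>i j. A $$ (i, j))" and "b = rep_mat n (\<lambda>i j. B $$ (i, j))"
    and "c = rep_vec n (\<lambda>i. v $ i)" and "d = rep_vec n (\<lambda>i. w $ i)"
  have "rep_mat n (\<lambda>i j. (A * B - B * A) $$ (i, j)) =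
      rep_mat n (\<lambda>i j. (\<Sum>k<n. A $$ (i, k) * B $$ (k, j)) - (\<Sum>k<n. B $$ (i, k) * A $$ (k, j)))"
    by (rule rep_mat_cong) (use C in \<open>simp add: mat_mult_entry del: index_mult_mat(1)\<close>)
  also have "\<dots> = a * b - b * a"
    unfolding rep_mat_diff a_def b_def by (rule rep_mat_comm[symmetric])
  finally have 1: "rep_mat n (\<lambda>i j. (A * B - B * A) $$ (i, j)) = a * b - b * a" .
  have "rep_vec n (\<lambda>i. (A *\<^sub>v w - B *\<^sub>v v) $ i) =
      rep_vec n (\<lambda>i. (\<Sum>k<n. A $$ (i, k) * w $ k) - (\<Sum>k<n. B $$ (i, k) * v $ k))"
    by (rule rep_vec_cong) (use C in \<open>simp add: mat_vec_entry del: index_mult_mat_vec\<close>)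
  also have "\<dots> = (a * d - d * a) - (b * c - c * b)"
    unfolding rep_vec_diff a_def b_def c_def d_def by (simp only: rep_mat_vec_comm)
  finally have 2: "rep_vec n (\<lambda>i. (A *\<^sub>v w - B *\<^sub>v v) $ i) = (a * d - d * a) - (b * c - c * b)" .
  have "rep n (lie_bracket (s_lie n) x y) = (a * b - b * a) + ((a * d - d * a) - (b * c - c * b))"
    unfolding rep_def xy s_lie_def by (simp add: 1 2)
  also have "\<dots> = (a + c) * (b + d) - (b + d) * (a + c)"
    using rep_vec_comm[of n "\<lambda>i. v $ i" "\<lambda>i. w $ i"] by (simp add: c_def d_def algebra_simps)
  finally show ?thesis by (simp add: rep_def xy a_def b_def c_def d_def)
qed

definition bas :: "nat \<Rightarrow> nat \<Rightarrow> complex mat \<times> complex vec" where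
  "bas n c = (if gcol n c < n then s_lie_mat n (grow n c) (gcol n c) else s_lie_vec n (grow n c))"

definition coef :: "nat \<Rightarrow> complex mat \<times> complex vec \<Rightarrow> nat \<Rightarrow> complex" where
  "coef n x c = (if gcol n c < n then fst x $$ (grow n c, gcol n c) else snd x $ grow n c)"

lemma bas_carrier: "bas n c \<in> carrier (s_lie n)"
  by (simp add: bas_def carrier_s_lie s_lie_mat_def s_lie_vec_def)

lemma scl_indicator: "scl (if P then 1 else 0) f = (if P then f else 0)"
  by simp

lemma rep_bas:
  assumes "c < ngen n"
  shows "rep n (bas n c) = gen n c"
proof -
  have r: "grow n c < n" using assms by (rule grow_less)
  show ?thesis
  proof (cases "gcol n c < n")
    case True
    have "rep_mat n (\<lambda>i j. fst (bas n c) $$ (i, j)) = rep_mat n (\<lambda>i j. if i = grow n c \<and> j = gcol n c then 1 else 0)"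
      by (rule rep_mat_cong) (use True in \<open>simp add: bas_def s_lie_mat_def\<close>)
    also have "\<dots> = (\<Sum>i<n. if i = grow n c then \<Sum>j<n. if j = gcol n c then E n i j else 0 else 0)"
      unfolding rep_mat_def scl_indicator by (intro sum.cong refl) (auto intro!: sum.cong)
    also have "\<dots> = E n (grow n c) (gcol n c)" using r True by simp
    finally have 1: "rep_mat n (\<lambda>i j. fst (bas n c) $$ (i, j)) = E n (grow n c) (gcol n c)" .
    have 2: "rep_vec n (\<lambda>i. snd (bas n c) $ i) = 0"
      using True by (simp add: rep_vec_def bas_def s_lie_mat_def)
    show ?thesis using True 1 2 by (simp add: rep_def gen_def)
  next
    case False
    have 1: "rep_mat n (\<lambda>i j. fst (bas n c) $$ (i, j)) = 0"
      using False by (simp add: rep_mat_def bas_def s_lie_vec_def)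
    have "rep_vec n (\<lambda>i. snd (bas n c) $ i) = (\<Sum>i<n. if i = grow n c then X (vidx n i) else 0)"
      unfolding rep_vec_def by (intro sum.cong refl) (use False r in \<open>simp add: bas_def s_lie_vec_def\<close>)
    also have "\<dots> = X (vidx n (grow n c))" using r by simp
    finally show ?thesis using False 1 by (simp add: rep_def gen_def)
  qed
qed

lemma rep_weyl: "rep n x \<in> weyl_ops (tri n)"
  unfolding rep_def rep_mat_def rep_vec_def
  by (intro weyl_ops_closed(2,4) weyl_ops_sum E_weyl X_weyl) auto

section \<open>The kernel of the representation\<close>

type_synonym s_tensor = "(complex mat \<times> complex vec) word \<Rightarrow>\<^sub>0 complex"

abbreviation free_s_lie :: "nat \<Rightarrow> (complex, s_tensor) module" where
  "free_s_lie n \<equiv> free_alg (carrier (s_lie n))"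

abbreviation rel_ideal :: "nat \<Rightarrow> s_tensor set" where
  "rel_ideal n \<equiv> Idl\<^bsub>free_s_lie n\<^esub> (enveloping_relations (s_lie n))"

lemma enveloping_relations_closed: "enveloping_relations (s_lie n) \<subseteq> carrier (free_s_lie n)"
proof -
  interpret lie_algebra "s_lie n" by (rule lie_algebra_s_lie)
  have minus: "p - q \<in> carrier (free_alg Y)" if "p \<in> carrier (free_alg Y)" "q \<in> carrier (free_alg Y)"
    for p q :: "'g word \<Rightarrow>\<^sub>0 complex" and Y
    using free_alg_closed(4)[OF that(1) free_alg_closed(6)[OF that(2)]] by simp
  show ?thesis
    unfolding enveloping_relations_def
    by (auto intro!: minus free_alg_closed letter_closed add_closed scale_closed bracket_closed)
qed

lemma ideal_rel_ideal: "ideal (rel_ideal n) (free_s_lie n)"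
  by (rule ring.genideal_ideal[OF ring_free_alg enveloping_relations_closed])

lemma relations_in_ideal: "p \<in> enveloping_relations (s_lie n) \<Longrightarrow> p \<in> rel_ideal n"
  using ring.genideal_self[OF ring_free_alg enveloping_relations_closed] by blast

lemma rel_ideal_closed:
  "0 \<in> rel_ideal n"
  "p \<in> rel_ideal n \<Longrightarrow> p' \<in> rel_ideal n \<Longrightarrow> p + p' \<in> rel_ideal n"
  "r \<in> carrier (free_s_lie n) \<Longrightarrow> p \<in> rel_ideal n \<Longrightarrow> r * p \<in> rel_ideal n"
  "r \<in> carrier (free_s_lie n) \<Longrightarrow> p \<in> rel_ideal n \<Longrightarrow> p * r \<in> rel_ideal n"
  "p \<in> rel_ideal n \<Longrightarrow> fscale c p \<in> rel_ideal n"
proof -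
  interpret I: ideal "rel_ideal n" "free_s_lie n" by (rule ideal_rel_ideal)
  show "0 \<in> rel_ideal n" using additive_subgroup.zero_closed[OF ideal.axioms(1)[OF ideal_rel_ideal]] by (simp add: free_alg_simps)
  show "p + p' \<in> rel_ideal n" if "p \<in> rel_ideal n" "p' \<in> rel_ideal n"
    using additive_subgroup.a_closed[OF ideal.axioms(1)[OF ideal_rel_ideal] that] by (simp add: free_alg_simps)
  show L: "r * p \<in> rel_ideal n" if "r \<in> carrier (free_s_lie n)" "p \<in> rel_ideal n" for r p
    using I.I_l_closed[OF that(2,1)] by (simp add: free_alg_simps)
  show "p * r \<in> rel_ideal n" if "r \<in> carrier (free_s_lie n)" "p \<in> rel_ideal n"
    using I.I_r_closed[OF that(2,1)] by (simp add: free_alg_simps)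
  show "fscale c p \<in> rel_ideal n" if "p \<in> rel_ideal n"
    using L[OF _ that] free_alg_closed(3) by blast
qed

lemma ev_single_zero: "ev \<phi> (single 0 c) = scl c 1"
  by (simp add: ev_single)

lemma ev_relations: "p \<in> enveloping_relations (s_lie n) \<Longrightarrow> ev (rep n) p = 0"
  unfolding enveloping_relations_def
  by (auto simp: ev_minus ev_add ev_mult ev_single_zero scl_mult_left rep_lie_add rep_lie_scale rep_lie_bracket)

text \<open>The letters are arbitrary elements of the Lie algebra and each relation adds two of them
  or scales one, so the expansion in the basis is built up one coordinate at a time, in the
  numbering \<open>idx\<close>.\<close>

lemma letter_lin:
  assumes x: "x \<in> carrier (s_lie n)"
  shows "letter x - (\<Sum>k<ngen n. fscale (coef n x k) (letter (bas n k))) \<in> rel_ideal n"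
proof -
  interpret lie_algebra "s_lie n" by (rule lie_algebra_s_lie)
  let ?I = "rel_ideal n"
  obtain A v where Av: "x = (A, v)" "A \<in> carrier_mat n n" "v \<in> carrier_vec n"
    using x by (auto simp: carrier_s_lie)
  define part where "part m =
    (mat n n (\<lambda>(i, j). if idx n i j < m then A $$ (i, j) else 0), vec n (\<lambda>i. if idx n i n < m then v $ i else 0))" for m
  have part_in: "part m \<in> carrier (s_lie n)" for m by (simp add: part_def carrier_s_lie)
  have idx_eq: "idx n i j = c \<longleftrightarrow> i = grow n c \<and> j = gcol n c" if "j \<le> n" for i j c
    using that by auto
  have step: "part (Suc c) = lie_add (s_lie n) (part c) (lie_scale (s_lie n) (coef n x c) (bas n c))" for c
  proof (cases "gcol n c < n")
    case True
    then show ?thesis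
      using Av idx_eq
      by (auto simp: part_def bas_def coef_def s_lie_def s_lie_mat_def less_Suc_eq intro!: eq_matI eq_vecI)
  next
    case False
    then have "gcol n c = n" using gcol_le[of n c] by simp
    moreover from this have "\<not> idx n (grow n c) n < c" using idx_grow_gcol[of n c] by simp
    ultimately show ?thesis
      using Av idx_eq
      by (auto simp: part_def bas_def coef_def s_lie_def s_lie_vec_def less_Suc_eq unit_vec_def intro!: eq_matI eq_vecI)
  qed
  have main: "letter (part m) - (\<Sum>k<m. fscale (coef n x k) (letter (bas n k))) \<in> ?I" for m
  proof (induction m)
    case 0
    \<comment> \<open>The letter of the zero element is not zero in the free algebra; the scaling
      relation with factor 0 puts it into the ideal.\<close>
    have z: "part 0 = lie_scale (s_lie n) 0 x"
      using Av by (auto simp: part_def s_lie_def intro!: eq_matI eq_vecI)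
    have "letter (lie_scale (s_lie n) 0 x) - fscale 0 (letter x) \<in> ?I"
      using x by (intro relations_in_ideal) (unfold enveloping_relations_def, blast)
    then show ?case by (simp add: z)
  next
    case (Suc m)
    let ?y = "lie_scale (s_lie n) (coef n x m) (bas n m)"
    have "letter (part (Suc m)) - (letter (part m) + letter ?y) \<in> ?I"
      unfolding step using part_in scale_closed[OF bas_carrier]
      by (intro relations_in_ideal) (unfold enveloping_relations_def, blast)
    moreover have "letter ?y - fscale (coef n x m) (letter (bas n m)) \<in> ?I"
      using bas_carrier by (intro relations_in_ideal) (unfold enveloping_relations_def, blast)
    ultimately have "(letter (part (Suc m)) - (letter (part m) + letter ?y)) +
        (letter ?y - fscale (coef n x m) (letter (bas n m))) +
        (letter (part m) - (\<Sum>k<m. fscale (coef n x k) (letter (bas n k)))) \<in> ?I"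
      using Suc.IH by (intro rel_ideal_closed(2))
    then show ?case by (simp add: algebra_simps)
  qed
  have part_x: "part (ngen n) = x"
    using Av idx_less by (auto simp: part_def intro!: eq_matI eq_vecI)
  show ?thesis using main[of "ngen n"] unfolding part_x .
qed

interpretation st: straightening "carrier (s_lie n)" "rel_ideal n" "ngen n" "bas n" "coef n"
  "lie_bracket (s_lie n)" for n
proof -
  interpret lie_algebra "s_lie n" by (rule lie_algebra_s_lie)
  show "straightening (carrier (s_lie n)) (rel_ideal n) (ngen n) (bas n) (coef n) (lie_bracket (s_lie n))"
  proof
    show "fa.subspace (rel_ideal n)"
      by (rule fa.subspaceI) (auto intro: rel_ideal_closed)
    show "letter x * letter y - letter y * letter x - letter (lie_bracket (s_lie n) x y) \<in> rel_ideal n"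
      if "x \<in> carrier (s_lie n)" "y \<in> carrier (s_lie n)" for x y
      using that by (intro relations_in_ideal) (unfold enveloping_relations_def, blast)
    show "letter x - (\<Sum>k<ngen n. fscale (coef n x k) (letter (bas n k))) \<in> rel_ideal n"
      if "x \<in> carrier (s_lie n)" for x
      using that by (rule letter_lin)
  qed (auto intro: rel_ideal_closed bas_carrier bracket_closed)
qed

lemma ev_mon: "set v \<subseteq> {..<ngen n} \<Longrightarrow> ev (rep n) (st.mon n v) = prod_list (map (gen n) v)"
  by (induction v) (auto simp: st.mon_Cons ev_mult rep_bas)

lemma prod_list_weyl: "(\<And>x. x \<in> set v \<Longrightarrow> f x \<in> weyl_ops r) \<Longrightarrow> prod_list (map f v) \<in> weyl_ops r"
  by (induction v) (auto intro: weyl_ops_closed)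

lemma ev_weyl: "ev (rep n) p \<in> weyl_ops (tri n)"
  unfolding ev_def by (intro weyl_ops_sum weyl_ops_closed(4) prod_list_weyl rep_weyl)

definition pbw :: "nat \<Rightarrow> s_tensor \<Rightarrow> laurent \<Rightarrow> laurent" where
  "pbw n p = restr (tri n) (ev (rep n) p)"

lemma pbw_hom: "pbw n \<in> Ring.ring_hom (free_s_lie n) (weyl_alg (tri n))"
  by (rule ring_hom_memI)
    (auto simp: pbw_def carrier_weyl_alg ev_weyl free_alg_simps ev_mult ev_add restr_hom weyl_alg_simps)

interpretation pbw: ring_hom_ring "free_s_lie n" "weyl_alg (tri n)" "pbw n" for n
  by (rule ring_hom_ringI2[OF ring_free_alg ring_weyl_alg pbw_hom])

lemma pbw_zero_iff: "pbw n p = \<zero>\<^bsub>weyl_alg (tri n)\<^esub> \<longleftrightarrow> ev (rep n) p = 0"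
  unfolding pbw_def using restr_inj[OF ev_weyl weyl_ops_zero] restr_zero by metis

lemma mem_kernel:
  "p \<in> a_kernel (free_s_lie n) (weyl_alg (tri n)) (pbw n) \<longleftrightarrow>
    p \<in> carrier (free_s_lie n) \<and> ev (rep n) p = 0"
  by (simp only: a_kernel_def' mem_Collect_eq pbw_zero_iff)

lemma free_alg_degree:
  assumes "p \<in> carrier (free_alg Y)"
  shows "\<exists>N. \<forall>w\<in>keys p. set (letters w) \<subseteq> Y \<and> length (letters w) \<le> N"
proof (intro exI ballI conjI)
  fix w assume "w \<in> keys p"
  then show "set (letters w) \<subseteq> Y" "length (letters w) \<le> Max ((\<lambda>w. length (letters w)) ` keys p)"
    using assms by (auto simp: free_alg_def)
qed

text \<open>Straightening turns an element of the kernel into a combination of sorted monomials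
  modulo the ideal, and independence of their images makes all coefficients vanish. Faithfulness and
  the Poincare-Birkhoff-Witt theorem for this Lie algebra are thus obtained together.\<close>

theorem kernel_eq: "a_kernel (free_s_lie n) (weyl_alg (tri n)) (pbw n) = rel_ideal n"
proof
  let ?R = "free_s_lie n"
  show *: "rel_ideal n \<subseteq> a_kernel ?R (weyl_alg (tri n)) (pbw n)"
  proof (rule ring.genideal_minimal[OF ring_free_alg pbw.kernel_is_ideal])
    show "enveloping_relations (s_lie n) \<subseteq> a_kernel ?R (weyl_alg (tri n)) (pbw n)"
      using enveloping_relations_closed[of n] ev_relations[of _ n]
      by (auto simp only: mem_kernel)
  qed
  show "a_kernel ?R (weyl_alg (tri n)) (pbw n) \<subseteq> rel_ideal n"
  proof
    fix p assume "p \<in> a_kernel ?R (weyl_alg (tri n)) (pbw n)"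
    then have p: "p \<in> carrier ?R" "ev (rep n) p = 0" by (auto simp only: mem_kernel)
    obtain N where "\<And>w. w \<in> keys p \<Longrightarrow> set (letters w) \<subseteq> carrier (s_lie n) \<and> length (letters w) \<le> N"
      using free_alg_degree[OF p(1)] by blast
    from st.poly_straightening[OF this] obtain a where
      a: "p - (\<Sum>v\<in>st.sorted_upto n N. fscale (a v) (st.mon n v)) \<in> rel_ideal n" by blast
    let ?V = "st.sorted_upto n N"
    have "ev (rep n) (p - (\<Sum>v\<in>?V. fscale (a v) (st.mon n v))) = 0"
      using subsetD[OF * a] unfolding mem_kernel by (rule conjunct2)
    then have "(\<Sum>v\<in>?V. scl (a v) (ev (rep n) (st.mon n v))) = 0"
      by (simp add: ev_minus p(2) ev_sum ev_fscale)
    moreover have "(\<Sum>v\<in>?V. scl (a v) (ev (rep n) (st.mon n v))) =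
        (\<Sum>v\<in>?V. scl (a v) (prod_list (map (gen n) v)))"
      by (intro sum.cong refl) (auto simp: ev_mon st.lists_upto_def)
    ultimately have "a v = 0" if "v \<in> ?V" for v
      using that by (intro pbw_independent[OF st.finite_sorted_upto]) (auto simp: st.lists_upto_def)
    then have "(\<Sum>v\<in>?V. fscale (a v) (st.mon n v)) = 0" by simp
    then show "p \<in> rel_ideal n" using a by simp
  qed
qed

section \<open>The enveloping algebra inside the Weyl algebra\<close>

lemma ring_quotient_alg:
  assumes "ideal I A"
  shows "ring (quotient_alg A I)"
proof -
  interpret I: ideal I A by (rule assms)
  interpret Q: ring "A Quot I" by (rule I.quotient_is_ring)
  have "id \<in> ring_iso (A Quot I) (quotient_alg A I)"
    by (rule ring_iso_memI) (auto simp: quotient_alg_def)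
  from Q.ring_iso_imp_img_ring[OF this] show ?thesis
    by (simp add: quotient_alg_def)
qed

abbreviation U :: "nat \<Rightarrow> (complex, s_tensor set) module" where
  "U n \<equiv> enveloping_alg (s_lie n)"

lemma ring_U: "ring (U n)"
  unfolding enveloping_alg_def by (rule ring_quotient_alg[OF ideal_rel_ideal])

definition emb :: "nat \<Rightarrow> s_tensor set \<Rightarrow> laurent \<Rightarrow> laurent" where
  "emb n Y = the_elem (pbw n ` Y)"

definition cls :: "nat \<Rightarrow> s_tensor \<Rightarrow> s_tensor set" where
  "cls n p = rel_ideal n +>\<^bsub>free_s_lie n\<^esub> p"

lemma carrier_U: "carrier (U n) = cls n ` carrier (free_s_lie n)"
  by (auto simp: enveloping_alg_def quotient_alg_def FactRing_def A_RCOSETS_def' cls_def)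

lemma emb_cls: "p \<in> carrier (free_s_lie n) \<Longrightarrow> emb n (cls n p) = pbw n p"
  unfolding emb_def cls_def kernel_eq[symmetric] by (rule pbw.the_elem_simp)

lemma emb_hom: "emb n \<in> Ring.ring_hom (U n) (weyl_alg (tri n))"
proof -
  have "emb n \<in> Ring.ring_hom (free_s_lie n Quot rel_ideal n) (weyl_alg (tri n))"
    using pbw.the_elem_hom[of n] unfolding kernel_eq emb_def[abs_def] .
  then show ?thesis
    by (simp add: Ring.ring_hom_def enveloping_alg_def quotient_alg_def)
qed

lemma emb_inj: "inj_on (emb n) (carrier (U n))"
proof -
  have "inj_on (emb n) (carrier (free_s_lie n Quot rel_ideal n))"
    unfolding inj_on_def emb_def using pbw.the_elem_inj[of _ n] unfolding kernel_eq by blast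
  then show ?thesis by (simp add: enveloping_alg_def quotient_alg_def)
qed

lemma cls_eqI:
  assumes "p \<in> carrier (free_s_lie n)" "p' \<in> carrier (free_s_lie n)"
    and "ev (rep n) p = ev (rep n) p'"
  shows "cls n p = cls n p'"
proof (rule inj_onD[OF emb_inj[of n]])
  show "emb n (cls n p) = emb n (cls n p')" using assms by (simp add: emb_cls pbw_def)
qed (use assms carrier_U in auto)

text \<open>Scalars of the quotient act as a union over all representatives of a coset. The union
  collapses because the representatives have the same value under \<open>ev\<close>, which by
  injectivity of \<open>emb\<close> determines the class.\<close>

lemma smult_cls:
  assumes p: "p \<in> carrier (free_s_lie n)"
  shows "c \<odot>\<^bsub>U n\<^esub> cls n p = cls n (fscale c p)"
proof -
  let ?R = "free_s_lie n"
  have sc: "fscale c x \<in> carrier ?R" if "x \<in> carrier ?R" for x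
    using that by (intro free_alg_closed)
  have mem: "x \<in> carrier ?R \<and> ev (rep n) x = ev (rep n) p" if x: "x \<in> cls n p" for x
  proof -
    obtain j where j: "j \<in> rel_ideal n" "x = j + p"
      using x by (auto simp: cls_def a_r_coset_def' free_alg_simps)
    then have "j \<in> carrier ?R" "ev (rep n) j = 0" unfolding kernel_eq[symmetric] mem_kernel by auto
    then show ?thesis using p j by (simp add: ev_add free_alg_closed)
  qed
  have "p \<in> cls n p"
    unfolding cls_def a_r_coset_def' using rel_ideal_closed(1)[of n] by (force simp: free_alg_simps)
  moreover have "cls n (fscale c x) = cls n (fscale c p)" if "x \<in> cls n p" for x
    using mem[OF that] p by (intro cls_eqI sc) (simp_all add: ev_fscale)
  ultimately have "(\<Union>x\<in>cls n p. cls n (fscale c x)) = cls n (fscale c p)"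
    by (rule UN_const)
  moreover have "c \<odot>\<^bsub>U n\<^esub> cls n p = (\<Union>x\<in>cls n p. cls n (fscale c x))"
    unfolding enveloping_alg_def quotient_alg_def by (simp add: cls_def free_alg_simps)
  ultimately show ?thesis by (rule trans[rotated])
qed

section \<open>The Ore condition\<close>

definition rep_image :: "nat \<Rightarrow> lop set" where
  "rep_image n = ev (rep n) ` carrier (free_s_lie n)"

definition filt :: "nat \<Rightarrow> nat \<Rightarrow> s_tensor set" where
  "filt n N = {p \<in> carrier (free_s_lie n). \<forall>w\<in>keys p. length (letters w) \<le> N}"

definition pbw_basis :: "nat \<Rightarrow> nat \<Rightarrow> lop set" where
  "pbw_basis n N = (\<lambda>v. prod_list (map (gen n) v)) ` (st.sorted_upto n N)"

text \<open>A sorted word is determined by its letter counts, and a word of length at most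
  \<open>N\<close> has counts between 0 and \<open>N\<close>.\<close>

lemma card_pbw_basis: "card (pbw_basis n N) \<le> (N + 1) ^ (ngen n)"
proof -
  let ?q = "ngen n" and ?V = "st.sorted_upto n N"
  let ?f = "\<lambda>v. restrict (count_list v) {..<?q}"
  have "inj_on ?f ?V"
  proof (rule inj_onI)
    fix v v' assume v: "v \<in> ?V" "v' \<in> ?V" "?f v = ?f v'"
    have "count_list v c = count_list v' c" for c
    proof (cases "c < ?q")
      case True
      then show ?thesis using fun_cong[OF v(3), of c] by simp
    next
      case False
      then have "c \<notin> set v" "c \<notin> set v'" using v(1,2) by (auto simp: st.lists_upto_def)
      then show ?thesis by (simp add: count_list_0_iff)
    qed
    then have "mset v = mset v'" by (intro multiset_eqI) (simp add: count_mset)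
    then show "v = v'" using v(1,2) by (metis (no_types, lifting) mem_Collect_eq properties_for_sort)
  qed
  moreover have "?f ` ?V \<subseteq> ({..<?q} \<rightarrow>\<^sub>E {..N})"
    by (intro image_subsetI PiE_I) (auto simp: st.lists_upto_def intro: le_trans[OF count_le_length])
  ultimately have "card ?V \<le> card ({..<?q} \<rightarrow>\<^sub>E {..N})"
    by (intro card_inj_on_le) (auto intro: finite_PiE)
  also have "\<dots> = (N + 1) ^ ?q" by (simp add: card_PiE)
  finally show ?thesis
    unfolding pbw_basis_def using card_image_le[OF st.finite_sorted_upto] le_trans by blast
qed

lemma filt_closed:
  "p \<in> filt n N \<Longrightarrow> p' \<in> filt n N \<Longrightarrow> p + p' \<in> filt n N"
  "p \<in> filt n N \<Longrightarrow> p' \<in> filt n M \<Longrightarrow> p * p' \<in> filt n (N + M)"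
  "single 0 c \<in> filt n 0"
proof -
  show "p + p' \<in> filt n N" if "p \<in> filt n N" "p' \<in> filt n N"
    using that Poly_Mapping.keys_add[of p p'] by (auto simp: filt_def free_alg_closed)
  show "p * p' \<in> filt n (N + M)" if p: "p \<in> filt n N" and p': "p' \<in> filt n M"
  proof -
    have "length (letters w) \<le> N + M" if w: "w \<in> keys (p * p')" for w
    proof -
      obtain u v where "w = u + v" "u \<in> keys p" "v \<in> keys p'" using w keys_mult[of p p'] by blast
      then show ?thesis using p p' by (auto simp: filt_def plus_word_def intro: add_mono)
    qed
    then show ?thesis using p p' by (auto simp: filt_def free_alg_closed)
  qed
  show "single 0 c \<in> filt n 0"
    by (auto simp: filt_def free_alg_closed)
qed

lemma filt_fscale: "p \<in> filt n N \<Longrightarrow> fscale c p \<in> filt n N"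
  using filt_closed(2)[OF filt_closed(3)[of c n]] by simp

lemma mon_filt: "v \<in> st.lists_upto n N \<Longrightarrow> st.mon n v \<in> filt n N"
proof -
  assume v: "v \<in> st.lists_upto n N"
  have "st.mon n v = single (Word (map (bas n) v)) 1"
    unfolding st.mon_def prod_letters[symmetric] by (simp add: comp_def)
  then show ?thesis
    using v st.mon_closed[of v n] by (simp add: filt_def st.lists_upto_def)
qed

abbreviation rep_filt :: "nat \<Rightarrow> nat \<Rightarrow> lop set" where
  "rep_filt n N \<equiv> ev (rep n) ` filt n N"

text \<open>Straightening does not increase length, so two filtrations agree: that by all words of
  bounded length, which is visibly multiplicative, and that by sorted words, whose dimension is
  visibly polynomial.\<close>

lemma ev_filt: "rep_filt n N = lop.span (pbw_basis n N)"
proof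
  let ?V = "st.sorted_upto n N"
  show "rep_filt n N \<subseteq> lop.span (pbw_basis n N)"
  proof
    fix f assume "f \<in> rep_filt n N"
    then obtain p where p: "f = ev (rep n) p" "p \<in> filt n N" by auto
    then have "\<And>w. w \<in> keys p \<Longrightarrow> set (letters w) \<subseteq> carrier (s_lie n) \<and> length (letters w) \<le> N"
      by (auto simp: filt_def free_alg_def)
    from st.poly_straightening[OF this] obtain a where
      a: "p - (\<Sum>v\<in>?V. fscale (a v) (st.mon n v)) \<in> rel_ideal n" by blast
    then have "ev (rep n) (p - (\<Sum>v\<in>?V. fscale (a v) (st.mon n v))) = 0"
      unfolding kernel_eq[symmetric] mem_kernel by (rule conjunct2)
    then have "f = (\<Sum>v\<in>?V. scl (a v) (ev (rep n) (st.mon n v)))"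
      by (simp add: p(1) ev_minus ev_sum ev_fscale)
    also have "\<dots> = (\<Sum>v\<in>?V. scl (a v) (prod_list (map (gen n) v)))"
      by (intro sum.cong refl) (auto simp: ev_mon st.lists_upto_def)
    also have "\<dots> \<in> lop.span (pbw_basis n N)"
      unfolding pbw_basis_def by (intro lop.span_sum lop.span_scale lop.span_base) auto
    finally show "f \<in> lop.span (pbw_basis n N)" .
  qed
  show "lop.span (pbw_basis n N) \<subseteq> rep_filt n N"
  proof (rule lop.span_minimal)
    show "pbw_basis n N \<subseteq> rep_filt n N"
    proof
      fix f assume "f \<in> pbw_basis n N"
      then obtain v where v: "f = prod_list (map (gen n) v)" "v \<in> st.lists_upto n N" by (auto simp: pbw_basis_def)
      then have "f = ev (rep n) (st.mon n v)" by (simp add: ev_mon st.lists_upto_def)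
      then show "f \<in> rep_filt n N" using mon_filt[OF v(2)] by blast
    qed
    show "lop.subspace (rep_filt n N)"
    proof (rule lop.subspaceI)
      show "0 \<in> rep_filt n N"
        by (rule image_eqI[of _ _ 0]) (simp_all add: filt_def free_alg_closed)
      show "f + g \<in> rep_filt n N" if "f \<in> rep_filt n N" "g \<in> rep_filt n N" for f g
        using that by (auto simp flip: ev_add intro!: imageI filt_closed)
      show "scl c f \<in> rep_filt n N" if "f \<in> rep_filt n N" for c f
        using that by (auto simp flip: ev_fscale intro!: imageI filt_fscale)
    qed
  qed
qed

lemma filt_rep_image: "rep_filt n N \<subseteq> rep_image n"
  by (auto simp: rep_image_def filt_def)

lemma rep_image_filt:
  assumes "f \<in> rep_image n" "g \<in> rep_image n"
  shows "\<exists>N. f \<in> rep_filt n N \<and> g \<in> rep_filt n N"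
proof -
  obtain p p' where p: "f = ev (rep n) p" "p \<in> carrier (free_s_lie n)"
    "g = ev (rep n) p'" "p' \<in> carrier (free_s_lie n)"
    using assms by (auto simp: rep_image_def)
  obtain N M where "\<forall>w\<in>keys p. length (letters w) \<le> N" "\<forall>w\<in>keys p'. length (letters w) \<le> M"
    using free_alg_degree[OF p(2)] free_alg_degree[OF p(4)] by blast
  then have "p \<in> filt n (max N M)" "p' \<in> filt n (max N M)" using p by (auto simp: filt_def le_max_iff_disj)
  then show ?thesis using p by blast
qed

lemma rep_image_ore:
  assumes "f \<in> rep_image n" "g \<in> rep_image n" "f \<noteq> 0" "g \<noteq> 0"
  shows "\<exists>u\<in>rep_image n. \<exists>v\<in>rep_image n. f * u = g * v \<and> f * u \<noteq> 0"
proof -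
  obtain c where c: "f \<in> rep_filt n c" "g \<in> rep_filt n c"
    using rep_image_filt[OF assms(1,2)] by blast
  have "\<exists>N. \<exists>u \<in> rep_filt n N. \<exists>v \<in> rep_filt n N. f * u = g * v \<and> f * u \<noteq> 0"
  proof (rule right_ore_by_growth[where B = "pbw_basis n" and q = "ngen n" and c = c])
    show "finite (pbw_basis n N)" for N by (simp add: pbw_basis_def st.finite_sorted_upto)
    show "h * k \<in> rep_filt n (N + M)"
      if "h \<in> rep_filt n N" "k \<in> rep_filt n M" for N M h k
      using that by (auto simp flip: ev_mult intro!: imageI filt_closed)
    show "1 \<in> rep_filt n 0"
      using filt_closed(3)[of 1 n] by (intro image_eqI[of _ _ 1]) simp_all
    show "regular h" if "h \<in> rep_filt n N" for N h
      using that regular_weyl_ops[OF ev_weyl] by auto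
  qed (use ev_filt card_pbw_basis c assms in auto)
  then show ?thesis using filt_rep_image by blast
qed

lemma rep_image_closed:
  "1 \<in> rep_image n" "f \<in> rep_image n \<Longrightarrow> g \<in> rep_image n \<Longrightarrow> f + g \<in> rep_image n" "f \<in> rep_image n \<Longrightarrow> g \<in> rep_image n \<Longrightarrow> f * g \<in> rep_image n"
  "f \<in> rep_image n \<Longrightarrow> scl c f \<in> rep_image n" "0 \<in> rep_image n"
proof -
  show "1 \<in> rep_image n" unfolding rep_image_def by (rule image_eqI[of _ _ 1]) (simp_all add: free_alg_closed)
  show "0 \<in> rep_image n" unfolding rep_image_def by (rule image_eqI[of _ _ 0]) (simp_all add: free_alg_closed)
  show "f + g \<in> rep_image n" if "f \<in> rep_image n" "g \<in> rep_image n"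
    using that unfolding rep_image_def by (auto simp flip: ev_add intro!: imageI free_alg_closed)
  show "f * g \<in> rep_image n" if "f \<in> rep_image n" "g \<in> rep_image n"
    using that unfolding rep_image_def by (auto simp flip: ev_mult intro!: imageI free_alg_closed)
  show "scl c f \<in> rep_image n" if "f \<in> rep_image n"
    using that unfolding rep_image_def by (auto simp flip: ev_fscale intro!: imageI free_alg_closed)
qed

lemma rep_image_weyl: "rep_image n \<subseteq> weyl_ops (tri n)"
  by (auto simp: rep_image_def ev_weyl)

lemma gen_rep_image: "c < ngen n \<Longrightarrow> gen n c \<in> rep_image n"
  unfolding rep_image_def
  by (rule image_eqI[of _ _ "letter (bas n c)"]) (simp_all add: rep_bas letter_closed bas_carrier)

lemma weyl_no_zero_div:
  "f \<in> weyl_ops r \<Longrightarrow> g \<in> weyl_ops r \<Longrightarrow> f * g = 0 \<Longrightarrow> f = 0 \<or> g = 0"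
  using regular_no_zero_divisors regular_weyl_ops by blast

lemma weyl_denominator:
  assumes "f \<in> weyl_ops (tri n)"
  shows "\<exists>s\<in>rep_image n. s \<noteq> 0 \<and> f * s \<in> rep_image n"
proof -
  define Q where "Q = {f \<in> weyl_ops (tri n). \<exists>s\<in>rep_image n. s \<noteq> 0 \<and> f * s \<in> rep_image n}"
  have AQ: "f \<in> Q" if "f \<in> rep_image n" for f
    unfolding Q_def using that rep_image_weyl rep_image_closed(1) by (auto intro!: bexI[of _ 1])
  have nz: "f * g \<noteq> 0" if "f \<in> rep_image n" "g \<in> rep_image n" "f \<noteq> 0" "g \<noteq> 0" for f g
    using that weyl_no_zero_div rep_image_weyl by blast
  have "weyl_ops (tri n) \<subseteq> Q"
  proof (rule weyl_ops_generated)
    show "1 \<in> Q" by (intro AQ rep_image_closed)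
    show "f + g \<in> Q" if fg: "f \<in> Q" "g \<in> Q" for f g
    proof -
      obtain s t where st: "s \<in> rep_image n" "s \<noteq> 0" "f * s \<in> rep_image n" "t \<in> rep_image n" "t \<noteq> 0" "g * t \<in> rep_image n"
        using fg by (auto simp: Q_def)
      \<comment> \<open>The common right multiple of the two denominators serves as a denominator of
        the sum.\<close>
      obtain u v where uv: "u \<in> rep_image n" "v \<in> rep_image n" "s * u = t * v" "s * u \<noteq> 0"
        using rep_image_ore[OF st(1,4,2,5)] by blast
      have "(f + g) * (s * u) = (f * s) * u + (g * t) * v"
        by (simp add: distrib_right mult.assoc) (simp add: uv(3))
      also have "\<dots> \<in> rep_image n"
        by (rule rep_image_closed(2)[OF rep_image_closed(3)[OF st(3) uv(1)] rep_image_closed(3)[OF st(6) uv(2)]])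
      finally have "(f + g) * (s * u) \<in> rep_image n" .
      moreover have "f + g \<in> weyl_ops (tri n)" using fg by (auto simp: Q_def intro: weyl_ops_closed)
      ultimately show ?thesis unfolding Q_def using rep_image_closed(3)[OF st(1) uv(1)] uv(4) by blast
    qed
    show "f * g \<in> Q" if fg: "f \<in> Q" "g \<in> Q" for f g
    proof -
      obtain s t where st: "s \<in> rep_image n" "s \<noteq> 0" "f * s \<in> rep_image n" "t \<in> rep_image n" "t \<noteq> 0" "g * t \<in> rep_image n"
        using fg by (auto simp: Q_def)
      have W: "f * g \<in> weyl_ops (tri n)" using fg by (auto simp: Q_def intro: weyl_ops_closed)
      show ?thesis
      proof (cases "g * t = 0")
        case True
        then have "f * g * t \<in> rep_image n" by (simp add: mult.assoc rep_image_closed)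
        then show ?thesis using W st by (auto simp: Q_def)
      next
        case False
        \<comment> \<open>The numerator \<open>g * t\<close> is moved past the denominator
          \<open>s\<close> of \<open>f\<close>, which leaves \<open>t * u\<close> as a denominator
          of the product. The Ore condition requires \<open>g * t\<close> to be nonzero.\<close>
        obtain u v where uv: "u \<in> rep_image n" "v \<in> rep_image n" "(g * t) * u = s * v" "(g * t) * u \<noteq> 0"
          using rep_image_ore[OF st(6,1) False st(2)] by blast
        have "(f * g) * (t * u) = f * ((g * t) * u)" by (simp add: mult.assoc)
        also have "\<dots> = (f * s) * v" unfolding uv(3) by (simp add: mult.assoc)
        also have "\<dots> \<in> rep_image n" by (rule rep_image_closed(3)[OF st(3) uv(2)])
        finally have "(f * g) * (t * u) \<in> rep_image n" .
        moreover have "t * u \<noteq> 0" using uv(4) by (auto simp: mult.assoc)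
        ultimately show ?thesis using W rep_image_closed(3)[OF st(4) uv(1)] by (auto simp: Q_def)
      qed
    qed
    show "scl c f \<in> Q" if "f \<in> Q" for c f
      using that by (auto simp: Q_def scl_mult_left intro: weyl_ops_closed rep_image_closed)
    show "Xinv v \<in> Q" if v: "v < tri n" and X: "X v \<in> Q" for v
    proof -
      obtain s where s: "s \<in> rep_image n" "s \<noteq> 0" "X v * s \<in> rep_image n" using X by (auto simp: Q_def)
      \<comment> \<open>The fraction is turned upside down: the numerator \<open>X v * s\<close> of
        the variable is a denominator of its inverse, with numerator \<open>s\<close>.\<close>
      have inv: "Xinv v * (X v * s) = s"
        using X_Xinv[of v] mulop_commute by (metis mult.assoc mult_1_left)
      then have "X v * s \<noteq> 0" using s by auto
      then show ?thesis using inv s v by (auto simp: Q_def intro!: weyl_ops_closed bexI[of _ "X v * s"])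
    qed
    show "X (vidx n i) \<in> Q" if "i < n" for i
      using gen_rep_image[OF idx_less[OF that order_refl]] by (intro AQ) (simp add: gen_def)
    show "E n i j \<in> Q" if "i < n" "j < n" for i j
      using gen_rep_image[OF idx_less[of i n j]] that by (intro AQ) (simp add: gen_def)
  qed
  then show ?thesis using assms by (auto simp: Q_def)
qed

text \<open>Multiplying two operators by their denominators moves them into the image; a common
  right multiple there is also one of the original operators.\<close>

lemma right_ore_domain_weyl_alg: "right_ore_domain (weyl_alg (tri n))"
proof -
  let ?W = "weyl_ops (tri n)" and ?S = "weyl_alg (tri n)"
  interpret S: ring ?S by (rule ring_weyl_alg)
  have zero: "restr (tri n) f = \<zero>\<^bsub>?S\<^esub> \<longleftrightarrow> f = 0" if "f \<in> ?W" for f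
    using restr_inj[OF that weyl_ops_zero] restr_zero by metis
  have mult: "restr (tri n) f \<otimes>\<^bsub>?S\<^esub> restr (tri n) g = restr (tri n) (f * g)" if "g \<in> ?W" for f g
    using restr_hom(3)[OF that] by (simp add: weyl_alg_simps)
  show ?thesis
  proof
    show "\<one>\<^bsub>?S\<^esub> \<noteq> \<zero>\<^bsub>?S\<^esub>"
      using zero[OF weyl_ops_closed(1)] restr_hom(1)[of "tri n"] by (simp add: weyl_alg_simps)
    show "a = \<zero>\<^bsub>?S\<^esub> \<or> b = \<zero>\<^bsub>?S\<^esub>"
      if ab: "a \<in> carrier ?S" "b \<in> carrier ?S" "a \<otimes>\<^bsub>?S\<^esub> b = \<zero>\<^bsub>?S\<^esub>" for a b
    proof -
      obtain f g where fg: "a = restr (tri n) f" "b = restr (tri n) g" "f \<in> ?W" "g \<in> ?W"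
        using ab by (auto simp: carrier_weyl_alg)
      then have "f * g = 0" using ab(3) zero[OF weyl_ops_closed(3)[OF fg(3,4)]] mult by simp
      then show ?thesis using weyl_no_zero_div[OF fg(3,4)] zero fg by auto
    qed
    show "\<exists>u\<in>carrier ?S. \<exists>v\<in>carrier ?S. a \<otimes>\<^bsub>?S\<^esub> u = b \<otimes>\<^bsub>?S\<^esub> v \<and> a \<otimes>\<^bsub>?S\<^esub> u \<noteq> \<zero>\<^bsub>?S\<^esub>"
      if ab: "a \<in> carrier ?S" "b \<in> carrier ?S" "a \<noteq> \<zero>\<^bsub>?S\<^esub>" "b \<noteq> \<zero>\<^bsub>?S\<^esub>" for a b
    proof -
      obtain f g where fg: "a = restr (tri n) f" "b = restr (tri n) g" "f \<in> ?W" "g \<in> ?W"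
        using ab by (auto simp: carrier_weyl_alg)
      then have nz: "f \<noteq> 0" "g \<noteq> 0" using ab(3,4) zero by auto
      obtain s t where st: "s \<in> rep_image n" "s \<noteq> 0" "f * s \<in> rep_image n" "t \<in> rep_image n" "t \<noteq> 0" "g * t \<in> rep_image n"
        using weyl_denominator[OF fg(3)] weyl_denominator[OF fg(4)] by blast
      have "f * s \<noteq> 0" "g * t \<noteq> 0" using weyl_no_zero_div fg(3,4) st nz rep_image_weyl by blast+
      then obtain u v where uv: "u \<in> rep_image n" "v \<in> rep_image n" "(f * s) * u = (g * t) * v" "(f * s) * u \<noteq> 0"
        using rep_image_ore[OF st(3,6)] by blast
      have su: "s * u \<in> ?W" "t * v \<in> ?W" using rep_image_closed(3)[of _ n] rep_image_weyl st uv by blast+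
      have "f * (s * u) = g * (t * v)" "f * (s * u) \<noteq> 0" using uv by (simp_all add: mult.assoc)
      then have "a \<otimes>\<^bsub>?S\<^esub> restr (tri n) (s * u) = b \<otimes>\<^bsub>?S\<^esub> restr (tri n) (t * v)"
        "a \<otimes>\<^bsub>?S\<^esub> restr (tri n) (s * u) \<noteq> \<zero>\<^bsub>?S\<^esub>"
        unfolding fg mult[OF su(1)] mult[OF su(2)] using zero[OF weyl_ops_closed(3)[OF fg(3) su(1)]] by simp_all
      then show ?thesis using su by (auto simp: carrier_weyl_alg)
    qed
  qed
qed

theorem theorem6:
  fixes n :: nat
  assumes "n \<ge> 1"
  shows "alg_isomorphic (skew_fraction_field (enveloping_alg (s_lie n)))
           (skew_fraction_field (weyl_alg (n * (n + 1) div 2)))"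
  unfolding tri_def[symmetric]
proof (rule alg_isomorphic_skew_fraction_field[OF ring_U right_ore_domain_weyl_alg emb_hom emb_inj])
  let ?R = "free_s_lie n" and ?S = "weyl_alg (tri n)"
  have sc: "fscale c p \<in> carrier ?R" if "p \<in> carrier ?R" for c p
    using that by (intro free_alg_closed)
  have smult: "c \<odot>\<^bsub>?S\<^esub> restr (tri n) f = restr (tri n) (scl c f)" for c f
    by (simp only: restr_hom(4) weyl_alg_simps)
  have mult: "restr (tri n) f \<otimes>\<^bsub>?S\<^esub> restr (tri n) g = restr (tri n) (f * g)"
    if "g \<in> weyl_ops (tri n)" for f g
    by (simp only: restr_hom(3)[OF that] weyl_alg_simps)
  show "c \<odot>\<^bsub>U n\<^esub> x \<in> carrier (U n)" "emb n (c \<odot>\<^bsub>U n\<^esub> x) = c \<odot>\<^bsub>?S\<^esub> emb n x"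
    if "x \<in> carrier (U n)" for c x
  proof -
    obtain p where p: "x = cls n p" "p \<in> carrier ?R" using \<open>x \<in> _\<close> unfolding carrier_U by blast
    show "c \<odot>\<^bsub>U n\<^esub> x \<in> carrier (U n)"
      unfolding p(1) smult_cls[OF p(2)] carrier_U using sc[OF p(2)] by (rule imageI)
    show "emb n (c \<odot>\<^bsub>U n\<^esub> x) = c \<odot>\<^bsub>?S\<^esub> emb n x"
      unfolding p(1) smult_cls[OF p(2)] emb_cls[OF p(2)] emb_cls[OF sc[OF p(2)]]
      by (simp only: pbw_def ev_fscale smult)
  qed
  show "c \<odot>\<^bsub>?S\<^esub> x \<in> carrier ?S" if "x \<in> carrier ?S" for c x
    using that by (auto simp: carrier_weyl_alg smult intro: weyl_ops_closed)
  show "c \<odot>\<^bsub>?S\<^esub> x \<otimes>\<^bsub>?S\<^esub> y = c \<odot>\<^bsub>?S\<^esub> (x \<otimes>\<^bsub>?S\<^esub> y)" if "x \<in> carrier ?S" "y \<in> carrier ?S" for c x y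
    using that by (auto simp: carrier_weyl_alg smult mult scl_mult_left)
  show "\<exists>s\<in>carrier (U n). emb n s \<noteq> \<zero>\<^bsub>?S\<^esub> \<and> d \<otimes>\<^bsub>?S\<^esub> emb n s \<in> emb n ` carrier (U n)"
    if d: "d \<in> carrier ?S" for d
  proof -
    obtain f where f: "d = restr (tri n) f" "f \<in> weyl_ops (tri n)" using d by (auto simp: carrier_weyl_alg)
    obtain s where s: "s \<in> rep_image n" "s \<noteq> 0" "f * s \<in> rep_image n" using weyl_denominator[OF f(2)] by blast
    \<comment> \<open>The denominator and the numerator are lifted to the free algebra, whose
      elements represent the classes in \<open>U n\<close>.\<close>
    obtain p where p0: "s = ev (rep n) p" "p \<in> carrier ?R" using s(1) unfolding rep_image_def by (rule imageE)
    obtain p' where p': "f * s = ev (rep n) p'" "p' \<in> carrier ?R" using s(3) unfolding rep_image_def by (rule imageE)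
    have p: "p \<in> carrier ?R" "ev (rep n) p \<noteq> 0" "p' \<in> carrier ?R" "f * ev (rep n) p = ev (rep n) p'"
      using p0 p' s(2) by simp_all
    have "emb n (cls n p) \<noteq> \<zero>\<^bsub>?S\<^esub>" using p by (simp add: emb_cls pbw_zero_iff)
    moreover have "d \<otimes>\<^bsub>?S\<^esub> emb n (cls n p) = emb n (cls n p')"
      unfolding emb_cls[OF p(1)] emb_cls[OF p(3)] pbw_def f(1) mult[OF ev_weyl] p(4) by (rule refl)
    ultimately show ?thesis using p by (auto simp: carrier_U)
  qed
qed

end
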